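(* Let $K$ be a primitive triangulation of a smooth $(n+1)$-dimensional lattice polytope $P$. For every sign distribution $\varepsilon\in C^0(K;\mathbb F_2)$, $$\dim H_0(\mathbb RX_\varepsilon;\mathbb F_2)\le h^{n,0}(X)+1-\kappa(K).$$
   Context: Polytope and triangulation. $M,N$ are dual lattices of rank $n+1$, $n\ge1$, with pairing $\langle-,-\rangle$; $M_2=M\otimes\mathbb F_2$, $N_2=N\otimes\mathbb F_2$. A full-dimensional lattice polytope $P\subset M\otimes\mathbb R$ is smooth if it is simple and at each vertex the primitive edge directions form a basis of $M$. A primitive triangulation $K$ of $P$ is a triangulation into lattice simplices whose maximal simplices have volume $1/(n+1)!$ (unit volume = parallelepiped on a basis of $M$); its vertices are exactly $P\cap M$. $\sigma^p$ denotes a $p$-simplex; $\sigma\le\tau$ means $\sigma$ is a face of $\tau$; a simplex (or vertex) is interior if it is not contained in $\partial P$. $T\sigma,TQ$ are linear tangent spaces. The number $\kappa(K)$. For an interior $n$-simplex $\sigma^n$ of $K$ let $v_1,v_2$ be the apices of its two adjacent $(n+1)$-simplices. There are unique $\rho_{\sigma^n}(v)\in\mathbb F_2$, $v$ a vertex of $\sigma^n$, with $\sum_{v\in\sigma^n}\rho_{\sigma^n}(v)=0$ and $\sum_{v\in\sigma^n}\rho_{\sigma^n}(v)v=v_1-v_2$ in $M_2$. $K$ fails to be $\rho$-uniform at $\sigma^n$ if $\rho_{\sigma^n}$ is not constant on the set of vertices of $\sigma^n$ lying in the interior of $P$. The distance between two simplices of $K$ is the minimum of the graph distances, in the 1-skeleton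 of $K$, between a vertex of the first and a vertex of the second. $\kappa(K)$ is the maximal number of $n$-simplices of $K$ at which $K$ fails to be $\rho$-uniform and which are pairwise at distance at least $2$. Complexes. For $\sigma\le\tau$, $[\sigma,\tau]$ is the cell of the cubical subdivision of $K$ formed by the simplices of the barycentric subdivision given by flags between $\sigma$ and $\tau$. For $\sigma$ contained in a face $Q$ of $P$, $[\sigma,Q]=\bigcup_{\sigma\le\tau\subset Q}[\sigma,\tau]$ is a ball of dimension $\dim Q-\dim\sigma$. These are the closed cells of a regular CW structure $Y$ on $P$, with $[\sigma',Q']\le[\sigma,Q]$ iff $\sigma'\ge\sigma$, $Q'\subset Q$. $X\le Y$ is the subcomplex of cells with $\dim\sigma\ge1$. Put $\sigma^*=[\sigma,P]$. Tropical Hodge numbers. $\mathrm{Sed}(Q)=(TQ^\perp\cap N)\otimes\mathbb F_2$. On $X$, $\mathcal F^X_p(\sigma,Q)=\sum_{\sigma^1\le\sigma}\bigwedge^p\big(((T\sigma^1)^\perp\cap N)\otimes\mathbb F_2/\mathrm{Sed}(Q)\big)\subset\bigwedge^p(N_2/\mathrm{Sed}(Q))$ (sum over edges of $\sigma$), a cellular cosheaf whose transition maps (from a cell to its faces) are induced by projections; $h^{p,q}(X)=\dim H_q(X;\mathcal F^X_p)$ (cellular homology). T-hypersurface. A sign distribution is an element of $C^0(K;\mathbb F_2)$. The real locus $\mathcal Y(\mathbb R)$ of the toric variety of $P$ is the quotient of $N_2\times P$ by $(u,x)\sim(u',x)$ iff $u-u'\in\mathrm{Sed}(Q_x)$, $Q_x$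 the smallest face containing $x$; $u\cdot E$ is the image of $\{u\}\times E$. $\mathbb RX_\varepsilon\subset\mathcal Y(\mathbb R)$ is the union of the cells $u\cdot(\sigma^1)^*$ over edges $\sigma^1$ of $K$ with vertices $v_0,v_1$ and $u\in N_2$ with $\langle v_0-v_1,u\rangle+\varepsilon(v_0)+\varepsilon(v_1)=1$. *)

theory Defs
  imports
    "HOL-Analysis.Analysis"
    "HOL-Homology.Homology"
    "HOL-Library.Z2"
    "HOL-Library.Function_Algebras"
    "HOL-Library.Extended_Nat"
begin

section \<open>Linear algebra over the field with two elements\<close>

text \<open>Vector spaces over \<^typ>\<open>bit\<close> other than \<open>bit ^ 'm\<close> (exterior powers, chain groups) are
  subspaces of function spaces \<open>'b \<Rightarrow> bit\<close>.\<close>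

global_interpretation F2: vector_space "\<lambda>(c::bit) (f :: 'b \<Rightarrow> bit) x. c * f x"
  defines F2_span = F2.span and F2_dependent = F2.dependent and F2_subspace = F2.subspace
  by unfold_locales (auto simp: fun_eq_iff algebra_simps)

text \<open>Dimension of the quotient \<open>U / W\<close> (for finite-dimensional quotients): the number of elements
  of a \<open>B\<close> that is mapped injectively to a basis of \<open>U / W\<close>, i.e. of a basis of a complement.\<close>

definition complement_basis :: "('b \<Rightarrow> bit) set \<Rightarrow> ('b \<Rightarrow> bit) set \<Rightarrow> ('b \<Rightarrow> bit) set \<Rightarrow> bool" where
  "complement_basis U W B \<longleftrightarrow>
     finite B \<and> \<not> F2_dependent B \<and> F2_span B \<inter> W = {0} \<and> {b + w |b w. b \<in> F2_span B \<and> w \<in> W} = U"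

definition quot_dim :: "('b \<Rightarrow> bit) set \<Rightarrow> ('b \<Rightarrow> bit) set \<Rightarrow> nat" where
  "quot_dim U W = (THE k. \<exists>B. complement_basis U W B \<and> card B = k)"

lemma complement_basis_card_le:
  assumes W: "F2_subspace W" and B: "complement_basis U W B" and C: "complement_basis U W C"
  shows "card B \<le> card C"
proof -
  have neg: "- x = x" for x :: "'a \<Rightarrow> bit" by (auto simp: fun_eq_iff)
  have "\<forall>b\<in>F2_span B. \<exists>c\<in>F2_span C. b + c \<in> W"
  proof
    fix b assume "b \<in> F2_span B"
    then have "b \<in> U" using B F2.subspace_0[OF W]
      unfolding complement_basis_def by (force intro: exI[of _ b] exI[of _ 0])
    then obtain c w where "c \<in> F2_span C" "w \<in> W" "b = c + w"
      using C unfolding complement_basis_def by blast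
    moreover have "(c + w) + c = w" by (rule ext) (simp add: add.commute)
    ultimately show "\<exists>c\<in>F2_span C. b + c \<in> W" by metis
  qed
  then obtain f where f: "\<And>b. b \<in> F2_span B \<Longrightarrow> f b \<in> F2_span C \<and> b + f b \<in> W" by metis
  have uniqC: "x = y" if "x \<in> F2_span C" "y \<in> F2_span C" "x + y \<in> W" for x y
  proof -
    have "x + y = 0" using C F2.span_add[OF that(1,2)] that(3) unfolding complement_basis_def by blast
    then show ?thesis by (metis neg eq_neg_iff_add_eq_0)
  qed
  have uniqB: "x = y" if "x \<in> F2_span B" "y \<in> F2_span B" "x + y \<in> W" for x y
  proof -
    have "x + y = 0" using B F2.span_add[OF that(1,2)] that(3) unfolding complement_basis_def by blast
    then show ?thesis by (metis neg eq_neg_iff_add_eq_0)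
  qed
  have inj: "inj_on f (F2_span B)"
  proof (rule inj_onI)
    fix x y assume xy: "x \<in> F2_span B" "y \<in> F2_span B" "f x = f y"
    have "(x + f x) + (y + f y) \<in> W" using f xy F2.subspace_add[OF W] by blast
    moreover have "(x + f x) + (y + f y) = x + y" using xy(3) by (auto simp: fun_eq_iff)
    ultimately show "x = y" using uniqB xy by metis
  qed
  have add: "f (x + y) = f x + f y" if "x \<in> F2_span B" "y \<in> F2_span B" for x y
  proof (rule uniqC)
    show "f (x + y) \<in> F2_span C" "f x + f y \<in> F2_span C"
      using f F2.span_add that by blast+
    have "((x + y) + f (x + y)) + ((x + f x) + (y + f y)) \<in> W"
      using f[of x] f[of y] f[of "x + y"] that F2.span_add[OF that] F2.subspace_add[OF W] by blast
    moreover have "((x + y) + f (x + y)) + ((x + f x) + (y + f y)) = f (x + y) + (f x + f y)"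
    proof
      fix t
      show "(((x + y) + f (x + y)) + ((x + f x) + (y + f y))) t = (f (x + y) + (f x + f y)) t"
        by (cases "x t"; cases "y t") auto
    qed
    ultimately show "f (x + y) + (f x + f y) \<in> W" by simp
  qed
  have f0: "f 0 = 0" using add[OF F2.span_zero F2.span_zero] by simp
  have sumf: "f (\<Sum>b\<in>S. b) = (\<Sum>b\<in>S. f b)" if "finite S" "S \<subseteq> B" for S
    using that
  proof (induction S rule: finite_induct)
    case empty show ?case by (simp only: sum.empty f0)
  next
    case (insert x F)
    then have "x \<in> F2_span B" "(\<Sum>b\<in>F. b) \<in> F2_span B"
      by (auto intro: F2.span_base F2.span_sum)
    then have "f (x + (\<Sum>b\<in>F. b)) = f x + f (\<Sum>b\<in>F. b)" by (rule add)
    moreover have "f (\<Sum>b\<in>F. b) = (\<Sum>b\<in>F. f b)" using insert by blast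
    ultimately show ?case by (simp only: sum.insert[OF insert(1,2)])
  qed
  have finB: "finite B" and finC: "finite C" using B C by (auto simp: complement_basis_def)
  have sub: "B \<subseteq> F2_span B" by (simp add: F2.span_superset)
  have "\<not> F2_dependent (f ` B)"
  proof
    assume "F2_dependent (f ` B)"
    then obtain u v where u: "(\<Sum>v\<in>f ` B. (\<lambda>x. u v * v x)) = 0" "v \<in> f ` B" "u v \<noteq> (0::bit)"
      using F2.dependent_finite[of "f ` B"] finB by auto
    define S where "S = {b \<in> B. u (f b) \<noteq> 0}"
    have "(\<Sum>v\<in>f ` B. (\<lambda>x. u v * v x)) = (\<Sum>b\<in>B. (\<lambda>x. u (f b) * f b x))"
      using inj_on_subset[OF inj sub] by (simp add: sum.reindex)
    also have "\<dots> = (\<Sum>b\<in>S. f b)"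
      by (rule sum.mono_neutral_cong_right) (auto simp: S_def finB fun_eq_iff)
    also have "\<dots> = f (\<Sum>b\<in>S. b)" by (rule sumf[symmetric]) (auto simp: S_def finB)
    finally have "f (\<Sum>b\<in>S. b) = f 0" using u f0 by simp
    moreover have "(\<Sum>b\<in>S. b) \<in> F2_span B" by (rule F2.span_sum) (auto simp: S_def intro: F2.span_base)
    ultimately have "(\<Sum>b\<in>S. b) = 0" using inj F2.span_zero by (meson inj_onD)
    moreover have "(\<Sum>b\<in>B. (\<lambda>x. u (f b) * b x)) = (\<Sum>b\<in>S. b)"
      by (rule sum.mono_neutral_cong_right) (auto simp: S_def finB fun_eq_iff)
    ultimately have "F2_dependent B"
      using u F2.dependent_finite[OF finB] by auto
    then show False using B by (simp add: complement_basis_def)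
  qed
  moreover have "f ` B \<subseteq> F2_span C" using f sub by blast
  ultimately have "card (f ` B) \<le> card C"
    using F2.independent_span_bound[OF finC] by blast
  then show ?thesis using card_image[OF inj_on_subset[OF inj sub]] by simp
qed

lemma quot_dim_eq:
  assumes "F2_subspace W" "complement_basis U W B"
  shows "quot_dim U W = card B"
  unfolding quot_dim_def
  using assms by (blast intro: the_equality le_antisym complement_basis_card_le)


section \<open>Lattice polytopes and primitive triangulations\<close>

text \<open>Coordinates are chosen on the lattices: \<open>M = N = \<int>\<^sup>n\<^sup>+\<^sup>1\<close> with the standard pairing, where
  \<open>n + 1 = CARD('m)\<close>; \<open>M \<otimes> \<real>\<close> is \<open>real ^ 'm\<close>, and \<open>M\<^sub>2\<close>, \<open>N\<^sub>2\<close> are \<open>bit ^ 'm\<close>.\<close>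

definition lat :: "(real ^ 'm) set" where
  "lat = {x. \<forall>i. x $ i \<in> \<int>}"

definition mod2 :: "real ^ 'm \<Rightarrow> bit ^ 'm" where
  "mod2 x = (\<chi> i. of_int \<lfloor>x $ i\<rfloor>)"

definition pair2 :: "bit ^ 'm \<Rightarrow> bit ^ 'm \<Rightarrow> bit" where
  "pair2 a u = (\<Sum>i\<in>UNIV. a $ i * u $ i)"

definition primitive_vector :: "real ^ 'm \<Rightarrow> bool" where
  "primitive_vector u \<longleftrightarrow>
     u \<in> lat \<and> u \<noteq> 0 \<and> (\<forall>w\<in>lat. \<forall>k::nat. u = real k *\<^sub>R w \<longrightarrow> k = 1)"

definition lattice_basis :: "(real ^ 'm) set \<Rightarrow> bool" where
  "lattice_basis B \<longleftrightarrow>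
     independent B \<and> lat = {\<Sum>b\<in>B. of_int (c b) *\<^sub>R b | c :: real ^ 'm \<Rightarrow> int. True}"

definition lattice_polytope :: "(real ^ 'm) set \<Rightarrow> bool" where
  "lattice_polytope P \<longleftrightarrow> (\<exists>V. finite V \<and> V \<subseteq> lat \<and> P = convex hull V)"

definition simple_polytope :: "(real ^ 'm) set \<Rightarrow> bool" where
  "simple_polytope P \<longleftrightarrow>
     (\<forall>v. v extreme_point_of P \<longrightarrow> int (card {F. F facet_of P \<and> v \<in> F}) = aff_dim P)"

definition edge_directions :: "(real ^ 'm) set \<Rightarrow> real ^ 'm \<Rightarrow> (real ^ 'm) set" where
  "edge_directions P v =
     {u. primitive_vector u \<and> (\<exists>E t. E edge_of P \<and> v \<in> E \<and> t > 0 \<and> v + t *\<^sub>R u \<in> E)}"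

definition smooth_polytope :: "(real ^ 'm) set \<Rightarrow> bool" where
  "smooth_polytope P \<longleftrightarrow>
     lattice_polytope P \<and> aff_dim P = int CARD('m) \<and> simple_polytope P \<and>
     (\<forall>v. v extreme_point_of P \<longrightarrow> lattice_basis (edge_directions P v))"

definition verts :: "(real ^ 'm) set \<Rightarrow> (real ^ 'm) set" where
  "verts \<sigma> = {v. v extreme_point_of \<sigma>}"

text \<open>The library's simplicial complexes are closed under all faces, so \<open>{} \<in> K\<close>.\<close>

definition primitive_triangulation :: "(real ^ 'm) set \<Rightarrow> (real ^ 'm) set set \<Rightarrow> bool" where
  "primitive_triangulation P K \<longleftrightarrow>
     simplicial_complex K \<and> \<Union>K = P \<and> (\<forall>\<sigma>\<in>K. verts \<sigma> \<subseteq> lat) \<and>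
     (\<forall>\<sigma>\<in>K. (\<forall>\<tau>\<in>K. \<sigma> \<subseteq> \<tau> \<longrightarrow> \<tau> = \<sigma>) \<longrightarrow> measure lebesgue \<sigma> = 1 / fact CARD('m))"


section \<open>The number \<open>\<kappa>(K)\<close>\<close>

definition interior_simplices ::
  "(real ^ 'm) set \<Rightarrow> (real ^ 'm) set set \<Rightarrow> int \<Rightarrow> (real ^ 'm) set set" where
  "interior_simplices P K d = {\<sigma>\<in>K. aff_dim \<sigma> = d \<and> \<not> \<sigma> \<subseteq> frontier P}"

definition apices :: "(real ^ 'm) set set \<Rightarrow> (real ^ 'm) set \<Rightarrow> (real ^ 'm) set" where
  "apices K \<sigma> = {v. \<exists>\<tau>\<in>K. aff_dim \<tau> = aff_dim \<sigma> + 1 \<and> \<sigma> \<subseteq> \<tau> \<and> v \<in> verts \<tau> - \<sigma>}"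

text \<open>Values off the vertices of \<open>\<sigma>\<close> are set to \<open>0\<close> so that uniqueness holds.\<close>

definition rho :: "(real ^ 'm) set set \<Rightarrow> (real ^ 'm) set \<Rightarrow> real ^ 'm \<Rightarrow> bit" where
  "rho K \<sigma> = (THE r. (\<forall>v. v \<notin> verts \<sigma> \<longrightarrow> r v = 0) \<and> (\<Sum>v\<in>verts \<sigma>. r v) = 0 \<and>
     (\<exists>v1 v2. v1 \<noteq> v2 \<and> apices K \<sigma> = {v1, v2} \<and>
        (\<Sum>v\<in>verts \<sigma>. r v *s mod2 v) = mod2 (v1 - v2)))"

definition non_uniform :: "(real ^ 'm) set \<Rightarrow> (real ^ 'm) set set \<Rightarrow> (real ^ 'm) set set" where
  "non_uniform P K =
     {\<sigma> \<in> interior_simplices P K (int CARD('m) - 1).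
        \<exists>v\<in>verts \<sigma> \<inter> interior P. \<exists>w\<in>verts \<sigma> \<inter> interior P. rho K \<sigma> v \<noteq> rho K \<sigma> w}"

definition skeleton1 :: "(real ^ 'm) set set \<Rightarrow> ((real ^ 'm) \<times> (real ^ 'm)) set" where
  "skeleton1 K = {(v, w). v \<noteq> w \<and> closed_segment v w \<in> K}"

definition graph_dist :: "(real ^ 'm) set set \<Rightarrow> real ^ 'm \<Rightarrow> real ^ 'm \<Rightarrow> enat" where
  "graph_dist K v w = (INF k\<in>{k. (v, w) \<in> skeleton1 K ^^ k}. enat k)"

definition simplex_dist :: "(real ^ 'm) set set \<Rightarrow> (real ^ 'm) set \<Rightarrow> (real ^ 'm) set \<Rightarrow> enat" where
  "simplex_dist K \<sigma> \<tau> = (INF v\<in>verts \<sigma>. INF w\<in>verts \<tau>. graph_dist K v w)"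

definition kappa :: "(real ^ 'm) set \<Rightarrow> (real ^ 'm) set set \<Rightarrow> nat" where
  "kappa P K = Max (card ` {S. S \<subseteq> non_uniform P K \<and> pairwise (\<lambda>\<sigma> \<tau>. simplex_dist K \<sigma> \<tau> \<ge> 2) S})"


section \<open>Exterior powers of \<open>N\<^sub>2\<close> and of its quotients\<close>

text \<open>An element of the exterior algebra of \<open>bit ^ 'm\<close> is given by its coordinates in the basis
  \<open>e\<^sub>S\<close>, \<open>S \<subseteq> 'm\<close>. In characteristic two no signs occur: \<open>e\<^sub>S \<and> e\<^sub>T\<close> is \<open>e\<^sub>S\<^sub>\<union>\<^sub>T\<close> for disjoint \<open>S\<close>, \<open>T\<close>,
  and \<open>0\<close> otherwise.\<close>

type_synonym 'm ext = "'m set \<Rightarrow> bit"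

definition wedge :: "'m::finite ext \<Rightarrow> 'm ext \<Rightarrow> 'm ext" where
  "wedge x y = (\<lambda>S. \<Sum>T\<in>Pow S. x T * y (S - T))"

definition ext_vec :: "bit ^ 'm \<Rightarrow> 'm::finite ext" where
  "ext_vec v = (\<lambda>S. \<Sum>i\<in>UNIV. of_bool (S = {i}) * v $ i)"

definition wedge_list :: "(bit ^ 'm) list \<Rightarrow> 'm::finite ext" where
  "wedge_list vs = foldr (\<lambda>v. wedge (ext_vec v)) vs (\<lambda>S. of_bool (S = {}))"

text \<open>\<open>ext_power p U\<close> is \<open>\<And>\<^sup>p U \<subseteq> \<And>\<^sup>p N\<^sub>2\<close> for a subspace \<open>U\<close>, and \<open>ext_kernel p W = W \<and> \<And>\<^sup>p\<^sup>-\<^sup>1 N\<^sub>2\<close> is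
  the kernel of \<open>\<And>\<^sup>p N\<^sub>2 \<rightarrow> \<And>\<^sup>p (N\<^sub>2 / W)\<close>.\<close>

definition ext_power :: "nat \<Rightarrow> (bit ^ 'm) set \<Rightarrow> 'm::finite ext set" where
  "ext_power p U = F2_span {wedge_list vs | vs. length vs = p \<and> set vs \<subseteq> U}"

definition ext_kernel :: "nat \<Rightarrow> (bit ^ 'm) set \<Rightarrow> 'm::finite ext set" where
  "ext_kernel p W = F2_span {wedge_list vs | vs. length vs = p \<and> set vs \<inter> W \<noteq> {}}"


section \<open>Tropical Hodge numbers of \<open>X\<close>\<close>

text \<open>The image of \<open>((T S)\<^sup>\<bottom> \<inter> N) \<otimes> F\<^sub>2\<close> in \<open>N\<^sub>2\<close>; for a face \<open>Q\<close> of \<open>P\<close> this is \<open>Sed(Q)\<close>. As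
  \<open>(T S)\<^sup>\<bottom> \<inter> N\<close> is saturated in \<open>N\<close>, the tensor product maps injectively to \<open>N\<^sub>2\<close>.\<close>

definition perp2 :: "(real ^ 'm) set \<Rightarrow> (bit ^ 'm) set" where
  "perp2 S = mod2 ` {u\<in>lat. \<forall>x\<in>S. \<forall>y\<in>S. u \<bullet> (x - y) = 0}"

abbreviation Sed :: "(real ^ 'm) set \<Rightarrow> (bit ^ 'm) set" where
  "Sed Q \<equiv> perp2 Q"

text \<open>The cell \<open>[\<sigma>, Q]\<close> is indexed by the pair \<open>(\<sigma>, Q)\<close>.\<close>

type_synonym 'm cell = "(real ^ 'm) set \<times> (real ^ 'm) set"

definition X_cells :: "(real ^ 'm) set \<Rightarrow> (real ^ 'm) set set \<Rightarrow> int \<Rightarrow> 'm cell set" where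
  "X_cells P K q = {(\<sigma>, Q). \<sigma> \<in> K \<and> aff_dim \<sigma> \<ge> 1 \<and> Q face_of P \<and> \<sigma> \<subseteq> Q \<and>
                            aff_dim Q - aff_dim \<sigma> = q}"

definition cell_le :: "'m cell \<Rightarrow> 'm cell \<Rightarrow> bool" where
  "cell_le = (\<lambda>(\<sigma>', Q') (\<sigma>, Q). \<sigma> \<subseteq> \<sigma>' \<and> Q' \<subseteq> Q)"

text \<open>Elements of \<open>\<And>\<^sup>p (N\<^sub>2 / Sed(Q)) = \<And>\<^sup>p N\<^sub>2 / ext_kernel p (Sed Q)\<close> are treated through
  representatives in \<open>\<And>\<^sup>p N\<^sub>2\<close>, as relative cycles are treated in \<^theory>\<open>HOL-Homology.Homology_Groups\<close>:
  \<open>cosheaf K p (\<sigma>, Q)\<close> is the preimage of \<open>F\<^sub>p(\<sigma>, Q)\<close> in \<open>\<And>\<^sup>p N\<^sub>2\<close>. Since \<open>Sed(Q) \<subseteq> Sed(Q')\<close> for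
  \<open>Q' \<subseteq> Q\<close>, the transition maps are the identity on representatives.\<close>

definition cosheaf_zero :: "nat \<Rightarrow> 'm::finite cell \<Rightarrow> 'm ext set" where
  "cosheaf_zero p = (\<lambda>(\<sigma>, Q). ext_kernel p (Sed Q))"

definition cosheaf :: "(real ^ 'm) set set \<Rightarrow> nat \<Rightarrow> 'm::finite cell \<Rightarrow> 'm ext set" where
  "cosheaf K p = (\<lambda>(\<sigma>, Q). F2_span (ext_kernel p (Sed Q) \<union>
     (\<Union>\<sigma>1\<in>{\<sigma>1\<in>K. aff_dim \<sigma>1 = 1 \<and> \<sigma>1 \<subseteq> \<sigma>}. ext_power p (perp2 \<sigma>1))))"

text \<open>Cellular chains with coefficients in subspaces \<open>G\<close>, and the cellular boundary; in a regular
  CW complex all incidence numbers of a cell and its codimension one faces are \<open>1\<close> modulo two.\<close>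

type_synonym 'm cchain = "'m cell \<times> 'm set \<Rightarrow> bit"

definition cell_chains :: "'m::finite cell set \<Rightarrow> ('m cell \<Rightarrow> 'm ext set) \<Rightarrow> 'm cchain set" where
  "cell_chains C G = {c. (\<forall>a\<in>C. (\<lambda>S. c (a, S)) \<in> G a) \<and> (\<forall>a S. a \<notin> C \<longrightarrow> c (a, S) = 0)}"

definition cell_boundary ::
  "(real ^ 'm) set \<Rightarrow> (real ^ 'm) set set \<Rightarrow> int \<Rightarrow> 'm::finite cchain \<Rightarrow> 'm cchain" where
  "cell_boundary P K q c = (\<lambda>(a', S). if a' \<in> X_cells P K (q - 1)
     then \<Sum>a\<in>{a\<in>X_cells P K q. cell_le a' a}. c (a, S) else 0)"

definition hodge_cycles ::
  "(real ^ 'm) set \<Rightarrow> (real ^ 'm) set set \<Rightarrow> nat \<Rightarrow> int \<Rightarrow> 'm::finite cchain set" where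
  "hodge_cycles P K p q = {c \<in> cell_chains (X_cells P K q) (cosheaf K p).
     cell_boundary P K q c \<in> cell_chains (X_cells P K (q - 1)) (cosheaf_zero p)}"

definition hodge_boundaries ::
  "(real ^ 'm) set \<Rightarrow> (real ^ 'm) set set \<Rightarrow> nat \<Rightarrow> int \<Rightarrow> 'm::finite cchain set" where
  "hodge_boundaries P K p q = {cell_boundary P K (q + 1) d + e | d e.
     d \<in> cell_chains (X_cells P K (q + 1)) (cosheaf K p) \<and>
     e \<in> cell_chains (X_cells P K q) (cosheaf_zero p)}"

definition hodge :: "(real ^ 'm) set \<Rightarrow> (real ^ 'm) set set \<Rightarrow> nat \<Rightarrow> nat \<Rightarrow> nat" where
  "hodge P K p q = quot_dim (hodge_cycles P K p (int q)) (hodge_boundaries P K p (int q))"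


section \<open>Singular homology with coefficients modulo two\<close>

type_synonym 'a chain2 = "((nat \<Rightarrow> real) \<Rightarrow> 'a) \<Rightarrow> bit"

definition chains2 :: "nat \<Rightarrow> 'a topology \<Rightarrow> 'a chain2 set" where
  "chains2 p X = {c. finite {f. c f \<noteq> 0} \<and> (\<forall>f. c f \<noteq> 0 \<longrightarrow> singular_simplex p X f)}"

definition boundary2 :: "nat \<Rightarrow> 'a chain2 \<Rightarrow> 'a chain2" where
  "boundary2 p c = (if p = 0 then 0 else
     (\<lambda>g. \<Sum>f\<in>{f. c f \<noteq> 0}. \<Sum>k\<le>p. c f * of_bool (g = singular_face p k f)))"

definition betti2 :: "nat \<Rightarrow> 'a topology \<Rightarrow> nat" where
  "betti2 p X = quot_dim {c\<in>chains2 p X. boundary2 p c = 0} (boundary2 (Suc p) ` chains2 (Suc p) X)"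


section \<open>The real toric variety and the T-hypersurface\<close>

definition smallest_face :: "(real ^ 'm) set \<Rightarrow> real ^ 'm \<Rightarrow> (real ^ 'm) set" where
  "smallest_face P x = \<Inter>{Q. Q face_of P \<and> x \<in> Q}"

definition toric_class ::
  "(real ^ 'm) set \<Rightarrow> (bit ^ 'm) \<times> (real ^ 'm) \<Rightarrow> ((bit ^ 'm) \<times> (real ^ 'm)) set" where
  "toric_class P = (\<lambda>(u, x). {(u', x') | u' x'. x' = x \<and> u - u' \<in> Sed (smallest_face P x)})"

definition toric_cover :: "(real ^ 'm) set \<Rightarrow> ((bit ^ 'm) \<times> (real ^ 'm)) topology" where
  "toric_cover P = prod_topology (discrete_topology UNIV) (top_of_set P)"

definition real_toric_variety ::
  "(real ^ 'm) set \<Rightarrow> ((bit ^ 'm) \<times> (real ^ 'm)) set topology" where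
  "real_toric_variety P = topology (\<lambda>U. U \<subseteq> toric_class P ` topspace (toric_cover P) \<and>
     openin (toric_cover P) {z \<in> topspace (toric_cover P). toric_class P z \<in> U})"

lemma quotient_map_toric_class:
  "quotient_map (toric_cover P) (real_toric_variety P) (toric_class P)"
proof -
  let ?C = "toric_cover P" and ?f = "toric_class P"
  let ?o = "\<lambda>U. U \<subseteq> ?f ` topspace ?C \<and> openin ?C {z \<in> topspace ?C. ?f z \<in> U}"
  have 1: "{z \<in> topspace ?C. ?f z \<in> S \<inter> T} = {z \<in> topspace ?C. ?f z \<in> S} \<inter> {z \<in> topspace ?C. ?f z \<in> T}"
    for S T by auto
  have 2: "{z \<in> topspace ?C. ?f z \<in> \<Union>\<K>} = (\<Union>S\<in>\<K>. {z \<in> topspace ?C. ?f z \<in> S})" for \<K>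
    by auto
  have "istopology ?o"
    unfolding istopology_def 1 2
    by (intro conjI allI impI openin_Int openin_Union) auto
  then have o: "openin (real_toric_variety P) = ?o"
    by (simp add: real_toric_variety_def topology_inverse')
  have "?o (?f ` topspace ?C)"
  proof -
    have "{z \<in> topspace ?C. ?f z \<in> ?f ` topspace ?C} = topspace ?C" by blast
    then show ?thesis by simp
  qed
  then have "topspace (real_toric_variety P) = ?f ` topspace ?C"
    unfolding topspace_def[of "real_toric_variety P"] o by blast
  then show ?thesis by (auto simp: quotient_map_def o)
qed

definition barycenter :: "(real ^ 'm) set \<Rightarrow> real ^ 'm" where
  "barycenter \<sigma> = (1 / real (card (verts \<sigma>))) *\<^sub>R (\<Sum>v\<in>verts \<sigma>. v)"

definition cubical_cell ::
  "(real ^ 'm) set set \<Rightarrow> (real ^ 'm) set \<Rightarrow> (real ^ 'm) set \<Rightarrow> (real ^ 'm) set" where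
  "cubical_cell K \<sigma> \<tau> = \<Union>{convex hull (barycenter ` F) | F.
     F \<subseteq> K \<and> (\<forall>\<alpha>\<in>F. \<forall>\<beta>\<in>F. \<alpha> \<subseteq> \<beta> \<or> \<beta> \<subseteq> \<alpha>) \<and> (\<forall>\<alpha>\<in>F. \<sigma> \<subseteq> \<alpha> \<and> \<alpha> \<subseteq> \<tau>)}"

definition face_cell ::
  "(real ^ 'm) set set \<Rightarrow> (real ^ 'm) set \<Rightarrow> (real ^ 'm) set \<Rightarrow> (real ^ 'm) set" where
  "face_cell K \<sigma> Q = (\<Union>\<tau>\<in>{\<tau>\<in>K. \<sigma> \<subseteq> \<tau> \<and> \<tau> \<subseteq> Q}. cubical_cell K \<sigma> \<tau>)"

definition T_hypersurface ::
  "(real ^ 'm) set \<Rightarrow> (real ^ 'm) set set \<Rightarrow> (real ^ 'm \<Rightarrow> bit) \<Rightarrow> ((bit ^ 'm) \<times> (real ^ 'm)) set set" where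
  "T_hypersurface P K \<epsilon> = \<Union>{toric_class P ` ({u} \<times> face_cell K (closed_segment v0 v1) P) | u v0 v1.
     v0 \<noteq> v1 \<and> closed_segment v0 v1 \<in> K \<and> pair2 (mod2 (v0 - v1)) u + \<epsilon> v0 + \<epsilon> v1 = 1}"

end

theory Submission
  imports Defs
begin

text \<open>Let \<open>d = n + 1\<close>. A function \<open>f\<close> with values in the field of two elements on the set of path
  components of the hypersurface is recorded on each maximal simplex \<open>T\<close> by a function \<open>F\<^sub>T\<close> on
  \<open>N\<^sub>2\<close>, the value at \<open>u\<close> being that of \<open>f\<close> at the barycentre of \<open>T\<close> in the sheet with index \<open>u\<close>.
  In exactly one sheet the signs are constant on the vertices of \<open>T\<close>, so that the hypersurface does
  not meet \<open>T\<close> there; the missing value is defined by \<open>\<Sum>\<^sub>u F\<^sub>T(u) = 0\<close>. For two maximal simplices with a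
  common ridge (a face of dimension \<open>n\<close>) the difference of the two functions is supported on the two
  sheets in which the ridge is not crossed. These differ by the vector \<open>l\<close> that is orthogonal to the
  ridge, and since the sums vanish the difference is constant on this pair. Hence the first moments
  \<open>w\<^sub>T = \<Sum>\<^sub>u F\<^sub>T(u) u\<close> change across the ridge by a multiple of \<open>l\<close>. Over a ridge in a facet \<open>Q\<close> of \<open>P\<close>
  the function \<open>F\<^sub>T\<close> is invariant under \<open>Sed Q\<close>, and \<open>w\<^sub>T\<close> is orthogonal to the ridge
  (\<open>weight_balanced\<close>).

  Families \<open>w\<close> with these properties, the balanced weights, are the linear functionals on
  \<open>H\<^sub>0(X; F\<^sub>n)\<close>: an element of \<open>\<And>\<^sup>n N\<^sub>2\<close> on each maximal simplex is paired with \<open>w\<^sub>T\<close> by the wedge product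
  with values in \<open>\<And>\<^sup>d N\<^sub>2\<close>. So there are at most \<open>2 ^ h\<close> of them, where \<open>h\<close> is the Hodge number
  \<open>h\<^sup>n\<^sup>,\<^sup>0\<close> (\<open>card_balanced_weights\<close>).

  If all moments vanish, the functions \<open>F\<^sub>T\<close> agree across every ridge, hence all of them are the same
  function, because the maximal simplices are connected through ridges. This function is invariant
  under the groups \<open>Sed Q\<close> of all facets, which generate \<open>N\<^sub>2\<close> since \<open>P\<close> is smooth at a vertex.
  Therefore \<open>f\<close> is constant (\<open>weight_zero_constant\<close>). With \<open>\<kappa> = 0\<close> this gives the bound \<open>h + 1\<close> for the
  dimension of the space of the functions \<open>f\<close>, that is, for the number of path components.

  The gain of \<open>\<kappa>\<close> comes from balanced weights that are not moments. An interior vertex \<open>v\<close> of the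
  triangulation defines a balanced weight, the family of the linear parts of the barycentric
  coordinate of \<open>v\<close>. Let \<open>v\<close> be a vertex of an interior ridge \<open>S\<close>. If this weight were the moment of some
  \<open>f\<close> near \<open>S - {v}\<close>, then the jumps of the functions \<open>F\<^sub>T\<close> across all ridges through \<open>S - {v}\<close> would
  have to add up to zero, and in a suitable sheet this says that \<open>\<rho>\<close> has at \<open>v\<close> a value that depends
  on \<open>S\<close> and the signs only (\<open>vertex_weight_obstruction\<close>). Where \<open>\<rho>\<close> takes both values at interior
  vertices, one of them violates this. For simplices that are far apart these obstructions do not
  interfere, so the weights of a maximal family are independent modulo the moments.\<close>

section \<open>Reduction modulo two and dual frames of primitive simplices\<close>

\<comment> \<open>Arithmetic in the field with two elements is to stay in the language of rings.\<close>
declare add_bit_eq_xor [simp del] mult_bit_eq_and [simp del]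

definition bit_of :: "real \<Rightarrow> bit" where
  "bit_of x = of_int \<lfloor>x\<rfloor>"

lemma bit_of_of_int [simp]: "bit_of (of_int k) = of_int k"
  by (simp add: bit_of_def)

lemma bit_of_simps [simp]: "bit_of 0 = 0" "bit_of 1 = 1"
  by (simp_all add: bit_of_def)

lemma bit_of_add: "\<lbrakk>x \<in> \<int>; y \<in> \<int>\<rbrakk> \<Longrightarrow> bit_of (x + y) = bit_of x + bit_of y"
  and bit_of_diff: "\<lbrakk>x \<in> \<int>; y \<in> \<int>\<rbrakk> \<Longrightarrow> bit_of (x - y) = bit_of x - bit_of y"
  and bit_of_mult: "\<lbrakk>x \<in> \<int>; y \<in> \<int>\<rbrakk> \<Longrightarrow> bit_of (x * y) = bit_of x * bit_of y"
  by (elim Ints_cases; metis bit_of_of_int of_int_add of_int_diff of_int_mult)+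

lemma bit_of_sum: "(\<And>i. i \<in> I \<Longrightarrow> f i \<in> \<int>) \<Longrightarrow> bit_of (\<Sum>i\<in>I. f i) = (\<Sum>i\<in>I. bit_of (f i))"
proof (induction I rule: infinite_finite_induct)
  case (insert x F)
  then show ?case by (simp add: bit_of_add Ints_sum)
qed auto

lemma lat_add: "x \<in> lat \<Longrightarrow> y \<in> lat \<Longrightarrow> x + y \<in> lat"
  and lat_diff: "x \<in> lat \<Longrightarrow> y \<in> lat \<Longrightarrow> x - y \<in> lat"
  and lat_uminus: "x \<in> lat \<Longrightarrow> - x \<in> lat"
  and lat_zero: "0 \<in> lat"
  by (auto simp: lat_def)

lemma lat_sum: "(\<And>i. i \<in> I \<Longrightarrow> f i \<in> lat) \<Longrightarrow> (\<Sum>i\<in>I. f i) \<in> lat"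
  by (auto simp: lat_def intro: Ints_sum)

lemma lat_axis: "axis i 1 \<in> lat"
  by (auto simp: lat_def axis_def)

lemma lat_inner: "x \<in> lat \<Longrightarrow> y \<in> lat \<Longrightarrow> x \<bullet> y \<in> \<int>"
  by (auto simp: lat_def inner_vec_def intro!: Ints_sum)

lemma mod2_nth: "mod2 x $ i = bit_of (x $ i)"
  by (simp add: mod2_def bit_of_def)

lemma mod2_add: "x \<in> lat \<Longrightarrow> y \<in> lat \<Longrightarrow> mod2 (x + y) = mod2 x + mod2 y"
  and mod2_diff: "x \<in> lat \<Longrightarrow> y \<in> lat \<Longrightarrow> mod2 (x - y) = mod2 x - mod2 y"
  by (auto simp: vec_eq_iff mod2_nth lat_def bit_of_add bit_of_diff)

lemma pair2_mod2: "x \<in> lat \<Longrightarrow> y \<in> lat \<Longrightarrow> pair2 (mod2 x) (mod2 y) = bit_of (x \<bullet> y)"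
  by (auto simp: pair2_def mod2_nth inner_vec_def lat_def bit_of_sum bit_of_mult)

lemma pair2_add_left: "pair2 (a + b) u = pair2 a u + pair2 b u"
  and pair2_diff_left: "pair2 (a - b) u = pair2 a u - pair2 b u"
  and pair2_add_right: "pair2 a (u + v) = pair2 a u + pair2 a v"
  and pair2_zero_right [simp]: "pair2 a 0 = 0"
  and pair2_zero_left [simp]: "pair2 0 a = 0"
  and pair2_scale_right: "pair2 a (c *s u) = c * pair2 a u"
  and pair2_scale_left: "pair2 (c *s a) u = c * pair2 a u"
  by (simp_all add: pair2_def algebra_simps sum.distrib sum_distrib_left)

lemma pair2_sum_right: "pair2 a (\<Sum>i\<in>I. f i) = (\<Sum>i\<in>I. pair2 a (f i))"
  by (induction I rule: infinite_finite_induct) (auto simp: pair2_add_right)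

lemma pair2_sum_left: "pair2 (\<Sum>i\<in>I. f i) a = (\<Sum>i\<in>I. pair2 (f i) a)"
  by (induction I rule: infinite_finite_induct) (auto simp: pair2_add_left)

lemma pair2_axis: "pair2 (axis i 1) u = u $ i"
proof -
  have "pair2 (axis i 1) u = (\<Sum>j\<in>UNIV. if j = i then u $ j else 0)"
    unfolding pair2_def by (rule sum.cong) (auto simp: axis_def)
  then show ?thesis by (simp only: sum.delta finite_class.finite_UNIV UNIV_I if_True)
qed

lemma UNIV_bit: "(UNIV :: bit set) = {0, 1}"
proof -
  have "x \<in> {0, 1}" for x :: bit by (cases x) auto
  then show ?thesis by blast
qed

instance bit :: finite
  by standard (simp add: UNIV_bit)

lemma bit_add_self [simp]: "(x::bit) + x = 0"
  by (cases x) auto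

lemma bitvec_add_self [simp]: "(u :: bit ^ 'm) + u = 0"
  by (simp add: vec_eq_iff)

lemma bitvec_diff_eq_add: "(u :: bit ^ 'm) - v = u + v"
  by (simp add: vec_eq_iff)

text \<open>The vectors \<open>g v\<close> are the linear parts of the barycentric coordinates of the simplex with
  vertex set \<open>T\<close>; that they are integral is what primitivity of the simplex provides.\<close>

definition dual_frame :: "(real ^ 'm) set \<Rightarrow> (real ^ 'm \<Rightarrow> real ^ 'm) \<Rightarrow> bool" where
  "dual_frame T g \<longleftrightarrow>
     (\<forall>v\<in>T. g v \<in> lat \<and> (\<forall>x\<in>T. \<forall>y\<in>T. g v \<bullet> (x - y) = of_bool (x = v) - of_bool (y = v)))"

lemma det_int_entries:
  fixes A :: "real ^ 'n ^ 'n"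
  assumes "\<And>i j. A $ i $ j \<in> \<int>"
  shows "det A \<in> \<int>"
  unfolding det_def using assms
  by (intro Ints_sum Ints_mult Ints_prod) auto

text \<open>The edge vectors at a vertex form an integral matrix, whose determinant is \<open>\<plusminus>1\<close> by the volume
  formula. By Cramer's rule the inverse matrix is integral as well; its rows are the vectors of the
  frame, apart from the one at the chosen vertex, which is minus their sum.\<close>

lemma dual_frame_exists_wellorder:
  fixes X :: "(real ^ 'n::{finite,wellorder}) set"
  assumes fin: "finite X" and card: "card X = Suc CARD('n)" and X: "X \<subseteq> lat"
    and vol: "measure lebesgue (convex hull X) = 1 / fact CARD('n)"
  shows "\<exists>g. dual_frame X g"
proof -
  obtain x0 where x0: "x0 \<in> X" using card by fastforce
  have "card (UNIV :: 'n set) = card (X - {x0})" using fin card x0 by simp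
  then obtain f where f: "bij_betw f (UNIV :: 'n set) (X - {x0})"
    using fin by (metis finite_class.finite_UNIV finite_Diff finite_same_card_bij)
  define M where "M = (\<chi> i. \<chi> j. f j $ i - x0 $ i)"
  have fX: "f j \<in> X" "f j \<noteq> x0" for j using f by (auto simp: bij_betw_def)
  have "compact (convex hull X)" using fin by (simp add: finite_imp_compact_convex_hull)
  then have "convex hull X \<in> sets lborel" by (auto dest: compact_imp_closed)
  then have "\<bar>det M\<bar> / fact CARD('n) = 1 / fact CARD('n)"
    using content_simplex[OF fin card x0 f] vol unfolding M_def
    by (simp add: measure_completion)
  then have detM: "\<bar>det M\<bar> = 1" by simp
  then have det0: "det (transpose M) \<noteq> 0" by (auto simp: det_transpose)
  have Mint: "M $ i $ j \<in> \<int>" for i j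
    using X fX(1)[of j] x0 by (auto simp: M_def lat_def subset_iff)
  have "\<exists>x. x \<in> lat \<and> transpose M *v x = axis k 1" for k
  proof -
    define x where
      "x = (\<chi> l. det (\<chi> i j. if j = l then axis k 1 $ i else transpose M $ i $ j) / det (transpose M))"
    have "transpose M *v x = axis k 1" using cramer[OF det0] x_def by blast
    moreover have "x \<in> lat"
    proof -
      have "a / det (transpose M) \<in> \<int>" if "a \<in> \<int>" for a
      proof -
        have "det (transpose M) = 1 \<or> det (transpose M) = - 1"
          using detM by (simp only: det_transpose) linarith
        then show ?thesis using that by fastforce
      qed
      moreover have "det (\<chi> i j. if j = l then axis k 1 $ i else transpose M $ i $ j) \<in> \<int>" for l
        using Mint by (intro det_int_entries) (auto simp: axis_def transpose_def)
      ultimately show ?thesis by (auto simp: lat_def x_def)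
    qed
    ultimately show ?thesis by blast
  qed
  then obtain a where a: "\<And>k. a k \<in> lat" "\<And>k. transpose M *v a k = axis k 1" by metis
  have ad: "a k \<bullet> (f j - x0) = of_bool (j = k)" for j k
  proof -
    have "a k \<bullet> (f j - x0) = (transpose M *v a k) $ j"
      by (simp add: matrix_vector_mult_def transpose_def M_def inner_vec_def algebra_simps)
    then show ?thesis using a(2)[of k] by (simp add: axis_def)
  qed
  define fi where "fi = the_inv f"
  have injf: "inj f" using f by (simp add: bij_betw_def)
  have surjf: "\<exists>k. x = f k" if "x \<in> X" "x \<noteq> x0" for x
    using f that unfolding bij_betw_def by blast
  define g where "g v = (if v = x0 then - (\<Sum>k\<in>UNIV. a k) else a (fi v))" for v
  have gf: "g (f k) = a k" for k using fX by (simp add: g_def fi_def the_inv_f_f[OF injf])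
  have main: "g v \<bullet> (x - x0) = of_bool (x = v) - of_bool (x0 = v)"
    if vX: "v \<in> X" and xX: "x \<in> X" for v x
  proof (cases "v = x0")
    case True
    show ?thesis
    proof (cases "x = x0")
      case False
      then obtain j where "x = f j" using surjf xX by blast
      then show ?thesis using True fX(2)
        by (simp add: g_def inner_sum_left ad)
    qed (use True in auto)
  next
    case False
    then obtain k where k: "v = f k" using surjf vX by blast
    show ?thesis
    proof (cases "x = x0")
      case False
      then obtain j where "x = f j" using surjf xX by blast
      then show ?thesis using k fX(2) injf by (auto simp: gf ad inj_eq)
    qed (use False in auto)
  qed
  have "g v \<bullet> (x - y) = of_bool (x = v) - of_bool (y = v)" if "v \<in> X" "x \<in> X" "y \<in> X" for v x y
  proof -
    have "x - y = (x - x0) - (y - x0)" by simp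
    then show ?thesis using main[OF that(1,2)] main[OF that(1,3)] by (simp only: inner_diff_right)
  qed
  moreover have "g v \<in> lat" for v
    using a(1) by (auto simp: g_def intro: lat_uminus lat_sum)
  ultimately show ?thesis unfolding dual_frame_def by blast
qed

text \<open>The volume formula for simplices rests on the factorization into elementary matrices and so on an
  ordering of the indices; any finite index type is isomorphic to an ordered one.\<close>

typedef 'a ordered_copy = "UNIV :: 'a set" ..

instantiation ordered_copy :: (finite) wellorder
begin

definition less_eq_ordered_copy :: "'a ordered_copy \<Rightarrow> 'a ordered_copy \<Rightarrow> bool" where
  "x \<le> y \<longleftrightarrow> to_nat (Rep_ordered_copy x) \<le> to_nat (Rep_ordered_copy y)"

definition less_ordered_copy :: "'a ordered_copy \<Rightarrow> 'a ordered_copy \<Rightarrow> bool" where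
  "x < y \<longleftrightarrow> to_nat (Rep_ordered_copy x) < to_nat (Rep_ordered_copy y)"

instance
proof
  fix P :: "'a ordered_copy \<Rightarrow> bool" and a
  assume step: "\<And>x. (\<And>y. y < x \<Longrightarrow> P y) \<Longrightarrow> P x"
  show "P a"
    by (induction "to_nat (Rep_ordered_copy a)" arbitrary: a rule: less_induct)
      (auto intro: step simp: less_ordered_copy_def)
qed (auto simp: less_eq_ordered_copy_def less_ordered_copy_def Rep_ordered_copy_inject)

end

instance ordered_copy :: (finite) finite
proof
  have "(UNIV :: 'a ordered_copy set) = Abs_ordered_copy ` UNIV"
    by (metis Rep_ordered_copy_inverse surj_def)
  then show "finite (UNIV :: 'a ordered_copy set)" by (metis finite_class.finite_UNIV finite_imageI)
qed

lemma bij_Rep_ordered_copy: "bij Rep_ordered_copy"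
  by (metis Abs_ordered_copy_inverse Rep_ordered_copy_inverse UNIV_I bijI')

definition relabel :: "real ^ 'm::finite \<Rightarrow> real ^ 'm ordered_copy" where
  "relabel x = (\<chi> i. x $ Rep_ordered_copy i)"

definition unlabel :: "real ^ 'm ordered_copy \<Rightarrow> real ^ 'm::finite" where
  "unlabel x = (\<chi> i. x $ Abs_ordered_copy i)"

lemma relabel_unlabel [simp]: "relabel (unlabel x) = x" "unlabel (relabel y) = y"
  by (auto simp: relabel_def unlabel_def vec_eq_iff Rep_ordered_copy_inverse Abs_ordered_copy_inverse)

lemma linear_relabel: "linear relabel" and linear_unlabel: "linear unlabel"
  by (auto intro!: linearI simp: relabel_def unlabel_def vec_eq_iff)

lemma relabel_in_lat [simp]: "relabel x \<in> lat \<longleftrightarrow> x \<in> lat"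
  unfolding lat_def relabel_def
  by auto (metis Abs_ordered_copy_inverse UNIV_I)

lemma inner_relabel: "relabel x \<bullet> relabel y = x \<bullet> y"
  unfolding relabel_def inner_vec_def
  using sum.reindex_bij_betw[OF bij_Rep_ordered_copy, of "\<lambda>i. x $ i * y $ i"] by simp

lemma lborel_unlabel: "(lborel :: (real ^ 'm::finite) measure) = distr lborel borel unlabel"
proof (rule lborel_eqI)
  fix l u :: "real ^ 'm"
  assume le: "\<And>b. b \<in> Basis \<Longrightarrow> l \<bullet> b \<le> u \<bullet> b"
  have le': "l $ i \<le> u $ i" for i using le[of "axis i 1"] by (auto simp: inner_axis Basis_vec_def)
  have prod_Basis: "(\<Prod>b\<in>Basis. x \<bullet> b) = (\<Prod>i\<in>UNIV. x $ i)" for x :: "real ^ 'k::finite"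
  proof -
    have "(\<Prod>b\<in>Basis. x \<bullet> b) = (\<Prod>b\<in>range (\<lambda>i::'k. axis i (1::real)). x \<bullet> b)"
      by (rule prod.cong) (auto simp: Basis_vec_def)
    also have "\<dots> = (\<Prod>i\<in>UNIV. x $ i)"
      by (subst prod.reindex) (auto simp: inj_def axis_eq_axis inner_axis)
    finally show ?thesis .
  qed
  have meas: "unlabel \<in> borel_measurable (borel :: (real ^ 'm ordered_copy) measure)"
    by (intro borel_measurable_continuous_onI linear_continuous_on linear_conv_bounded_linear[THEN iffD1] linear_unlabel)
  have "unlabel -` box l u = box (relabel l) (relabel u)"
    by (auto simp: mem_box_cart unlabel_def relabel_def)
       (metis Abs_ordered_copy_inverse Rep_ordered_copy_inverse UNIV_I)+
  then have "emeasure (distr lborel borel unlabel) (box l u) = emeasure lborel (box (relabel l) (relabel u))"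
    using meas by (subst emeasure_distr) auto
  also have "\<dots> = (\<Prod>b\<in>Basis. (relabel u - relabel l) \<bullet> b)"
  proof (rule emeasure_lborel_box)
    fix b :: "real ^ 'm ordered_copy" assume "b \<in> Basis"
    then obtain i where "b = axis i 1" by (auto simp: Basis_vec_def)
    then show "relabel l \<bullet> b \<le> relabel u \<bullet> b" using le' by (simp add: inner_axis relabel_def)
  qed
  also have "\<dots> = (\<Prod>i\<in>UNIV. (relabel u - relabel l) $ i)"
    by (rule arg_cong[of _ _ ennreal], rule prod_Basis)
  also have "(\<Prod>i\<in>UNIV. (relabel u - relabel l) $ i) = (\<Prod>i\<in>UNIV. (u - l) $ i)"
    using prod.reindex_bij_betw[OF bij_Rep_ordered_copy, of "\<lambda>i. (u - l) $ i"] by (simp add: relabel_def)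
  also have "\<dots> = (\<Prod>b\<in>Basis. (u - l) \<bullet> b)" by (rule prod_Basis[symmetric])
  finally show "emeasure (distr lborel borel unlabel) (box l u) = (\<Prod>b\<in>Basis. (u - l) \<bullet> b)" .
qed auto

lemma dual_frame_exists:
  fixes X :: "(real ^ 'm::finite) set"
  assumes fin: "finite X" and card: "card X = Suc CARD('m)" and X: "X \<subseteq> lat"
    and vol: "measure lebesgue (convex hull X) = 1 / fact CARD('m)"
  shows "\<exists>g. dual_frame X g"
proof -
  have inj: "inj relabel" by (metis injI relabel_unlabel(2))
  have cardU: "CARD('m ordered_copy) = CARD('m)"
    using bij_Rep_ordered_copy by (rule bij_betw_same_card)
  have closed: "convex hull Y \<in> sets lborel" if "finite Y" for Y :: "(real ^ 'k::finite) set"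
    using finite_imp_compact_convex_hull[OF that] by (auto dest: compact_imp_closed)
  have "convex hull (relabel ` X) = unlabel -` (convex hull X)"
    unfolding convex_hull_linear_image[OF linear_relabel, symmetric]
    by (auto simp: image_iff) (metis relabel_unlabel(1))
  moreover have meas: "unlabel \<in> borel_measurable (borel :: (real ^ 'm ordered_copy) measure)"
    by (intro borel_measurable_continuous_onI linear_continuous_on linear_conv_bounded_linear[THEN iffD1] linear_unlabel)
  ultimately have "measure lborel (convex hull (relabel ` X)) = measure (distr lborel borel unlabel) (convex hull X)"
    using closed[OF fin] by (subst measure_distr) auto
  also have "\<dots> = measure lborel (convex hull X)" by (metis lborel_unlabel)
  finally have "measure lebesgue (convex hull (relabel ` X)) = measure lebesgue (convex hull X)"
    using closed[OF fin] closed[of "relabel ` X"] fin by (simp add: measure_completion)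
  then have vol': "measure lebesgue (convex hull (relabel ` X)) = 1 / fact CARD('m ordered_copy)"
    by (simp only: vol cardU)
  have "card (relabel ` X) = card X" by (rule card_image[OF inj_on_subset[OF inj subset_UNIV]])
  then have "\<exists>g. dual_frame (relabel ` X) g"
    using fin card X cardU by (intro dual_frame_exists_wellorder vol') auto
  then obtain g where g: "dual_frame (relabel ` X) g" ..
  have "dual_frame X (\<lambda>v. unlabel (g (relabel v)))"
    unfolding dual_frame_def
  proof (intro ballI conjI)
    fix v assume "v \<in> X"
    then have "g (relabel v) \<in> lat" using g by (auto simp: dual_frame_def)
    then show "unlabel (g (relabel v)) \<in> lat" by (metis relabel_in_lat relabel_unlabel(1))
    fix x y assume xy: "x \<in> X" "y \<in> X"
    have "unlabel (g (relabel v)) \<bullet> (x - y) = g (relabel v) \<bullet> (relabel x - relabel y)"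
      by (metis inner_relabel relabel_unlabel(1) linear_diff linear_relabel)
    also have "\<dots> = of_bool (relabel x = relabel v) - of_bool (relabel y = relabel v)"
      using g xy \<open>v \<in> X\<close> by (auto simp: dual_frame_def)
    finally show "unlabel (g (relabel v)) \<bullet> (x - y) = of_bool (x = v) - of_bool (y = v)"
      by (simp add: inj_eq[OF inj])
  qed
  then show ?thesis by blast
qed

section \<open>Barycentric coordinates and sign vectors of a simplex\<close>

lemma dual_frameD:
  assumes "dual_frame T g" "v \<in> T"
  shows dual_frame_lat: "g v \<in> lat"
    and dual_frame_inner: "\<lbrakk>x \<in> T; y \<in> T\<rbrakk> \<Longrightarrow> g v \<bullet> (x - y) = of_bool (x = v) - of_bool (y = v)"
  using assms by (auto simp: dual_frame_def)

lemma dual_frame_expand: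
  fixes T :: "(real ^ 'm) set"
  assumes g: "dual_frame T g" and fin: "finite T" and card: "card T = Suc CARD('m)" and v0: "v0 \<in> T"
  shows "z = (\<Sum>v\<in>T - {v0}. (g v \<bullet> z) *\<^sub>R (v - v0))"
proof -
  let ?B = "(\<lambda>v. v - v0) ` (T - {v0})"
  have inj: "inj_on (\<lambda>v. v - v0) (T - {v0})" by (simp add: inj_on_def)
  have coef: "g w \<bullet> (\<Sum>v\<in>T - {v0}. c v *\<^sub>R (v - v0)) = c w" if "w \<in> T - {v0}" for c w
  proof -
    have "g w \<bullet> (\<Sum>v\<in>T - {v0}. c v *\<^sub>R (v - v0)) = (\<Sum>v\<in>T - {v0}. if v = w then c v else 0)"
      unfolding inner_sum_right
      by (rule sum.cong) (use that v0 in \<open>auto simp: dual_frame_inner[OF g]\<close>)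
    then show ?thesis using that fin by (simp add: sum.delta)
  qed
  have "independent ?B"
    unfolding independent_explicit_finite_subsets
  proof (intro allI impI ballI)
    fix A u w assume A: "A \<subseteq> ?B" "finite A" and 0: "(\<Sum>a\<in>A. u a *\<^sub>R a) = 0" and w: "w \<in> A"
    let ?u = "\<lambda>v. if v - v0 \<in> A then u (v - v0) else 0"
    have "(\<Sum>v\<in>T - {v0}. ?u v *\<^sub>R (v - v0)) = (\<Sum>b\<in>?B. (if b \<in> A then u b else 0) *\<^sub>R b)"
      by (subst sum.reindex[OF inj]) simp
    also have "\<dots> = (\<Sum>a\<in>A. u a *\<^sub>R a)"
      by (rule sum.mono_neutral_cong_right) (use A fin in auto)
    finally have s0: "(\<Sum>v\<in>T - {v0}. ?u v *\<^sub>R (v - v0)) = 0" using 0 by simp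
    obtain v where v: "v \<in> T - {v0}" "w = v - v0" using A w by blast
    then have "?u v = 0" using coef[OF v(1), of ?u] s0 by simp
    then show "u w = 0" using v w by simp
  qed
  moreover have "card ?B = CARD('m)" using card_image[OF inj] fin card v0 by simp
  ultimately have "span ?B = UNIV"
    by (metis DIM_cart DIM_real UNIV_I card_eq_dim dim_UNIV finite_imageI[OF finite_Diff[OF fin]] mult.right_neutral subsetI subset_antisym top_greatest order_refl)
  then have "z \<in> span ?B" by simp
  then obtain c where "z = (\<Sum>b\<in>?B. c b *\<^sub>R b)"
    using span_finite[of ?B] fin by auto
  then have z: "z = (\<Sum>v\<in>T - {v0}. c (v - v0) *\<^sub>R (v - v0))"
    by (simp add: sum.reindex[OF inj])
  show ?thesis
    using coef[of _ "\<lambda>v. c (v - v0)"] z by (metis (no_types, lifting) sum.cong)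
qed

lemma dual_frame_expand2:
  fixes T :: "(real ^ 'm) set"
  assumes g: "dual_frame T g" and fin: "finite T" and card: "card T = Suc CARD('m)" and v0: "v0 \<in> T"
    and T: "T \<subseteq> lat"
  shows "u = (\<Sum>v\<in>T - {v0}. pair2 (mod2 (v - v0)) u *s mod2 (g v))"
proof (rule vec_eq_iff[THEN iffD2], intro allI)
  fix i
  have lat: "v - v0 \<in> lat" "g v \<in> lat" if "v \<in> T - {v0}" for v
    using that T v0 by (auto intro: lat_diff dual_frame_lat[OF g])
  have "(mod2 (axis i 1) :: bit ^ 'm) = (\<Sum>v\<in>T - {v0}. bit_of (g v $ i) *s mod2 (v - v0))"
  proof (rule vec_eq_iff[THEN iffD2], intro allI)
    fix j
    have "(axis i 1 :: real ^ 'm) $ j = (\<Sum>v\<in>T - {v0}. (g v $ i) *\<^sub>R (v - v0)) $ j"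
      using dual_frame_expand[OF g fin card v0, of "axis i 1"] by (simp add: inner_axis)
    then have "(axis i 1 :: real ^ 'm) $ j = (\<Sum>v\<in>T - {v0}. (g v $ i) * ((v - v0) $ j))"
      by (simp only: sum_component vector_scaleR_component real_scaleR_def)
    moreover have "bit_of (\<Sum>v\<in>T - {v0}. (g v $ i) * ((v - v0) $ j))
        = (\<Sum>v\<in>T - {v0}. bit_of ((g v $ i) * ((v - v0) $ j)))"
      using lat by (intro bit_of_sum Ints_mult) (auto simp: lat_def)
    moreover have "\<dots> = (\<Sum>v\<in>T - {v0}. bit_of (g v $ i) * bit_of ((v - v0) $ j))"
      using lat by (intro sum.cong refl bit_of_mult) (auto simp: lat_def)
    ultimately show "(mod2 (axis i 1) :: bit ^ 'm) $ j = (\<Sum>v\<in>T - {v0}. bit_of (g v $ i) *s mod2 (v - v0)) $ j"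
      by (simp only: mod2_nth sum_component vector_smult_component)
  qed
  moreover have "mod2 (axis i 1) = (axis i 1 :: bit ^ 'm)"
    by (auto simp: vec_eq_iff mod2_nth axis_def)
  ultimately have "u $ i = pair2 (\<Sum>v\<in>T - {v0}. bit_of (g v $ i) *s mod2 (v - v0)) u"
    by (metis pair2_axis)
  also have "\<dots> = (\<Sum>v\<in>T - {v0}. bit_of (g v $ i) * pair2 (mod2 (v - v0)) u)"
    by (simp only: pair2_sum_left pair2_scale_left)
  finally show "u $ i = (\<Sum>v\<in>T - {v0}. pair2 (mod2 (v - v0)) u *s mod2 (g v)) $ i"
    by (simp only: sum_component vector_smult_component mod2_nth mult.commute)
qed

lemma pair2_dual_frame:
  assumes "dual_frame T g" "T \<subseteq> lat" "v \<in> T" "x \<in> T" "y \<in> T"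
  shows "pair2 (mod2 (x - y)) (mod2 (g v)) = of_bool (x = v) + of_bool (y = v)"
proof -
  have "pair2 (mod2 (x - y)) (mod2 (g v)) = bit_of (g v \<bullet> (x - y))"
    using assms by (subst pair2_mod2) (auto intro: lat_diff dual_frame_lat simp: inner_commute)
  then show ?thesis using assms
    by (auto simp: dual_frame_inner bit_of_def)
qed

lemma mod2_dual_frame_nonzero:
  assumes "dual_frame T g" "T \<subseteq> lat" "v \<in> T" "x \<in> T" "x \<noteq> v"
  shows "mod2 (g v) \<noteq> 0"
proof
  assume "mod2 (g v) = 0"
  then show False using pair2_dual_frame[OF assms(1-3), of v x] assms by simp
qed

text \<open>The sign distribution \<open>\<epsilon>\<close> as it appears in the sheet with index \<open>u\<close>: an edge is met by the
  hypersurface in this sheet exactly if its vertices have different signs.\<close>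

definition tsign :: "(real ^ 'm \<Rightarrow> bit) \<Rightarrow> bit ^ 'm \<Rightarrow> real ^ 'm \<Rightarrow> bit" where
  "tsign \<epsilon> u v = pair2 (mod2 v) u + \<epsilon> v"

definition crosses :: "(real ^ 'm \<Rightarrow> bit) \<Rightarrow> bit ^ 'm \<Rightarrow> (real ^ 'm) set \<Rightarrow> bool" where
  "crosses \<epsilon> u S \<longleftrightarrow> (\<exists>x\<in>S. \<exists>y\<in>S. tsign \<epsilon> u x \<noteq> tsign \<epsilon> u y)"

lemma crosses_mono: "crosses \<epsilon> u S \<Longrightarrow> S \<subseteq> T \<Longrightarrow> crosses \<epsilon> u T"
  by (auto simp: crosses_def)

lemma tsign_add: "tsign \<epsilon> (u + l) v = tsign \<epsilon> u v + pair2 (mod2 v) l"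
  by (simp add: tsign_def pair2_add_right algebra_simps)

lemma tsign_sum:
  assumes "x \<in> lat" "y \<in> lat"
  shows "tsign \<epsilon> u x + tsign \<epsilon> u y = pair2 (mod2 (x - y)) u + (\<epsilon> x + \<epsilon> y)"
proof -
  have "a + c + (b + d) = a + b + (c + d)" for a b c d :: bit by (simp only: ac_simps)
  then show ?thesis unfolding tsign_def mod2_diff[OF assms] pair2_diff_left by simp
qed

lemma tsign_diff:
  assumes "x \<in> lat" "y \<in> lat"
  shows "tsign \<epsilon> (u + l) x + tsign \<epsilon> (u + l) y = tsign \<epsilon> u x + tsign \<epsilon> u y + pair2 (mod2 (x - y)) l"
proof -
  have "a + c + (b + d) = a + b + (c + d)" for a b c d :: bit by (simp only: ac_simps)
  then show ?thesis unfolding tsign_add mod2_diff[OF assms] pair2_diff_left by simp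
qed

lemma bit_eq_iff_add: "(a::bit) = b \<longleftrightarrow> a + b = 0"
  by (cases a; cases b) auto

lemma bitvec_eq_iff_add: "(a :: bit ^ 'm) = b \<longleftrightarrow> a + b = 0"
  by (simp only: vec_eq_iff vector_add_component zero_index bit_eq_iff_add[symmetric])

lemma not_crosses_iff: "\<not> crosses \<epsilon> u S \<longleftrightarrow> (\<forall>x\<in>S. \<forall>y\<in>S. tsign \<epsilon> u x + tsign \<epsilon> u y = 0)"
  unfolding crosses_def bit_eq_iff_add[symmetric] by blast

lemma not_crosses_translate:
  assumes "\<not> crosses \<epsilon> u S" "S \<subseteq> lat"
  shows "\<not> crosses \<epsilon> (u + l) S \<longleftrightarrow> (\<forall>x\<in>S. \<forall>y\<in>S. pair2 (mod2 (x - y)) l = 0)"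
proof -
  have "tsign \<epsilon> (u + l) x + tsign \<epsilon> (u + l) y = pair2 (mod2 (x - y)) l" if "x \<in> S" "y \<in> S" for x y
  proof -
    have "tsign \<epsilon> u x + tsign \<epsilon> u y = 0" using assms(1) that unfolding not_crosses_iff by blast
    moreover have "x \<in> lat" "y \<in> lat" using that assms(2) by auto
    ultimately show ?thesis using tsign_diff[of x y \<epsilon> u l] by simp
  qed
  then show ?thesis unfolding not_crosses_iff by simp
qed

text \<open>The signs of the vertices relative to a fixed one are prescribed values of \<open>u\<close> on a basis of
  \<open>M\<^sub>2\<close>.\<close>

lemma not_crosses_ex1:
  fixes T :: "(real ^ 'm) set"
  assumes g: "dual_frame T g" and fin: "finite T" and card: "card T = Suc CARD('m)" and T: "T \<subseteq> lat"
  shows "\<exists>!u. \<not> crosses \<epsilon> u T"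
proof -
  obtain v0 where v0: "v0 \<in> T" using card by fastforce
  define u where "u = (\<Sum>v\<in>T - {v0}. (\<epsilon> v + \<epsilon> v0) *s mod2 (g v))"
  have u0: "tsign \<epsilon> u x + tsign \<epsilon> u v0 = 0" if x: "x \<in> T" for x
  proof (cases "x = v0")
    case False
    have "pair2 (mod2 (x - v0)) u = (\<Sum>v\<in>T - {v0}. (\<epsilon> v + \<epsilon> v0) * (of_bool (x = v) + of_bool (v0 = v)))"
      unfolding u_def pair2_sum_right pair2_scale_right
      by (intro sum.cong refl) (use pair2_dual_frame[OF g T _ x v0] in auto)
    also have "\<dots> = (\<Sum>v\<in>T - {v0}. if v = x then \<epsilon> v + \<epsilon> v0 else 0)"
      by (intro sum.cong refl) auto
    also have "\<dots> = \<epsilon> x + \<epsilon> v0" using False x fin by (simp add: sum.delta)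
    finally have "pair2 (mod2 (x - v0)) u = \<epsilon> x + \<epsilon> v0" .
    then show ?thesis using tsign_sum[of x v0 \<epsilon> u] x v0 T by auto
  qed simp
  have nc: "\<not> crosses \<epsilon> u T"
  proof -
    have "tsign \<epsilon> u x = tsign \<epsilon> u v0" if "x \<in> T" for x using u0[OF that] by (rule bit_eq_iff_add[THEN iffD2])
    then show ?thesis by (simp add: crosses_def)
  qed
  show ?thesis
  proof (rule ex1I)
    show "\<not> crosses \<epsilon> u T" by (rule nc)
  next
    fix w assume w: "\<not> crosses \<epsilon> w T"
    have "u = w + (w + u)" by (simp add: vec_eq_iff flip: add.assoc)
    then have "\<forall>x\<in>T. \<forall>y\<in>T. pair2 (mod2 (x - y)) (w + u) = 0"
      using not_crosses_translate[OF w T, of "w + u"] nc by metis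
    then have "w + u = 0"
      using dual_frame_expand2[OF g fin card v0 T, of "w + u"] v0 by simp
    then show "w = u" by (rule bitvec_eq_iff_add[THEN iffD2])
  qed
qed

lemma not_crosses_ridge:
  fixes T :: "(real ^ 'm) set"
  assumes g: "dual_frame T g" and fin: "finite T" and card: "card T = Suc CARD('m)" and T: "T \<subseteq> lat"
    and v: "v \<in> T" and u0: "\<not> crosses \<epsilon> u0 T"
  shows "\<not> crosses \<epsilon> u (T - {v}) \<longleftrightarrow> u = u0 \<or> u = u0 + mod2 (g v)"
proof -
  have "card (T - {v}) \<noteq> 0" using card v fin by simp
  then obtain v0 where v0: "v0 \<in> T - {v}" by (metis card.empty ex_in_conv)
  have w: "u = u0 + (u0 + u)" by (simp add: vec_eq_iff flip: add.assoc)
  have "\<not> crosses \<epsilon> u0 (T - {v})" using u0 crosses_mono by blast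
  then have "\<not> crosses \<epsilon> u (T - {v}) \<longleftrightarrow> (\<forall>x\<in>T - {v}. \<forall>y\<in>T - {v}. pair2 (mod2 (x - y)) (u0 + u) = 0)"
    using not_crosses_translate[of \<epsilon> u0 "T - {v}" "u0 + u"] T w by auto
  also have "\<dots> \<longleftrightarrow> u0 + u = 0 \<or> u0 + u = mod2 (g v)"
  proof
    assume 0: "\<forall>x\<in>T - {v}. \<forall>y\<in>T - {v}. pair2 (mod2 (x - y)) (u0 + u) = 0"
    have "u0 + u = (\<Sum>y\<in>T - {v0}. pair2 (mod2 (y - v0)) (u0 + u) *s mod2 (g y))"
      using dual_frame_expand2[OF g fin card _ T, of v0 "u0 + u"] v0 by simp
    also have "\<dots> = (\<Sum>y\<in>{v}. pair2 (mod2 (y - v0)) (u0 + u) *s mod2 (g y))"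
      by (rule sum.mono_neutral_right) (use fin v v0 0 in auto)
    finally show "u0 + u = 0 \<or> u0 + u = mod2 (g v)"
      by (cases "pair2 (mod2 (v - v0)) (u0 + u)") auto
  next
    assume "u0 + u = 0 \<or> u0 + u = mod2 (g v)"
    then show "\<forall>x\<in>T - {v}. \<forall>y\<in>T - {v}. pair2 (mod2 (x - y)) (u0 + u) = 0"
      using pair2_dual_frame[OF g T v] by auto
  qed
  also have "\<dots> \<longleftrightarrow> u = u0 \<or> u = u0 + mod2 (g v)"
    unfolding bitvec_eq_iff_add[of u] bitvec_eq_iff_add[of "u0 + u"] by (simp add: ac_simps)
  finally show ?thesis .
qed

definition bary_coord :: "(real ^ 'm \<Rightarrow> real ^ 'm) \<Rightarrow> real ^ 'm \<Rightarrow> real ^ 'm \<Rightarrow> real" where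
  "bary_coord g v x = g v \<bullet> (x - v) + 1"

lemma bary_coord_vertex:
  assumes "dual_frame T g" "v \<in> T" "w \<in> T"
  shows "bary_coord g v w = of_bool (w = v)"
  using assms by (simp add: bary_coord_def dual_frame_inner)

lemma bary_coord_affine:
  "bary_coord g v ((1 - t) *\<^sub>R x + t *\<^sub>R y) = (1 - t) * bary_coord g v x + t * bary_coord g v y"
  by (simp add: bary_coord_def inner_diff_right inner_add_right algebra_simps)

lemma bary_coord_diff: "bary_coord g v y = bary_coord g v x + g v \<bullet> (y - x)"
  by (simp add: bary_coord_def inner_diff_right)

lemma bary_coord_sum:
  fixes T :: "(real ^ 'm) set"
  assumes g: "dual_frame T g" and fin: "finite T" and card: "card T = Suc CARD('m)"
  shows "(\<Sum>v\<in>T. bary_coord g v x) = 1" and "x = (\<Sum>v\<in>T. bary_coord g v x *\<^sub>R v)"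
proof -
  obtain v0 where v0: "v0 \<in> T" using card by fastforce
  have e: "z = (\<Sum>v\<in>T - {v0}. (g v \<bullet> z) *\<^sub>R (v - v0))" for z
    by (rule dual_frame_expand[OF g fin card v0])
  have sg: "(\<Sum>v\<in>T. g v) = 0"
  proof -
    have "(\<Sum>v\<in>T. g v) \<bullet> (w - v0) = 0" if "w \<in> T" for w
    proof -
      have "(\<Sum>v\<in>T. g v) \<bullet> (w - v0) = (\<Sum>v\<in>T. (if w = v then 1 else 0) - (if v0 = v then 1 else (0::real)))"
        unfolding inner_sum_left by (rule sum.cong) (use that v0 in \<open>auto simp: dual_frame_inner[OF g]\<close>)
      then show ?thesis using that v0 fin by (simp add: sum_subtractf sum.delta')
    qed
    then have "(\<Sum>v\<in>T. g v) \<bullet> (\<Sum>v\<in>T. g v) = 0"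
      by (subst (2) e) (simp add: inner_sum_right)
    then show ?thesis by simp
  qed
  have c: "bary_coord g v x = bary_coord g v v0 + g v \<bullet> (x - v0)" for v by (rule bary_coord_diff)
  have "(\<Sum>v\<in>T. bary_coord g v x) = (\<Sum>v\<in>T. if v = v0 then 1 else 0) + (\<Sum>v\<in>T. g v) \<bullet> (x - v0)"
    unfolding inner_sum_left sum.distrib[symmetric]
    by (rule sum.cong) (use c bary_coord_vertex[OF g _ v0] in auto)
  then show s1: "(\<Sum>v\<in>T. bary_coord g v x) = 1" using sg v0 fin by simp
  have "x - v0 = (\<Sum>v\<in>T - {v0}. (g v \<bullet> (x - v0)) *\<^sub>R (v - v0))" by (rule e)
  also have "\<dots> = (\<Sum>v\<in>T - {v0}. bary_coord g v x *\<^sub>R (v - v0))"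
    by (rule sum.cong) (use c bary_coord_vertex[OF g _ v0] in auto)
  also have "\<dots> = (\<Sum>v\<in>T. bary_coord g v x *\<^sub>R (v - v0))"
    by (rule sum.mono_neutral_left) (use fin in auto)
  also have "\<dots> = (\<Sum>v\<in>T. bary_coord g v x *\<^sub>R v) - v0"
    by (simp add: scaleR_diff_right sum_subtractf s1 flip: scaleR_sum_left)
  finally show "x = (\<Sum>v\<in>T. bary_coord g v x *\<^sub>R v)" by simp
qed

lemma mem_convex_hull_bary_coord:
  fixes T :: "(real ^ 'm) set"
  assumes g: "dual_frame T g" and fin: "finite T" and card: "card T = Suc CARD('m)" and S: "S \<subseteq> T"
  shows "x \<in> convex hull S \<longleftrightarrow> (\<forall>v\<in>T. bary_coord g v x \<ge> 0) \<and> (\<forall>v\<in>T - S. bary_coord g v x = 0)"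
    (is "_ \<longleftrightarrow> ?R")
proof
  let ?C = "{y. (\<forall>v\<in>T. bary_coord g v y \<ge> 0) \<and> (\<forall>v\<in>T - S. bary_coord g v y = 0)}"
  assume "x \<in> convex hull S"
  moreover have "convex ?C"
  proof (rule convexI)
    fix y z :: "real ^ 'm" and a b :: real
    assume *: "y \<in> ?C" "z \<in> ?C" "0 \<le> a" "0 \<le> b" "a + b = 1"
    then have "a = 1 - b" by simp
    then have "bary_coord g v (a *\<^sub>R y + b *\<^sub>R z) = a * bary_coord g v y + b * bary_coord g v z" for v
      by (simp only: bary_coord_affine)
    then show "a *\<^sub>R y + b *\<^sub>R z \<in> ?C" using * by auto
  qed
  moreover have "S \<subseteq> ?C"
    using S bary_coord_vertex[OF g] by auto
  ultimately show ?R using hull_minimal[of S ?C convex] by blast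
next
  assume R: ?R
  have finS: "finite S" using S fin finite_subset by blast
  have "(\<Sum>v\<in>S. bary_coord g v x) = 1"
    using bary_coord_sum(1)[OF g fin card, of x] sum.mono_neutral_left[OF fin S, of "\<lambda>v. bary_coord g v x"] R by simp
  moreover have "(\<Sum>v\<in>S. bary_coord g v x *\<^sub>R v) = (\<Sum>v\<in>T. bary_coord g v x *\<^sub>R v)"
    by (rule sum.mono_neutral_left[OF fin S]) (use R in auto)
  then have "x = (\<Sum>v\<in>S. bary_coord g v x *\<^sub>R v)"
    using bary_coord_sum(2)[OF g fin card, of x] by simp
  moreover have "\<forall>v\<in>S. 0 \<le> bary_coord g v x" using R S by blast
  ultimately show "x \<in> convex hull S" unfolding convex_hull_finite[OF finS]
    by (intro CollectI exI[of _ "\<lambda>v. bary_coord g v x"] conjI) (assumption | rule sym)+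
qed

section \<open>Incidences of the maximal simplices\<close>

lemma verts_convex_hull: "\<not> affine_dependent C \<Longrightarrow> verts (convex hull C) = C"
  by (simp add: verts_def extreme_point_of_convex_hull_affine_independent)

lemma bary_coord_combination:
  fixes T :: "(real ^ 'm) set"
  assumes g: "dual_frame T g" and T: "finite T" and S: "S \<subseteq> T" and 1: "(\<Sum>w\<in>S. c w) = 1" and v: "v \<in> T"
  shows "bary_coord g v (\<Sum>w\<in>S. c w *\<^sub>R w) = (if v \<in> S then c v else 0)"
proof -
  have S': "finite S" using S T finite_subset by blast
  have "bary_coord g v (\<Sum>w\<in>S. c w *\<^sub>R w) = (\<Sum>w\<in>S. c w * bary_coord g v w)"
    by (simp add: bary_coord_def inner_diff_right inner_sum_right algebra_simps sum.distrib sum_subtractf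
        1 flip: sum_distrib_left sum_distrib_right)
  also have "\<dots> = (\<Sum>w\<in>S. if w = v then c v else 0)"
    by (rule sum.cong) (use bary_coord_vertex[OF g v] S in auto)
  finally show ?thesis using S' by (simp add: sum.delta)
qed

text \<open>A segment from a point outside one of the affine sets to a point outside all the others would be
  covered by finitely many sets that meet it in at most one point each.\<close>

lemma convex_subset_Union_affine:
  fixes C :: "'a::euclidean_space set"
  assumes "finite \<A>" "\<And>A. A \<in> \<A> \<Longrightarrow> affine A" "convex C" "C \<noteq> {}" "C \<subseteq> \<Union>\<A>"
  shows "\<exists>A\<in>\<A>. C \<subseteq> A"
  using assms
proof (induction \<A> rule: finite_induct)
  case (insert A \<A>)
  show ?case
  proof (rule ccontr)
    assume no: "\<not> ?case"
    then obtain x where x: "x \<in> C" "x \<notin> A" by auto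
    have "\<not> C \<subseteq> \<Union>\<A>" using no insert by auto
    then obtain y where y: "y \<in> C" "y \<notin> \<Union>\<A>" by auto
    let ?l = "\<lambda>t::real. (1 - t) *\<^sub>R x + t *\<^sub>R y"
    have inC: "?l t \<in> C" if "t \<in> {0..1}" for t
      using that insert.prems(2) x(1) y(1) by (auto simp: convex_alt)
    have one: "t = s" if B: "B \<in> insert A \<A>" "?l t \<in> B" "?l s \<in> B" for B s t
    proof (rule ccontr)
      assume "t \<noteq> s"
      have line: "?l r \<in> B" for r
      proof -
        let ?k = "(r - s) / (t - s)"
        have "(1 - ?k) *\<^sub>R ?l s + ?k *\<^sub>R ?l t \<in> B"
          using insert.prems(1)[OF B(1)] B(2,3) by (simp add: affine_alt)
        moreover have "(1 - k) *\<^sub>R ?l s + k *\<^sub>R ?l t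
            = (1 - (s + k * (t - s))) *\<^sub>R x + (s + k * (t - s)) *\<^sub>R y" for k
          by (simp add: algebra_simps)
        ultimately show ?thesis using \<open>t \<noteq> s\<close> by simp
      qed
      show False using line[of 0] line[of 1] B(1) x y by auto
    qed
    have "{0..1} \<subseteq> (\<Union>B\<in>insert A \<A>. {t. ?l t \<in> B})" using inC insert.prems(4) by blast
    moreover have "finite {t. ?l t \<in> B}" if "B \<in> insert A \<A>" for B
    proof (cases "{t. ?l t \<in> B} = {}")
      case False
      then obtain s where "?l s \<in> B" by auto
      then have "{t. ?l t \<in> B} \<subseteq> {s}" using one[OF that] by blast
      then show ?thesis using finite_subset by blast
    qed auto
    ultimately have "finite {0..1::real}"
      using insert.hyps(1) by (meson finite_UN_I finite_insert finite_subset)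
    then show False using infinite_Icc[of "0::real" 1] by simp
  qed
qed auto

text \<open>Simplices are handled through their vertex sets: \<open>tops K\<close> are those of the maximal simplices and
  \<open>ridges K\<close> those of their facets.\<close>

definition tops :: "(real ^ 'm) set set \<Rightarrow> (real ^ 'm) set set" where
  "tops K = verts ` {\<tau>\<in>K. aff_dim \<tau> = int CARD('m)}"

definition ridges :: "(real ^ 'm) set set \<Rightarrow> (real ^ 'm) set set" where
  "ridges K = {S. card S = CARD('m) \<and> (\<exists>T\<in>tops K. S \<subseteq> T)}"

definition frame :: "(real ^ 'm) set \<Rightarrow> real ^ 'm \<Rightarrow> real ^ 'm" where
  "frame T = (SOME g. dual_frame T g)"

locale primitively_triangulated =
  fixes P :: "(real ^ 'm) set" and K :: "(real ^ 'm) set set"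
  assumes polytope: "lattice_polytope P" and dim_P: "aff_dim P = int CARD('m)"
    and triangulation: "primitive_triangulation P K"
begin

lemma polytope_P: "polytope P"
  using polytope by (auto simp: lattice_polytope_def intro: polytope_convex_hull)

lemma convex_P: "convex P" and compact_P: "compact P" and closed_P: "closed P" and polyhedron_P: "polyhedron P"
  using polytope_P by (auto intro: polytope_imp_convex polytope_imp_compact polytope_imp_closed polytope_imp_polyhedron)

lemma interior_P: "interior P \<noteq> {}"
proof -
  have "rel_interior P \<noteq> {}" using rel_interior_eq_empty[OF convex_P] dim_P by force
  moreover have "affine hull P = UNIV" using dim_P by (simp flip: aff_dim_eq_full)
  ultimately show ?thesis by (simp add: rel_interior_interior)
qed

lemma frontier_P: "frontier P = P - interior P"
  by (simp add: frontier_def closed_P)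

lemma finite_K: "finite K" and Union_K: "\<Union>K = P"
  and verts_lat: "\<sigma> \<in> K \<Longrightarrow> verts \<sigma> \<subseteq> lat"
  and K_simplex: "\<sigma> \<in> K \<Longrightarrow> \<exists>n. n simplex \<sigma>"
  and K_face: "\<lbrakk>\<sigma> \<in> K; F face_of \<sigma>\<rbrakk> \<Longrightarrow> F \<in> K"
  and K_Int: "\<lbrakk>\<sigma> \<in> K; \<tau> \<in> K\<rbrakk> \<Longrightarrow> (\<sigma> \<inter> \<tau>) face_of \<sigma>"
  and K_vol: "\<lbrakk>\<sigma> \<in> K; \<And>\<tau>. \<lbrakk>\<tau> \<in> K; \<sigma> \<subseteq> \<tau>\<rbrakk> \<Longrightarrow> \<tau> = \<sigma>\<rbrakk> \<Longrightarrow> measure lebesgue \<sigma> = 1 / fact CARD('m)"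
  using triangulation by (auto simp: primitive_triangulation_def simplicial_complex_def)

lemma K_subset: "\<sigma> \<in> K \<Longrightarrow> \<sigma> \<subseteq> P"
  using Union_K by auto

lemma K_verts:
  assumes "\<sigma> \<in> K"
  shows "\<sigma> = convex hull (verts \<sigma>)" "\<not> affine_dependent (verts \<sigma>)" "finite (verts \<sigma>)"
    "int (card (verts \<sigma>)) = aff_dim \<sigma> + 1"
proof -
  obtain C where "\<not> affine_dependent C" "\<sigma> = convex hull C"
    using K_simplex[OF assms] by (auto simp: simplex_def)
  then show "\<sigma> = convex hull (verts \<sigma>)" "\<not> affine_dependent (verts \<sigma>)" "finite (verts \<sigma>)"
    "int (card (verts \<sigma>)) = aff_dim \<sigma> + 1"
    by (auto simp: verts_convex_hull aff_dim_convex_hull aff_independent_finite aff_dim_affine_independent)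
qed

lemma topsD:
  assumes "T \<in> tops K"
  shows tops_finite: "finite T" and tops_card: "card T = Suc CARD('m)" and tops_lat: "T \<subseteq> lat"
    and tops_indep: "\<not> affine_dependent T" and tops_K: "convex hull T \<in> K"
    and tops_frame: "dual_frame T (frame T)"
proof -
  obtain \<tau> where \<tau>: "\<tau> \<in> K" "aff_dim \<tau> = int CARD('m)" "T = verts \<tau>"
    using assms by (auto simp: tops_def)
  show fin: "finite T" and card: "card T = Suc CARD('m)" and lat: "T \<subseteq> lat"
    and "\<not> affine_dependent T" and K: "convex hull T \<in> K"
    using K_verts[OF \<tau>(1)] \<tau> verts_lat by auto
  have "measure lebesgue \<tau> = 1 / fact CARD('m)"
  proof (rule K_vol[OF \<tau>(1)])
    fix \<tau>' assume \<tau>': "\<tau>' \<in> K" "\<tau> \<subseteq> \<tau>'"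
    then have "\<tau> face_of \<tau>'" using K_Int[OF \<tau>'(1) \<tau>(1)] by (simp add: inf_absorb2)
    moreover have "convex \<tau>'" using K_simplex[OF \<tau>'(1)] convex_simplex by blast
    moreover have "aff_dim \<tau>' \<le> aff_dim \<tau>" using aff_dim_le_DIM[of \<tau>'] \<tau>(2) by simp
    ultimately show "\<tau>' = \<tau>" using face_of_aff_dim_lt[of \<tau>' \<tau>] by fastforce
  qed
  then have "measure lebesgue (convex hull T) = 1 / fact CARD('m)"
    using K_verts(1)[OF \<tau>(1)] \<tau>(3) by simp
  then have "\<exists>g. dual_frame T g" using dual_frame_exists[OF fin card lat] by blast
  then show "dual_frame T (frame T)" unfolding frame_def by (rule someI_ex)
qed

lemma subset_tops:
  assumes "S \<subseteq> T" "T \<in> tops K"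
  shows face_tops_K: "convex hull S \<in> K" and verts_face_tops: "verts (convex hull S) = S"
    and face_tops_indep: "\<not> affine_dependent S" and face_tops_finite: "finite S"
proof -
  show "convex hull S \<in> K"
    using K_face[OF tops_K[OF assms(2)]] face_of_convex_hull_affine_independent[OF tops_indep[OF assms(2)]] assms(1)
    by blast
  show ind: "\<not> affine_dependent S" using tops_indep assms affine_independent_subset by blast
  then show "verts (convex hull S) = S" "finite S"
    by (simp_all add: verts_convex_hull aff_independent_finite)
qed

text \<open>The volume condition forces the inclusion-maximal simplices to have full dimension.\<close>

lemma K_subset_tops:
  assumes "\<sigma> \<in> K"
  shows "\<exists>T\<in>tops K. verts \<sigma> \<subseteq> T"
proof -
  obtain \<tau> where \<tau>: "\<tau> \<in> K" "\<sigma> \<subseteq> \<tau>" "\<And>\<tau>'. \<lbrakk>\<tau>' \<in> K; \<tau> \<subseteq> \<tau>'\<rbrakk> \<Longrightarrow> \<tau>' = \<tau>"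
    using finite_has_maximal2[OF finite_K assms] by metis
  have "measure lebesgue \<tau> = 1 / fact CARD('m)" by (rule K_vol[OF \<tau>(1)]) (use \<tau>(3) in blast)
  then have "\<not> negligible \<tau>" using negligible_imp_measure0 by fastforce
  moreover have "convex \<tau>" using K_simplex[OF \<tau>(1)] convex_simplex by blast
  ultimately have "aff_dim \<tau> = int CARD('m)"
    using aff_dim_nonempty_interior[of \<tau>] negligible_convex_interior by auto
  then have top: "verts \<tau> \<in> tops K" using \<tau>(1) by (auto simp: tops_def)
  have "\<sigma> face_of \<tau>" using K_Int[OF \<tau>(1) assms] \<tau>(2) by (simp add: inf_absorb2)
  then obtain C where C: "C \<subseteq> verts \<tau>" "\<sigma> = convex hull C"
    using face_of_convex_hull_affine_independent[OF K_verts(2)[OF \<tau>(1)]] K_verts(1)[OF \<tau>(1)] by metis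
  then show ?thesis using top verts_face_tops by auto
qed

lemma finite_tops: "finite (tops K)"
  using finite_K by (simp add: tops_def)

lemma finite_ridges: "finite (ridges K)"
proof (rule finite_subset)
  show "ridges K \<subseteq> \<Union>(Pow ` tops K)" by (auto simp: ridges_def)
  show "finite (\<Union>(Pow ` tops K))" using finite_tops tops_finite by auto
qed

lemma P_eq_Union_tops: "P = (\<Union>T\<in>tops K. convex hull T)"
proof
  show "P \<subseteq> (\<Union>T\<in>tops K. convex hull T)"
  proof
    fix x assume "x \<in> P"
    then obtain \<sigma> where "\<sigma> \<in> K" "x \<in> \<sigma>" using Union_K by blast
    then show "x \<in> (\<Union>T\<in>tops K. convex hull T)"
      using K_subset_tops[of \<sigma>] K_verts(1)[of \<sigma>] hull_mono[of "verts \<sigma>"] by blast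
  qed
qed (use tops_K K_subset in blast)

lemma tops_Int:
  assumes T: "T \<in> tops K" and T': "T' \<in> tops K"
  shows "convex hull T \<inter> convex hull T' = convex hull (T \<inter> T')"
proof
  obtain C where C: "C \<subseteq> T" "convex hull T \<inter> convex hull T' = convex hull C"
    using K_Int[OF tops_K[OF T] tops_K[OF T']] face_of_convex_hull_affine_independent[OF tops_indep[OF T]] by blast
  have "convex hull T \<inter> convex hull T' face_of convex hull T'"
    using K_Int[OF tops_K[OF T'] tops_K[OF T]] by (simp add: inf_commute)
  then obtain C' where C': "C' \<subseteq> T'" "convex hull T \<inter> convex hull T' = convex hull C'"
    using face_of_convex_hull_affine_independent[OF tops_indep[OF T']] by blast
  have "C = C'" using verts_face_tops[OF C(1) T] verts_face_tops[OF C'(1) T'] C C' by metis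
  then show "convex hull T \<inter> convex hull T' \<subseteq> convex hull (T \<inter> T')"
    using C C' hull_mono[of C "T \<inter> T'"] by auto
qed (simp add: hull_mono)

abbreviation coord :: "(real ^ 'm) set \<Rightarrow> real ^ 'm \<Rightarrow> real ^ 'm \<Rightarrow> real" where
  "coord T \<equiv> bary_coord (frame T)"

lemma mem_face_tops:
  assumes "T \<in> tops K" "S \<subseteq> T"
  shows "x \<in> convex hull S \<longleftrightarrow> (\<forall>v\<in>T. coord T v x \<ge> 0) \<and> (\<forall>v\<in>T - S. coord T v x = 0)"
  using assms by (intro mem_convex_hull_bary_coord tops_frame tops_finite tops_card)

lemma positive_coord_in_tops:
  assumes T: "T \<in> tops K" and T': "T' \<in> tops K" and x: "x \<in> convex hull T" "x \<in> convex hull T'"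
    and v: "v \<in> T" "coord T v x > 0"
  shows "v \<in> T'"
proof -
  have "x \<in> convex hull (T \<inter> T')" using x tops_Int[OF T T'] by auto
  then show ?thesis using mem_face_tops[OF T, of "T \<inter> T'" x] v by force
qed

lemma coord_rel_interior:
  assumes T: "T \<in> tops K" and S: "S \<subseteq> T" and x: "x \<in> rel_interior (convex hull S)"
  shows "\<And>v. v \<in> S \<Longrightarrow> coord T v x > 0" "\<And>v. v \<in> T - S \<Longrightarrow> coord T v x = 0"
proof -
  obtain c where c: "\<forall>v\<in>S. 0 < c v" "sum c S = 1" "(\<Sum>v\<in>S. c v *\<^sub>R v) = x"
    using x rel_interior_convex_hull_explicit[OF face_tops_indep[OF S T]] by auto
  then show "\<And>v. v \<in> S \<Longrightarrow> coord T v x > 0" "\<And>v. v \<in> T - S \<Longrightarrow> coord T v x = 0"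
    using bary_coord_combination[OF tops_frame[OF T] tops_finite[OF T] S c(2)] S by auto
qed

lemma ridge_apex:
  assumes "S \<in> ridges K" "T \<in> tops K" "S \<subseteq> T"
  obtains a where "a \<in> T" "a \<notin> S" "T = insert a S" "S = T - {a}"
proof -
  have "card (T - S) = 1"
    using assms tops_card[OF assms(2)] finite_subset[OF assms(3) tops_finite[OF assms(2)]]
    by (simp add: ridges_def card_Diff_subset)
  then obtain a where "T - S = {a}" using card_1_singletonE by blast
  then show thesis using that[of a] assms(3) by blast
qed

lemma ridgeD:
  assumes "S \<in> ridges K"
  shows "card S = CARD('m)" "finite S" "S \<subseteq> lat" "S \<noteq> {}" "convex hull S \<in> K" "verts (convex hull S) = S"
    "aff_dim (convex hull S) = int CARD('m) - 1"
proof -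
  obtain T where T: "T \<in> tops K" "S \<subseteq> T" and c: "card S = CARD('m)" using assms by (auto simp: ridges_def)
  show "card S = CARD('m)" by (rule c)
  show "finite S" "convex hull S \<in> K" "verts (convex hull S) = S" using subset_tops[OF T(2,1)] by auto
  show "S \<subseteq> lat" using T tops_lat by blast
  show "S \<noteq> {}" using c by auto
  show "aff_dim (convex hull S) = int CARD('m) - 1"
    using face_tops_indep[OF T(2,1)] c by (simp add: aff_dim_convex_hull affine_independent_iff_card)
qed

text \<open>The two linear forms are both constant on the common ridge, hence proportional, and the
  factor is read off at one of the apices.\<close>

lemma frame_proportional:
  assumes S: "S \<in> ridges K" and T: "insert a S \<in> tops K" "a \<notin> S" and T': "insert b S \<in> tops K" "b \<notin> S"
    and s: "s \<in> S"
  shows "frame (insert a S) a \<bullet> z = (frame (insert a S) a \<bullet> (b - s)) * (frame (insert b S) b \<bullet> z)"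
proof -
  let ?g = "frame (insert a S)" and ?h = "frame (insert b S)"
  note g = dual_frame_inner[OF tops_frame[OF T(1)]]
  have ga: "?g a \<bullet> (v - s) = 0" if "v \<in> S" for v using g[of a v s] that s T(2) by auto
  have "?g a \<bullet> z = ?g a \<bullet> (\<Sum>v\<in>insert b S - {s}. (?h v \<bullet> z) *\<^sub>R (v - s))"
    using dual_frame_expand[OF tops_frame[OF T'(1)] tops_finite[OF T'(1)] tops_card[OF T'(1)], of s z] s by simp
  also have "\<dots> = (\<Sum>v\<in>insert b S - {s}. (?h v \<bullet> z) * (?g a \<bullet> (v - s)))"
    by (simp add: inner_sum_right)
  also have "\<dots> = (\<Sum>v\<in>{b}. (?h v \<bullet> z) * (?g a \<bullet> (v - s)))"
    by (rule sum.mono_neutral_right) (use ga T'(2) s ridgeD(2)[OF S] in auto)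
  finally show ?thesis by simp
qed

lemma interior_ridge_point:
  assumes S: "S \<in> ridges K" and int: "\<not> convex hull S \<subseteq> frontier P"
  obtains x where "x \<in> rel_interior (convex hull S)" "x \<in> interior P"
proof -
  have "convex hull S \<subseteq> P" using ridgeD(5)[OF S] K_subset by blast
  then obtain z where z: "z \<in> convex hull S" "z \<in> interior P" using int frontier_P by auto
  then have "z \<in> closure (rel_interior (convex hull S))"
    using convex_closure_rel_interior[OF convex_convex_hull, of S] closure_subset by blast
  then have "interior P \<inter> rel_interior (convex hull S) \<noteq> {}"
    using z open_Int_closure_eq_empty[OF open_interior, of P] by blast
  then show thesis using that by blast
qed

text \<open>Moving from a point in the relative interior of the ridge towards \<open>a\<close> leads at first into the
  relative interior of the one simplex and also into the other one, so the two have a common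
  point that does not lie in the ridge.\<close>

lemma tops_same_side:
  assumes S: "S \<in> ridges K" and x: "x \<in> rel_interior (convex hull S)"
    and T: "insert a S \<in> tops K" "a \<notin> S" and T': "insert b S \<in> tops K" "b \<notin> S"
    and pos: "frame (insert b S) b \<bullet> (a - x) > 0"
  shows "a = b"
proof (rule ccontr)
  assume ab: "a \<noteq> b"
  let ?T = "insert a S" and ?T' = "insert b S"
  let ?y = "\<lambda>t. (1 - t) *\<^sub>R x + t *\<^sub>R a"
  note fin = ridgeD(2)[OF S]
  have cx: "coord ?T v x > 0" "coord ?T' v x > 0" if "v \<in> S" for v
    using coord_rel_interior[OF T(1) _ x] coord_rel_interior[OF T'(1) _ x] that by auto
  have ca: "coord ?T a x = 0" "coord ?T' b x = 0"
    using coord_rel_interior(2)[OF T(1) _ x] coord_rel_interior(2)[OF T'(1) _ x] T T' by auto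
  have "\<exists>t. 0 < t \<and> t < 1 \<and> (\<forall>v\<in>S. coord ?T' v (?y t) \<ge> 0)"
  proof -
    have "\<forall>v\<in>S. \<forall>\<^sub>F t in at_right 0. coord ?T' v (?y t) \<ge> 0"
    proof
      fix v assume v: "v \<in> S"
      have "((\<lambda>t. coord ?T' v (?y t)) \<longlongrightarrow> (1 - 0) * coord ?T' v x + 0 * coord ?T' v a) (at_right 0)"
        unfolding bary_coord_affine by (intro tendsto_intros)
      then have "\<forall>\<^sub>F t in at_right 0. coord ?T' v (?y t) > 0"
        using cx(2)[OF v] by (intro order_tendstoD(1)) auto
      then show "\<forall>\<^sub>F t in at_right 0. coord ?T' v (?y t) \<ge> 0" by eventually_elim simp
    qed
    then have "\<forall>\<^sub>F t in at_right 0. \<forall>v\<in>S. coord ?T' v (?y t) \<ge> 0"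
      using fin by (simp add: eventually_ball_finite)
    moreover have "\<forall>\<^sub>F t in at_right (0::real). t \<in> {0<..<1}"
      by (rule eventually_at_right_real) simp
    ultimately have "\<forall>\<^sub>F t in at_right 0. 0 < t \<and> t < 1 \<and> (\<forall>v\<in>S. coord ?T' v (?y t) \<ge> 0)"
      by eventually_elim auto
    then show ?thesis using eventually_happens by force
  qed
  then obtain t where t: "0 < t" "t < 1" "\<forall>v\<in>S. coord ?T' v (?y t) \<ge> 0" by blast
  have "coord ?T' b a > 0" using bary_coord_diff[of "frame ?T'" b a x] ca pos by simp
  then have "coord ?T' b (?y t) > 0" using t by (simp add: bary_coord_affine ca)
  then have in': "?y t \<in> convex hull ?T'"
    using mem_face_tops[OF T'(1) order_refl, of "?y t"] t by auto
  have "x \<in> convex hull ?T" using x rel_interior_subset hull_mono[of S ?T] by blast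
  then have in1: "?y t \<in> convex hull ?T"
    using convexD_alt[OF convex_convex_hull[of ?T], of x a t] t by (auto intro: hull_inc)
  have "coord ?T a (?y t) > 0"
    using t by (simp add: bary_coord_affine ca bary_coord_vertex[OF tops_frame[OF T(1)]])
  then have "a \<in> ?T'" using positive_coord_in_tops[OF T(1) T'(1) in1 in'] by simp
  then show False using ab T(2) by simp
qed

text \<open>Near a point \<open>x\<close> that is interior to both \<open>P\<close> and the ridge, \<open>P\<close> is covered by the simplices through
  \<open>x\<close>, which contain the ridge. So there is one on each side of it, and not more than one.\<close>

lemma interior_ridge_two_tops:
  assumes S: "S \<in> ridges K" and int: "\<not> convex hull S \<subseteq> frontier P"
  obtains a b where "a \<noteq> b" "a \<notin> S" "b \<notin> S" "{T \<in> tops K. S \<subseteq> T} = {insert a S, insert b S}"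
proof -
  obtain x where x: "x \<in> rel_interior (convex hull S)" "x \<in> interior P"
    using interior_ridge_point[OF S int] by blast
  obtain T0 where T0: "T0 \<in> tops K" "S \<subseteq> T0" using S by (auto simp: ridges_def)
  obtain a where a: "a \<notin> S" "T0 = insert a S" using ridge_apex[OF S T0] by metis
  let ?h = "frame T0 a"
  have xh: "x \<in> convex hull S" using x rel_interior_subset by blast
  obtain s where s: "s \<in> S" using ridgeD(4)[OF S] by blast
  have frx: "frame (insert c S) c \<bullet> (y - x) = frame (insert c S) c \<bullet> (y - s)"
    if "insert c S \<in> tops K" "c \<notin> S" for c y
  proof -
    have "coord (insert c S) c x = 0" "coord (insert c S) c s = 0"
      using coord_rel_interior(2)[OF that(1) _ x(1), of c] bary_coord_vertex[OF tops_frame[OF that(1)], of c s] s that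
      by auto
    then show ?thesis
      using bary_coord_diff[of "frame (insert c S)" c y x] bary_coord_diff[of "frame (insert c S)" c y s] by simp
  qed
  have h0: "?h \<noteq> 0"
    using dual_frame_inner[OF tops_frame[OF T0(1)], of a a s] a s by auto
  have side: "\<exists>c. c \<notin> S \<and> insert c S \<in> tops K \<and> sg * (?h \<bullet> (c - x)) > 0" if sg: "sg \<noteq> 0" for sg :: real
  proof -
    \<comment> \<open>A point off the ridge on the side \<open>sg\<close>, so close to \<open>x\<close> that it avoids the simplices not
      containing \<open>x\<close>\<close>
    let ?F = "\<Union>T\<in>{T \<in> tops K. x \<notin> convex hull T}. convex hull T"
    have "closed ?F" using finite_tops by (auto intro!: closed_Union compact_imp_closed finite_imp_compact_convex_hull tops_finite)
    then have "open (interior P - ?F)" by blast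
    then obtain e where e: "e > 0" "ball x e \<subseteq> interior P - ?F"
      using x(2) by (metis (no_types, lifting) Diff_iff UN_E mem_Collect_eq open_contains_ball)
    define t where "t = e / (2 * norm ?h)"
    have t: "t > 0" using e h0 by (simp add: t_def)
    define y where "y = x + (t * sgn sg) *\<^sub>R ?h"
    have "dist x y = e / 2" using h0 sg e by (simp add: y_def dist_norm t_def abs_mult abs_sgn_eq)
    then have "y \<in> ball x e" using e by simp
    then have y: "y \<in> interior P - ?F" using e by blast
    then obtain T where T: "T \<in> tops K" "y \<in> convex hull T" "x \<in> convex hull T"
      using P_eq_Union_tops interior_subset by blast
    have xT0: "x \<in> convex hull T0" using xh hull_mono[OF T0(2)] by blast
    have "S \<subseteq> T"
      using positive_coord_in_tops[OF T0(1) T(1) xT0 T(3)] coord_rel_interior(1)[OF T0 x(1)] T0(2) by blast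
    then obtain c where c: "c \<notin> S" "T = insert c S" using ridge_apex[OF S T(1)] by metis
    have "coord T c x = 0" using coord_rel_interior(2)[OF T(1) \<open>S \<subseteq> T\<close> x(1)] c by auto
    then have "frame T c \<bullet> (y - x) \<ge> 0"
      using bary_coord_diff[of "frame T" c y x] mem_face_tops[OF T(1) order_refl, of y] T(2) c by auto
    then have fr: "sgn sg * (frame T c \<bullet> ?h) \<ge> 0" using t by (auto simp: y_def zero_le_mult_iff mult_le_0_iff)
    have "?h \<bullet> ?h = (?h \<bullet> (c - s)) * (frame T c \<bullet> ?h)"
      using frame_proportional[OF S, of a c s ?h] T0(1) T(1) a c s by simp
    then have "(?h \<bullet> (c - x)) * (frame T c \<bullet> ?h) > 0"
      using frx[of a c] T0(1) a inner_gt_zero_iff[of ?h] h0 by simp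
    then have "sg * (?h \<bullet> (c - x)) > 0"
      using fr sg by (auto simp: zero_less_mult_iff zero_le_mult_iff sgn_if split: if_splits)
    then show ?thesis using c T(1) by blast
  qed
  obtain b where b: "b \<notin> S" "insert b S \<in> tops K" "?h \<bullet> (b - x) < 0" using side[of "-1"] by auto
  have ab: "a \<noteq> b"
  proof
    assume "a = b"
    then have "?h \<bullet> (a - s) < 0" using b frx[of a a] T0 a by simp
    moreover have "s \<noteq> a" using a s by auto
    ultimately show False using dual_frame_inner[OF tops_frame[OF T0(1)], of a a s] a s by auto
  qed
  have "T = insert a S \<or> T = insert b S" if T: "T \<in> tops K" "S \<subseteq> T" for T
  proof -
    obtain c where c: "c \<notin> S" "T = insert c S" using ridge_apex[OF S T] by metis
    have "?h \<bullet> (c - x) \<noteq> 0"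
    proof
      assume "?h \<bullet> (c - x) = 0"
      then have "?h \<bullet> ?h = 0"
        using frame_proportional[OF S, of a c s ?h] frx[of a c] T0(1) T(1) a c s by simp
      then show False using h0 by simp
    qed
    then consider "?h \<bullet> (c - x) > 0" | "?h \<bullet> (c - x) < 0" by linarith
    then show ?thesis
    proof cases
      case 1
      then have "c = a" using tops_same_side[OF S x(1), of c a] T T0(1) a c by simp
      then show ?thesis using c by simp
    next
      case 2
      have "?h \<bullet> (c - s) = (?h \<bullet> (b - s)) * (frame (insert b S) b \<bullet> (c - s))"
        using frame_proportional[OF S, of a b s "c - s"] T0(1) a b s by simp
      then have "frame (insert b S) b \<bullet> (c - x) > 0"
        using 2 b(3) frx[of a c] frx[of a b] frx[of b c] T0(1) a b(1,2)
        by (auto simp: mult_less_0_iff)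
      then have "c = b" using tops_same_side[OF S x(1), of c b] T b c by simp
      then show ?thesis using c by simp
    qed
  qed
  then have "{T \<in> tops K. S \<subseteq> T} = {insert a S, insert b S}" using T0 a b by auto
  then show thesis using that[of a b] ab a b by blast
qed

end

context primitively_triangulated begin

lemma boundary_ridge_facet:
  assumes S: "S \<in> ridges K" and bd: "convex hull S \<subseteq> frontier P"
  shows "\<exists>Q. Q facet_of P \<and> convex hull S \<subseteq> Q"
proof -
  have "rel_interior (convex hull S) \<noteq> {}"
    using ridgeD(4)[OF S] by (simp add: rel_interior_eq_empty)
  then obtain x where x: "x \<in> rel_interior (convex hull S)" by blast
  then have "x \<in> rel_frontier P"
    using bd rel_interior_subset rel_frontier_nonempty_interior[OF interior_P] by blast
  then obtain Q where Q: "Q facet_of P" "x \<in> Q"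
    using rel_frontier_of_polyhedron[OF polyhedron_P] by blast
  have "convex hull S \<subseteq> P" using ridgeD(5)[OF S] K_subset by blast
  then show ?thesis
    using subset_of_face_of[OF facet_of_imp_face_of[OF Q(1)]] x Q by blast
qed

lemma facet_aff_dim: "Q facet_of P \<Longrightarrow> aff_dim Q = int CARD('m) - 1"
  by (simp add: facet_of_def dim_P)

text \<open>The facet is covered by faces of simplices; a cover by faces of smaller dimension is impossible.\<close>

lemma facet_contains_ridge:
  assumes Q: "Q facet_of P"
  shows "\<exists>S\<in>ridges K. convex hull S \<subseteq> Q"
proof -
  have face: "Q face_of P" by (rule facet_of_imp_face_of[OF Q])
  have Qne: "Q \<noteq> {}" using Q by (simp add: facet_of_def)
  have sub: "Q \<inter> convex hull T \<subseteq> affine hull (T \<inter> Q)" if T: "T \<in> tops K" for T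
  proof -
    have "Q \<inter> convex hull T face_of P \<inter> convex hull T"
      by (rule face_of_slice[OF face convex_convex_hull])
    then have "Q \<inter> convex hull T face_of convex hull T"
      using K_subset[OF tops_K[OF T]] by (simp add: inf_absorb2)
    then obtain C where C: "C \<subseteq> T" "Q \<inter> convex hull T = convex hull C"
      using face_of_convex_hull_affine_independent[OF tops_indep[OF T]] by blast
    then have "C \<subseteq> T \<inter> Q" using hull_subset[of C convex] by blast
    then show ?thesis using C(2) convex_hull_subset_affine_hull hull_mono by (metis subset_trans)
  qed
  have "Q \<subseteq> (\<Union>T\<in>tops K. affine hull (T \<inter> Q))"
    using sub P_eq_Union_tops face_of_imp_subset[OF face] by blast
  then have "\<exists>A\<in>(\<lambda>T. affine hull (T \<inter> Q)) ` tops K. Q \<subseteq> A"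
    using finite_tops face_of_imp_convex[OF face] Qne
    by (intro convex_subset_Union_affine) auto
  then obtain T where T: "T \<in> tops K" "Q \<subseteq> affine hull (T \<inter> Q)" by blast
  have "aff_dim Q \<le> int (card (T \<inter> Q)) - 1"
    using aff_dim_subset[OF T(2)] aff_dim_le_card[of "T \<inter> Q"] tops_finite[OF T(1)] by simp
  then have ge: "card (T \<inter> Q) \<ge> CARD('m)" using facet_aff_dim[OF Q] by simp
  have "T \<inter> Q \<noteq> T"
  proof
    assume "T \<inter> Q = T"
    then have "aff_dim T \<le> aff_dim Q" using aff_dim_subset[of T Q] by blast
    then show False
      using facet_aff_dim[OF Q] tops_indep[OF T(1)] tops_card[OF T(1)] by (simp add: affine_independent_iff_card)
  qed
  then have "card (T \<inter> Q) < Suc CARD('m)"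
    using psubset_card_mono[OF tops_finite[OF T(1)], of "T \<inter> Q"] tops_card[OF T(1)] by auto
  then have "T \<inter> Q \<in> ridges K" using ge T(1) by (auto simp: ridges_def)
  moreover have "convex hull (T \<inter> Q) \<subseteq> Q"
    using hull_minimal[of "T \<inter> Q" Q convex] face_of_imp_convex[OF face] by blast
  ultimately show ?thesis by blast
qed

lemma facet_frame_in_Sed:
  assumes Q: "Q facet_of P" and S: "S \<in> ridges K" and SQ: "convex hull S \<subseteq> Q"
    and T: "insert a S \<in> tops K" "a \<notin> S"
  shows "mod2 (frame (insert a S) a) \<in> Sed Q"
proof -
  let ?g = "frame (insert a S) a"
  obtain s where s: "s \<in> S" using ridgeD(4)[OF S] by blast
  have SQ': "S \<subseteq> Q" using SQ hull_subset[of S convex] by simp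
  have "affine hull S = affine hull Q"
  proof (rule affine_dim_equal)
    show "aff_dim (affine hull S) = aff_dim (affine hull Q)"
      using ridgeD(7)[OF S] facet_aff_dim[OF Q] by (simp add: aff_dim_convex_hull)
    show "affine hull S \<subseteq> affine hull Q" by (rule hull_mono[OF SQ'])
  qed (use s in auto)
  moreover have "affine hull S \<subseteq> {y. ?g \<bullet> y = ?g \<bullet> s}"
  proof (rule hull_minimal)
    show "S \<subseteq> {y. ?g \<bullet> y = ?g \<bullet> s}"
    proof
      fix y assume "y \<in> S"
      then have "?g \<bullet> (y - s) = 0" using dual_frame_inner[OF tops_frame[OF T(1)], of a y s] s T(2) by auto
      then show "y \<in> {y. ?g \<bullet> y = ?g \<bullet> s}" by (simp add: inner_diff_right)
    qed
  qed (rule affine_hyperplane)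
  ultimately have "Q \<subseteq> {y. ?g \<bullet> y = ?g \<bullet> s}" using hull_subset[of Q affine] by simp
  then have "?g \<bullet> (x - y) = 0" if "x \<in> Q" "y \<in> Q" for x y
    using that by (auto simp: inner_diff_right subset_iff)
  moreover have "?g \<in> lat" using dual_frame_lat[OF tops_frame[OF T(1)]] by simp
  ultimately show ?thesis unfolding perp2_def by blast
qed

text \<open>A generic segment from a simplex of the class to one outside avoids all faces of codimension
  two, so it has to leave the class across a common facet of two maximal simplices.\<close>

lemma tops_strongly_connected:
  assumes sub: "A \<subseteq> tops K" and ne: "A \<noteq> {}"
    and closed: "\<And>S T T'. \<lbrakk>S \<in> ridges K; T \<in> A; T' \<in> tops K; S \<subseteq> T; S \<subseteq> T'\<rbrakk> \<Longrightarrow> T' \<in> A"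
  shows "A = tops K"
proof (rule ccontr)
  assume "A \<noteq> tops K"
  then obtain T2 where T2: "T2 \<in> tops K" "T2 \<notin> A" using sub by blast
  obtain T1 where T1: "T1 \<in> A" using ne by blast
  define B where "B = (\<lambda>(T, T'). T \<inter> T') ` (A \<times> (tops K - A))"
  have finA: "finite A" using finite_subset[OF sub finite_tops] .
  have finB: "finite B" unfolding B_def using finA finite_tops by blast
  have B: "finite C \<and> int (card C) \<le> int CARD('m) - 1" if C: "C \<in> B" for C
  proof -
    obtain T T' where T: "T \<in> A" "T' \<in> tops K" "T' \<notin> A" "C = T \<inter> T'"
      using C by (auto simp: B_def)
    have fin: "finite T" and cT: "card T = Suc CARD('m)" "card T' = Suc CARD('m)" "finite T'"
      using T sub tops_finite tops_card by blast+
    have "C \<noteq> T" using T cT fin by (metis card_subset_eq inf_le2)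
    then have lt: "card C < Suc CARD('m)" using psubset_card_mono[OF fin, of C] T cT by auto
    have "card C \<noteq> CARD('m)"
    proof
      assume "card C = CARD('m)"
      then have "C \<in> ridges K" using T sub by (auto simp: ridges_def)
      then show False using closed[of C T T'] T by blast
    qed
    then show ?thesis using lt fin T by simp
  qed
  have generic: "\<exists>x\<in>convex hull T. \<forall>C\<in>B. x \<notin> affine hull (insert y C)" if T: "T \<in> tops K" for T y
  proof (rule ccontr)
    assume "\<not> ?thesis"
    then have "convex hull T \<subseteq> \<Union>((\<lambda>C. affine hull (insert y C)) ` B)" by blast
    moreover have "T \<noteq> {}" using tops_card[OF T] by auto
    ultimately have "\<exists>H\<in>(\<lambda>C. affine hull (insert y C)) ` B. convex hull T \<subseteq> H"
      using finB by (intro convex_subset_Union_affine) auto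
    then obtain C where C: "C \<in> B" "convex hull T \<subseteq> affine hull (insert y C)" by blast
    have "aff_dim T \<le> aff_dim (insert y C)"
      using aff_dim_subset[OF C(2)] by (simp add: aff_dim_convex_hull)
    also have "\<dots> \<le> int (card (insert y C)) - 1"
      by (rule aff_dim_le_card) (use B[OF C(1)] in simp)
    also have "\<dots> \<le> int (card C)" using card_insert_le_m1[of "Suc (card C)" C y] by simp
    finally show False
      using B[OF C(1)] tops_indep[OF T] tops_card[OF T] by (simp add: affine_independent_iff_card)
  qed
  have T1': "T1 \<in> tops K" using T1 sub by blast
  obtain x where x: "x \<in> convex hull T1" "\<forall>C\<in>B. x \<notin> affine hull C"
    using generic[OF T1'] by (meson hull_mono subsetD subset_insertI)
  obtain y where y: "y \<in> convex hull T2" "\<forall>C\<in>B. y \<notin> affine hull (insert x C)"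
    using generic[OF T2(1)] by blast
  let ?L = "closed_segment x y"
  let ?U = "(\<Union>T\<in>A. convex hull T) \<inter> ?L" and ?V = "(\<Union>T\<in>tops K - A. convex hull T) \<inter> ?L"
  have LP: "?L \<subseteq> P"
  proof (rule closed_segment_subset[OF _ _ convex_P])
    show "x \<in> P" "y \<in> P" using P_eq_Union_tops x(1) y(1) T1' T2(1) by blast+
  qed
  have cl: "closed (\<Union>T\<in>A'. convex hull T)" if "A' \<subseteq> tops K" for A'
    using that finite_subset[OF that finite_tops]
    by (intro closed_UN) (auto intro!: compact_imp_closed finite_imp_compact_convex_hull tops_finite)
  have "closed ?U" "closed ?V" using cl sub by (auto intro: closed_Int)
  moreover have "?U \<union> ?V = ?L" using LP P_eq_Union_tops sub by blast
  moreover have "?U \<noteq> {}" "?V \<noteq> {}" using x(1) y(1) T1 T2 by auto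
  ultimately have "?U \<inter> ?V \<noteq> {}"
    using connected_closed_set[OF closed_segment(1), of x y] connected_segment(1)[of x y] by meson
  then obtain z T T' where z: "z \<in> ?L" and T: "T \<in> A" "T' \<in> tops K - A" "z \<in> convex hull T" "z \<in> convex hull T'"
    by blast
  have CB: "T \<inter> T' \<in> B" using T by (auto simp: B_def)
  have zC: "z \<in> affine hull (T \<inter> T')"
    using tops_Int[of T T'] T sub convex_hull_subset_affine_hull by blast
  obtain t where t: "0 \<le> t" "z = (1 - t) *\<^sub>R x + t *\<^sub>R y" using z by (auto simp: closed_segment_def)
  have "t \<noteq> 0" using t zC x(2) CB by auto
  then have "(1 / t) *\<^sub>R z = (1 / t - 1) *\<^sub>R x + y"
    by (simp add: t(2) scaleR_add_right algebra_simps)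
  then have "y = (1 - 1 / t) *\<^sub>R x + (1 / t) *\<^sub>R z" by (simp add: algebra_simps)
  moreover have "x \<in> affine hull (insert x (T \<inter> T'))" "z \<in> affine hull (insert x (T \<inter> T'))"
    using zC hull_mono[of "T \<inter> T'" "insert x (T \<inter> T')" affine] by (auto intro: hull_inc)
  ultimately have "y \<in> affine hull (insert x (T \<inter> T'))"
    using mem_affine[OF affine_affine_hull, of x "insert x (T \<inter> T')" z "1 - 1 / t" "1 / t"] by simp
  then show False using y(2) CB by blast
qed

end

section \<open>The facets at a vertex of a smooth polytope\<close>

text \<open>The components of \<open>\<beta> b\<close> are the coefficients of \<open>b\<close> in the expansions of the coordinate vectors.\<close>

lemma lattice_basis_dual:
  fixes B :: "(real ^ 'm) set"
  assumes B: "lattice_basis B"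
  obtains \<beta> where "\<And>b. \<beta> b \<in> lat" "\<And>x. x = (\<Sum>b\<in>B. (\<beta> b \<bullet> x) *\<^sub>R b)"
proof -
  have "axis i 1 \<in> {\<Sum>b\<in>B. of_int (c b) *\<^sub>R b | c :: real ^ 'm \<Rightarrow> int. True}" for i
    using B lat_axis[of i] by (simp add: lattice_basis_def)
  then have "\<exists>c :: real ^ 'm \<Rightarrow> int. axis i 1 = (\<Sum>b\<in>B. of_int (c b) *\<^sub>R b)" for i by blast
  then obtain c :: "'m \<Rightarrow> real ^ 'm \<Rightarrow> int" where c: "\<And>i. axis i 1 = (\<Sum>b\<in>B. of_int (c i b) *\<^sub>R b)" by metis
  define \<beta> :: "real ^ 'm \<Rightarrow> real ^ 'm" where "\<beta> b = (\<chi> i. of_int (c i b))" for b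
  have "x = (\<Sum>b\<in>B. (\<beta> b \<bullet> x) *\<^sub>R b)" for x :: "real ^ 'm"
  proof -
    have "x = (\<Sum>i\<in>UNIV. x $ i *\<^sub>R axis i 1)"
      by (metis (no_types, lifting) basis_expansion scalar_mult_eq_scaleR sum.cong)
    also have "\<dots> = (\<Sum>i\<in>UNIV. \<Sum>b\<in>B. (x $ i * of_int (c i b)) *\<^sub>R b)"
      by (simp add: c scaleR_sum_right)
    also have "\<dots> = (\<Sum>b\<in>B. \<Sum>i\<in>UNIV. (x $ i * of_int (c i b)) *\<^sub>R b)" by (rule sum.swap)
    also have "\<dots> = (\<Sum>b\<in>B. (\<beta> b \<bullet> x) *\<^sub>R b)"
      by (simp add: \<beta>_def inner_vec_def scaleR_sum_left mult.commute)
    finally show ?thesis .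
  qed
  moreover have "\<beta> b \<in> lat" for b by (simp add: \<beta>_def lat_def)
  ultimately show thesis using that by blast
qed

text \<open>\<open>F\<close> indexes the inequalities \<open>a h \<bullet> x \<le> b h\<close> of the facets at \<open>p\<close>; along \<open>z h\<close> one moves from \<open>p\<close>
  inside \<open>P\<close> and inside all these facets except that of \<open>h\<close>.\<close>

definition vertex_inequalities ::
  "(real ^ 'm) set \<Rightarrow> real ^ 'm \<Rightarrow> 'i set \<Rightarrow> ('i \<Rightarrow> real ^ 'm) \<Rightarrow> ('i \<Rightarrow> real) \<Rightarrow> ('i \<Rightarrow> real ^ 'm) \<Rightarrow> bool" where
  "vertex_inequalities P p F a b z \<longleftrightarrow>
     (\<forall>h\<in>F. P \<inter> {x. a h \<bullet> x = b h} facet_of P) \<and>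
     (\<forall>Q. Q facet_of P \<and> p \<in> Q \<longrightarrow> (\<exists>h\<in>F. Q = P \<inter> {x. a h \<bullet> x = b h})) \<and>
     (\<forall>h\<in>F. a h \<bullet> p = b h) \<and> (\<forall>v. (\<forall>h\<in>F. a h \<bullet> v = 0) \<longrightarrow> v = 0) \<and>
     (\<forall>h\<in>F. a h \<bullet> z h \<noteq> 0 \<and> (\<forall>h'\<in>F. h' \<noteq> h \<longrightarrow> a h' \<bullet> z h = 0) \<and> (\<exists>t>0. p + t *\<^sub>R z h \<in> P))"

text \<open>The inequalities of a minimal description of \<open>P\<close> correspond to the facets. At the vertex \<open>p\<close> of a
  simple polytope as many are tight as the dimension says. They determine \<open>p\<close>, so those other than
  \<open>h\<close> leave a line, on which one direction \<open>z h\<close> leads into \<open>P\<close>.\<close>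

lemma simple_vertex_directions:
  fixes P :: "(real ^ 'm) set"
  assumes P: "polytope P" and dim: "aff_dim P = int CARD('m)" and simple: "simple_polytope P"
    and p: "p extreme_point_of P"
  shows "\<exists>(F :: (real ^ 'm) set set) a b z. vertex_inequalities P p F a b z"
proof -
  have UNIV: "affine hull P = UNIV" using dim by (simp flip: aff_dim_eq_full)
  have "polyhedron P" using P by (rule polytope_imp_polyhedron)
  then obtain G where G: "finite G" "P = affine hull P \<inter> \<Inter>G"
      and Gh: "\<forall>h\<in>G. \<exists>a b. a \<noteq> 0 \<and> h = {x. a \<bullet> x \<le> b}"
      and min: "\<forall>G'. G' \<subset> G \<longrightarrow> P \<subset> affine hull P \<inter> \<Inter>G'"
    using polyhedron_Int_affine_minimal by metis
  obtain a b where ab: "\<And>h. h \<in> G \<Longrightarrow> a h \<noteq> 0 \<and> h = {x. a h \<bullet> x \<le> b h}"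
  proof -
    obtain a where a: "\<forall>h\<in>G. \<exists>b. a h \<noteq> 0 \<and> h = {x. a h \<bullet> x \<le> b}"
      using bchoice[OF Gh] by blast
    obtain b where b: "\<forall>h\<in>G. a h \<noteq> 0 \<and> h = {x. a h \<bullet> x \<le> b h}"
      using bchoice[OF a] by blast
    show thesis by (rule that) (erule bspec[OF b])
  qed
  have memh: "x \<in> h \<longleftrightarrow> a h \<bullet> x \<le> b h" if "h \<in> G" for h x
    using arg_cong[where f = "\<lambda>h. x \<in> h", OF conjunct2[OF ab[OF that]]] by simp
  let ?Q = "\<lambda>h. P \<inter> {x. a h \<bullet> x = b h}"
  have facets: "C facet_of P \<longleftrightarrow> (\<exists>h. h \<in> G \<and> C = ?Q h)" for C
    by (rule facet_of_polyhedron_explicit[OF G ab min[rule_format]])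
  have mem: "x \<in> P \<longleftrightarrow> (\<forall>h\<in>G. a h \<bullet> x \<le> b h)" for x
  proof -
    have "x \<in> P \<longleftrightarrow> (\<forall>h\<in>G. x \<in> h)" using G(2) UNIV by blast
    then show ?thesis using memh by blast
  qed
  have "rel_interior P \<noteq> {}"
    using rel_interior_eq_empty[OF polytope_imp_convex[OF P]] dim by force
  then obtain o' where o': "\<And>h. h \<in> G \<Longrightarrow> a h \<bullet> o' < b h"
  proof -
    have "rel_interior P = {x \<in> P. \<forall>h\<in>G. a h \<bullet> x < b h}"
      by (rule rel_interior_polyhedron_explicit[OF G ab min[rule_format]])
    then have "\<exists>x. \<forall>h\<in>G. a h \<bullet> x < b h" using \<open>rel_interior P \<noteq> {}\<close> by auto
    then show thesis using that by blast
  qed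
  \<comment> \<open>Without the inequality \<open>h'\<close> there is a point \<open>y\<close> outside \<open>P\<close>; the segment from an interior point
    to \<open>y\<close> leaves \<open>P\<close> in a point where no other inequality is tight.\<close>
  have inj: "h = h'" if h: "h \<in> G" "h' \<in> G" and eq: "?Q h = ?Q h'" for h h'
  proof (rule ccontr)
    assume ne: "h \<noteq> h'"
    have "P \<subset> affine hull P \<inter> \<Inter>(G - {h'})" by (rule min[rule_format]) (use h(2) in blast)
    then obtain y where y: "y \<notin> P" "y \<in> \<Inter>(G - {h'})" by (metis IntE psubset_imp_ex_mem DiffE)
    have yk: "a k \<bullet> y \<le> b k" if "k \<in> G - {h'}" for k using InterD[OF y(2) that] memh[of k y] that by simp
    have yh': "a h' \<bullet> y > b h'" using y(1) yk unfolding mem by force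
    define t where "t = (b h' - a h' \<bullet> o') / (a h' \<bullet> y - a h' \<bullet> o')"
    have t: "0 < t" "t < 1" using yh' o'[OF h(2)] by (auto simp: t_def)
    let ?w = "(1 - t) *\<^sub>R o' + t *\<^sub>R y"
    have "a h' \<bullet> ?w = a h' \<bullet> o' + t * (a h' \<bullet> y - a h' \<bullet> o')" by (simp add: inner_add_right algebra_simps)
    also have "\<dots> = b h'" using yh' o'[OF h(2)] by (simp add: t_def)
    finally have wh': "a h' \<bullet> ?w = b h'" .
    have wk: "a k \<bullet> ?w < b k" if k: "k \<in> G - {h'}" for k
    proof -
      have "(1 - t) * (a k \<bullet> o') + t * (a k \<bullet> y) < (1 - t) * b k + t * b k"
        using t o'[of k] yk[OF k] k by (intro add_less_le_mono mult_strict_left_mono mult_left_mono) auto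
      then show ?thesis by (simp add: inner_add_right algebra_simps)
    qed
    have "?w \<in> P" unfolding mem using wh' wk by force
    then have "?w \<in> ?Q h" using wh' eq by blast
    then show False using wk[of h] h ne by auto
  qed
  define F where "F = {h\<in>G. a h \<bullet> p = b h}"
  have finF: "finite F" using G(1) by (simp add: F_def)
  have pP: "p \<in> P" using p by (simp add: extreme_point_of_def)
  have imF: "?Q ` F = {Q. Q facet_of P \<and> p \<in> Q}" using facets pP by (auto simp: F_def)
  have "inj_on ?Q F" by (rule inj_onI, rule inj) (auto simp: F_def)
  then have "card F = card {Q. Q facet_of P \<and> p \<in> Q}" unfolding imF[symmetric] by (rule card_image[symmetric])
  then have cardF: "card F = CARD('m)" using simple p dim by (simp add: simple_polytope_def)
  have move: "\<exists>t>0. p + t *\<^sub>R v \<in> P" if v: "\<And>h. h \<in> F \<Longrightarrow> a h \<bullet> v \<le> 0" for v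
  proof -
    have "\<forall>h\<in>G. \<forall>\<^sub>F t in at_right 0. a h \<bullet> (p + t *\<^sub>R v) \<le> b h"
    proof
      fix h assume h: "h \<in> G"
      show "\<forall>\<^sub>F t in at_right 0. a h \<bullet> (p + t *\<^sub>R v) \<le> b h"
      proof (cases "h \<in> F")
        case True
        have "\<forall>\<^sub>F t in at_right (0::real). t > 0" by (rule eventually_at_right_less)
        then show ?thesis
        proof eventually_elim
          case (elim t)
          then show ?case using v[OF True] True
            by (simp add: F_def inner_add_right mult_nonneg_nonpos)
        qed
      next
        case False
        then have "a h \<bullet> p < b h" using h pP mem by (force simp: F_def)
        moreover have "((\<lambda>t. a h \<bullet> (p + t *\<^sub>R v)) \<longlongrightarrow> a h \<bullet> (p + 0 *\<^sub>R v)) (at_right 0)"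
          by (intro tendsto_intros)
        ultimately have "\<forall>\<^sub>F t in at_right 0. a h \<bullet> (p + t *\<^sub>R v) < b h"
          by (intro order_tendstoD(2)) auto
        then show ?thesis by eventually_elim simp
      qed
    qed
    then have "\<forall>\<^sub>F t in at_right 0. p + t *\<^sub>R v \<in> P"
      unfolding mem using G(1) by (simp add: eventually_ball_finite)
    moreover have "\<forall>\<^sub>F t in at_right (0::real). t > 0" by (rule eventually_at_right_less)
    ultimately have "\<forall>\<^sub>F t in at_right 0. t > 0 \<and> p + t *\<^sub>R v \<in> P" by eventually_elim simp
    then show ?thesis using eventually_happens by force
  qed
  have nondeg: "v = 0" if v: "\<And>h. h \<in> F \<Longrightarrow> a h \<bullet> v = 0" for v
  proof (rule ccontr)
    assume v0: "v \<noteq> 0"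
    obtain t where t: "t > 0" "p + t *\<^sub>R v \<in> P" using move[of v] v by force
    obtain s where s: "s > 0" "p + s *\<^sub>R (- v) \<in> P" using move[of "- v"] v by force
    let ?u = "t / (t + s)"
    have u: "0 < ?u" "?u < 1" using t s by auto
    have "(1 - ?u) *\<^sub>R (p + t *\<^sub>R v) + ?u *\<^sub>R (p + s *\<^sub>R (- v)) = p + ((1 - ?u) * t - ?u * s) *\<^sub>R v"
      by (simp add: algebra_simps)
    also have "(1 - ?u) * t - ?u * s = 0" using t s by (simp add: field_simps)
    finally have "p = (1 - ?u) *\<^sub>R (p + t *\<^sub>R v) + ?u *\<^sub>R (p + s *\<^sub>R (- v))" by simp
    moreover have "p + t *\<^sub>R v \<noteq> p + s *\<^sub>R (- v)"
    proof
      assume "p + t *\<^sub>R v = p + s *\<^sub>R (- v)"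
      then have "(t + s) *\<^sub>R v = 0" by (simp add: algebra_simps)
      then show False using v0 t s by simp
    qed
    ultimately have "p \<in> open_segment (p + t *\<^sub>R v) (p + s *\<^sub>R (- v))"
      unfolding in_segment(2) using u by blast
    then show False using p t s by (simp add: extreme_point_of_def)
  qed
  have "\<exists>v. (\<forall>h'\<in>F - {h}. a h' \<bullet> v = 0) \<and> a h \<bullet> v < 0" if h: "h \<in> F" for h
  proof -
    have "card (a ` (F - {h})) \<le> card (F - {h})" using finF by (intro card_image_le) simp
    also have "\<dots> < CARD('m)" using cardF h finF by simp
    finally have "dim (a ` (F - {h})) < DIM(real ^ 'm)"
      using dim_le_card'[of "a ` (F - {h})"] finF by simp
    then obtain v where v: "v \<noteq> 0" "span (a ` (F - {h})) \<subseteq> {x. v \<bullet> x = 0}"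
      using lowdim_subset_hyperplane by metis
    have v': "a h' \<bullet> v = 0" if "h' \<in> F - {h}" for h'
      using v(2) that span_base[of "a h'" "a ` (F - {h})"] by (auto simp: inner_commute)
    have "a h \<bullet> v \<noteq> 0" using nondeg[of v] v' v(1) by blast
    then consider "a h \<bullet> v < 0" | "a h \<bullet> (- v) < 0" by fastforce
    then show ?thesis using v' by cases (blast, force intro!: exI[of _ "- v"])
  qed
  then obtain z where z: "\<And>h h'. h \<in> F \<Longrightarrow> h' \<in> F \<Longrightarrow> h' \<noteq> h \<Longrightarrow> a h' \<bullet> z h = 0" "\<And>h. h \<in> F \<Longrightarrow> a h \<bullet> z h < 0"
    by (metis DiffI empty_iff insert_iff)
  have c1: "\<forall>h\<in>F. ?Q h facet_of P" using facets by (auto simp: F_def)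
  have c2: "\<forall>Q. Q facet_of P \<and> p \<in> Q \<longrightarrow> (\<exists>h\<in>F. Q = ?Q h)"
    using facets by (auto simp: F_def)
  have c3: "\<forall>h\<in>F. a h \<bullet> p = b h" by (simp add: F_def)
  have c4: "\<forall>v. (\<forall>h\<in>F. a h \<bullet> v = 0) \<longrightarrow> v = 0" using nondeg by blast
  have c5: "a h \<bullet> z h \<noteq> 0 \<and> (\<forall>h'\<in>F. h' \<noteq> h \<longrightarrow> a h' \<bullet> z h = 0) \<and> (\<exists>t>0. p + t *\<^sub>R z h \<in> P)"
    if h: "h \<in> F" for h
  proof (intro conjI ballI impI)
    show "a h \<bullet> z h \<noteq> 0" using z(2)[OF h] by simp
    show "\<exists>t>0. p + t *\<^sub>R z h \<in> P"
    proof (rule move)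
      fix k assume "k \<in> F"
      then show "a k \<bullet> z h \<le> 0" using z(1)[OF h, of k] z(2)[OF h] by (cases "k = h") auto
    qed
  qed (use z(1)[OF h] in blast)
  have "vertex_inequalities P p F a b z"
    unfolding vertex_inequalities_def by (intro conjI c1 c2 c3 c4) (rule ballI, erule c5)
  then show ?thesis by blast
qed

text \<open>An edge is the intersection of the facets that contain it. If it is not contained in the facet of
  \<open>h\<close>, then all of these facets contain the direction \<open>z h\<close>, which therefore is that of the edge.\<close>

lemma edge_direction_off_one_facet:
  fixes P :: "(real ^ 'm) set"
  assumes P: "polytope P" and dim: "aff_dim P = int CARD('m)" and d: "CARD('m) \<ge> 2"
    and ineq: "vertex_inequalities P p F a b z"
    and e: "e \<in> edge_directions P p"
  shows "\<exists>h\<in>F. a h \<bullet> e \<noteq> 0 \<and> (\<exists>c. e = c *\<^sub>R z h)"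
proof -
  have facets: "\<And>Q. Q facet_of P \<Longrightarrow> p \<in> Q \<Longrightarrow> \<exists>h\<in>F. Q = P \<inter> {x. a h \<bullet> x = b h}"
    and tight: "\<And>h. h \<in> F \<Longrightarrow> a h \<bullet> p = b h"
    and nondeg: "\<And>v. (\<And>h. h \<in> F \<Longrightarrow> a h \<bullet> v = 0) \<Longrightarrow> v = 0"
    and z: "\<And>h. h \<in> F \<Longrightarrow> a h \<bullet> z h \<noteq> 0"
      "\<And>h h'. h \<in> F \<Longrightarrow> h' \<in> F \<Longrightarrow> h' \<noteq> h \<Longrightarrow> a h' \<bullet> z h = 0"
      "\<And>h. h \<in> F \<Longrightarrow> \<exists>t>0. p + t *\<^sub>R z h \<in> P"
    using ineq unfolding vertex_inequalities_def by auto
  obtain E s where E: "E edge_of P" "p \<in> E" "s > 0" "p + s *\<^sub>R e \<in> E" and e0: "e \<noteq> 0"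
    using e by (auto simp: edge_directions_def primitive_vector_def)
  have Eface: "E face_of P" and Edim: "aff_dim E = 1" using E(1) by (auto simp: edge_of_def)
  have ray: "\<exists>c. x = p + c *\<^sub>R e" if x: "x \<in> E" for x
  proof -
    have ne: "p \<noteq> p + s *\<^sub>R e" using E(3) e0 by simp
    have "affine hull {p, p + s *\<^sub>R e} = affine hull E"
    proof (rule affine_dim_equal)
      show "affine hull {p, p + s *\<^sub>R e} \<subseteq> affine hull E" using E by (intro hull_mono) auto
      show "aff_dim (affine hull {p, p + s *\<^sub>R e}) = aff_dim (affine hull E)"
        using Edim aff_dim_2[of p "p + s *\<^sub>R e"] ne by (simp only: aff_dim_affine_hull) simp
    qed auto
    then have "x \<in> affine hull {p, p + s *\<^sub>R e}" using x hull_inc by metis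
    then obtain u v where uv: "u + v = 1" "x = u *\<^sub>R p + v *\<^sub>R (p + s *\<^sub>R e)"
      by (auto simp: affine_hull_2)
    have "x = (u + v) *\<^sub>R p + (v * s) *\<^sub>R e"
      unfolding uv(2) by (simp add: scaleR_add_left scaleR_add_right)
    then show ?thesis using uv(1) by auto
  qed
  have "E \<noteq> P" using Edim dim d by auto
  then have Eint: "E = \<Inter>{Q. Q facet_of P \<and> E \<subseteq> Q}"
    using face_of_polyhedron[OF polytope_imp_polyhedron[OF P] Eface] E(2) by blast
  obtain h where h: "h \<in> F" "a h \<bullet> e \<noteq> 0" using nondeg[of e] e0 by blast
  obtain t where t: "t > 0" "p + t *\<^sub>R z h \<in> P" using z(3)[OF h(1)] by blast
  have "p + t *\<^sub>R z h \<in> Q" if Q: "Q facet_of P" "E \<subseteq> Q" for Q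
  proof -
    obtain k where k: "k \<in> F" "Q = P \<inter> {x. a k \<bullet> x = b k}" using facets[of Q] Q E(2) by blast
    have "a k \<bullet> (p + s *\<^sub>R e) = b k" using k(2) Q(2) E(4) by blast
    then have "a k \<bullet> e = 0" using tight[OF k(1)] E(3) by (simp add: inner_add_right)
    then have "k \<noteq> h" using h by blast
    then show ?thesis using k z(2)[OF h(1) k(1)] tight[OF k(1)] t(2) by (simp add: inner_add_right)
  qed
  then have "p + t *\<^sub>R z h \<in> E" using Eint by blast
  then obtain c where c: "t *\<^sub>R z h = c *\<^sub>R e" using ray by fastforce
  have "c \<noteq> 0"
  proof
    assume "c = 0"
    then have "z h = 0" using c t by simp
    then show False using z(1)[OF h(1)] by simp
  qed
  then have "e = (t / c) *\<^sub>R z h" using c by (metis divideR_right scaleR_scaleR divide_inverse mult.commute)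
  then show ?thesis using h by blast
qed

text \<open>By the preceding lemma every edge direction at a vertex belongs to a facet at this vertex that
  contains all the other directions. The basis of \<open>N\<close> dual to the edge directions consists of
  normals of these facets.\<close>

lemma smooth_polytope_Sed_generate:
  fixes P :: "(real ^ 'm) set"
  assumes P: "smooth_polytope P" and d: "CARD('m) \<ge> 2"
    and 0: "u0 \<in> A" and A: "\<And>Q l u. Q facet_of P \<Longrightarrow> l \<in> Sed Q \<Longrightarrow> u \<in> A \<Longrightarrow> u + l \<in> A"
  shows "A = UNIV"
proof -
  have poly: "polytope P" and dim: "aff_dim P = int CARD('m)" and simple: "simple_polytope P"
    using P by (auto simp: smooth_polytope_def lattice_polytope_def intro: polytope_convex_hull)
  have "P \<noteq> {}" using dim by force
  then obtain p where p: "p extreme_point_of P"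
    using extreme_point_exists_convex[OF polytope_imp_compact[OF poly] polytope_imp_convex[OF poly]] by blast
  let ?B = "edge_directions P p"
  have lb: "lattice_basis ?B" using P p by (simp add: smooth_polytope_def)
  then have indep: "independent ?B" by (simp add: lattice_basis_def)
  then have finB: "finite ?B" using independent_bound by blast
  obtain \<beta> where \<beta>: "\<And>b. \<beta> b \<in> lat" "\<And>x. x = (\<Sum>b\<in>?B. (\<beta> b \<bullet> x) *\<^sub>R b)"
    using lattice_basis_dual[OF lb] by blast
  obtain F :: "(real ^ 'm) set set" and a b z where ineq: "vertex_inequalities P p F a b z"
    using simple_vertex_directions[OF poly dim simple p] by blast
  have facet: "\<And>h. h \<in> F \<Longrightarrow> P \<inter> {x. a h \<bullet> x = b h} facet_of P"
    and z: "\<And>h h'. h \<in> F \<Longrightarrow> h' \<in> F \<Longrightarrow> h' \<noteq> h \<Longrightarrow> a h' \<bullet> z h = 0"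
    using ineq unfolding vertex_inequalities_def by auto
  have "\<exists>Q. Q facet_of P \<and> mod2 (\<beta> e) \<in> Sed Q" if e: "e \<in> ?B" for e
  proof -
    obtain h c where h: "h \<in> F" "a h \<bullet> e \<noteq> 0" "e = c *\<^sub>R z h"
      using edge_direction_off_one_facet[OF poly dim d ineq e] by blast
    have other: "a h \<bullet> e' = 0" if e': "e' \<in> ?B" "e' \<noteq> e" for e'
    proof -
      obtain h' c' where h': "h' \<in> F" "a h' \<bullet> e' \<noteq> 0" "e' = c' *\<^sub>R z h'"
        using edge_direction_off_one_facet[OF poly dim d ineq e'(1)] by blast
      have "h' \<noteq> h"
      proof
        assume eq: "h' = h"
        have "c \<noteq> 0" using h by auto
        then have "e' = (c' / c) *\<^sub>R e" using h(3) h'(3) eq by simp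
        then have "e' \<in> span (?B - {e'})"
          using e e'(2) by (metis DiffI empty_iff insert_iff span_base span_scale)
        then show False using indep e'(1) by (auto simp: dependent_def)
      qed
      then show ?thesis using z[OF h'(1) h(1)] h'(3) by simp
    qed
    have ah: "a h \<bullet> x = (\<beta> e \<bullet> x) * (a h \<bullet> e)" for x
    proof -
      have "a h \<bullet> x = (\<Sum>b\<in>?B. (\<beta> b \<bullet> x) * (a h \<bullet> b))"
        by (subst \<beta>(2)) (simp add: inner_sum_right)
      also have "\<dots> = (\<Sum>b\<in>{e}. (\<beta> b \<bullet> x) * (a h \<bullet> b))"
        by (rule sum.mono_neutral_right) (use finB e other in auto)
      finally show ?thesis by simp
    qed
    have "\<beta> e \<bullet> (x - y) = 0" if "x \<in> P \<inter> {x. a h \<bullet> x = b h}" "y \<in> P \<inter> {x. a h \<bullet> x = b h}" for x y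
    proof -
      have "a h \<bullet> (x - y) = 0" using that by (simp add: inner_diff_right)
      then show ?thesis using ah[of "x - y"] h(2) by simp
    qed
    then have "mod2 (\<beta> e) \<in> Sed (P \<inter> {x. a h \<bullet> x = b h})"
      using \<beta>(1)[of e] unfolding perp2_def by blast
    then show ?thesis using facet[OF h(1)] by blast
  qed
  then have step: "u + mod2 (\<beta> e) \<in> A" if "e \<in> ?B" "u \<in> A" for e u using A that by blast
  have sums: "u0 + (\<Sum>e\<in>C. mod2 (\<beta> e)) \<in> A" if "C \<subseteq> ?B" for C
    using finite_subset[OF that finB] that
  proof (induction C rule: finite_induct)
    case (insert e C)
    have "u0 + (\<Sum>e\<in>insert e C. mod2 (\<beta> e)) = (u0 + (\<Sum>e\<in>C. mod2 (\<beta> e))) + mod2 (\<beta> e)"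
      by (simp add: insert.hyps add_ac)
    moreover have "(u0 + (\<Sum>e\<in>C. mod2 (\<beta> e))) + mod2 (\<beta> e) \<in> A"
      by (rule step) (use insert in auto)
    ultimately show ?case by (simp only:)
  qed (use 0 in simp)
  have "u \<in> A" for u
  proof -
    \<comment> \<open>An integral lift of \<open>u + u0\<close>, to be expanded in the dual basis\<close>
    define w :: "real ^ 'm" where "w = (\<chi> i. of_bool ((u + u0) $ i = 1))"
    have wlat: "w \<in> lat" by (simp add: w_def lat_def)
    have w2: "mod2 w = u + u0"
      unfolding vec_eq_iff
    proof
      fix i show "mod2 w $ i = (u + u0) $ i"
        by (cases "(u + u0) $ i") (simp_all only: w_def mod2_nth vec_lambda_beta, simp_all)
    qed
    have int: "w \<bullet> e \<in> \<int>" if "e \<in> ?B" for e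
      using that wlat lat_inner by (auto simp: edge_directions_def primitive_vector_def)
    have "w = (\<Sum>e\<in>?B. (w \<bullet> e) *\<^sub>R \<beta> e)"
    proof -
      have "w \<bullet> x = (\<Sum>e\<in>?B. (w \<bullet> e) *\<^sub>R \<beta> e) \<bullet> x" for x
      proof -
        have "w \<bullet> x = w \<bullet> (\<Sum>b\<in>?B. (\<beta> b \<bullet> x) *\<^sub>R b)" by (rule arg_cong[OF \<beta>(2)])
        then show ?thesis by (simp add: inner_sum_right inner_sum_left mult.commute)
      qed
      then show ?thesis using vector_eq_rdot by blast
    qed
    then have "mod2 w = mod2 (\<Sum>e\<in>?B. (w \<bullet> e) *\<^sub>R \<beta> e)" by simp
    also have "\<dots> = (\<Sum>e\<in>?B. bit_of (w \<bullet> e) *s mod2 (\<beta> e))"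
      unfolding vec_eq_iff
    proof
      fix i
      have "bit_of (\<Sum>e\<in>?B. (w \<bullet> e) * \<beta> e $ i) = (\<Sum>e\<in>?B. bit_of ((w \<bullet> e) * \<beta> e $ i))"
        using int \<beta>(1) by (intro bit_of_sum Ints_mult) (auto simp: lat_def)
      also have "\<dots> = (\<Sum>e\<in>?B. bit_of (w \<bullet> e) * bit_of (\<beta> e $ i))"
        using int \<beta>(1) by (intro sum.cong refl bit_of_mult) (auto simp: lat_def)
      finally show "mod2 (\<Sum>e\<in>?B. (w \<bullet> e) *\<^sub>R \<beta> e) $ i = (\<Sum>e\<in>?B. bit_of (w \<bullet> e) *s mod2 (\<beta> e)) $ i"
        by (simp only: mod2_nth sum_component vector_scaleR_component real_scaleR_def vector_smult_component)
    qed
    also have "\<dots> = (\<Sum>e\<in>{e\<in>?B. bit_of (w \<bullet> e) = 1}. mod2 (\<beta> e))"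
      by (rule sum.mono_neutral_cong_right) (use finB in auto)
    finally have "u0 + (u + u0) \<in> A" using sums[of "{e\<in>?B. bit_of (w \<bullet> e) = 1}"] w2 by simp
    moreover have "u0 + (u + u0) = u" by (simp add: add.left_commute[of u0 u])
    ultimately show ?thesis by simp
  qed
  then show ?thesis by blast
qed

section \<open>Top-degree forms and the tropical Hodge number \<open>h\<^sup>n\<^sup>,\<^sup>0\<close>\<close>

lemma F2_subspace_iff:
  "F2_subspace U \<longleftrightarrow> 0 \<in> U \<and> (\<forall>x\<in>U. \<forall>y\<in>U. x + y \<in> U)" for U :: "('b \<Rightarrow> bit) set"
proof -
  have "(\<lambda>x. c * f x) \<in> U" if "0 \<in> U" "f \<in> U" for c f
    using that by (cases c) (simp_all add: zero_fun_def)
  then show ?thesis unfolding F2.subspace_def by blast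
qed

lemma F2_add_self: "(f :: 'b \<Rightarrow> bit) + f = 0"
  by (simp add: fun_eq_iff)

lemma sum_fun_apply: "(\<Sum>i\<in>A. f i) x = (\<Sum>i\<in>A. (f i x :: 'a::comm_monoid_add))"
  by (induction A rule: infinite_finite_induct) simp_all

lemma complement_basis_exists:
  fixes U W :: "('b \<Rightarrow> bit) set"
  assumes W: "F2_subspace W" and U: "F2_subspace U" and WU: "W \<subseteq> U" and fin: "finite U"
  shows "\<exists>B. complement_basis U W B"
proof -
  obtain B0 where B0: "B0 \<subseteq> W" "\<not> F2_dependent B0" "W \<subseteq> F2_span B0"
    using F2.maximal_independent_subset[of W] by blast
  have spB0: "F2_span B0 = W"
    using B0(3) F2.span_minimal[OF B0(1) W] by blast
  have "B0 \<subseteq> U" using B0(1) WU by (rule subset_trans)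
  then obtain B1 where B1: "B0 \<subseteq> B1" "B1 \<subseteq> U" "\<not> F2_dependent B1" "U \<subseteq> F2_span B1"
    using F2.maximal_independent_subset_extend[OF _ B0(2)] by blast
  have spB1: "F2_span B1 = U"
    using B1(4) F2.span_minimal[OF B1(2) U] by blast
  let ?B = "B1 - B0"
  have ind: "\<not> F2_dependent ?B" using B1(3) F2.dependent_mono[of ?B B1] by blast
  have "F2_span ?B \<inter> W = {0}"
  proof
    show "F2_span ?B \<inter> W \<subseteq> {0}"
    proof
      fix x assume x: "x \<in> F2_span ?B \<inter> W"
      have x1: "x \<in> F2_span B1" using x F2.span_mono[of ?B B1] by blast
      have "F2.representation B1 x = F2.representation ?B x"
        by (rule F2.representation_extend[OF B1(3)]) (use x in auto)
      moreover have "F2.representation B1 x = F2.representation B0 x"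
        by (rule F2.representation_extend[OF B1(3)]) (use x spB0 B1(1) in auto)
      ultimately have "F2.representation B1 x b = 0" for b
        using F2.representation_ne_zero[of ?B x b] F2.representation_ne_zero[of B0 x b] by (metis DiffE)
      then have "x = 0"
        using F2.sum_nonzero_representation_eq[OF B1(3) x1] by simp
      then show "x \<in> {0}" by simp
    qed
  qed (use F2.span_zero F2.subspace_0[OF W] in simp)
  moreover have "{b + w |b w. b \<in> F2_span ?B \<and> w \<in> W} = U"
  proof -
    have "F2_span (?B \<union> B0) = {x + y |x y. x \<in> F2_span ?B \<and> y \<in> F2_span B0}"
      by (rule F2.span_Un)
    moreover have "?B \<union> B0 = B1" using B1(1) by blast
    ultimately show ?thesis using spB0 spB1 by simp
  qed
  moreover have "finite ?B" using finite_subset[OF B1(2) fin] by simp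
  ultimately show ?thesis using ind unfolding complement_basis_def by blast
qed

text \<open>Distinct functionals on \<open>U / W\<close> have distinct restrictions to a basis of the quotient.\<close>

lemma card_functionals_le:
  fixes \<Phi> :: "'w \<Rightarrow> ('b \<Rightarrow> bit) \<Rightarrow> bit"
  assumes W: "F2_subspace W" and U: "F2_subspace U" and WU: "W \<subseteq> U" and fin: "finite U"
    and add: "\<And>w c c'. \<Phi> w (c + c') = \<Phi> w c + \<Phi> w c'"
    and kill: "\<And>w c. w \<in> A \<Longrightarrow> c \<in> W \<Longrightarrow> \<Phi> w c = 0"
    and sep: "\<And>w w'. \<lbrakk>w \<in> A; w' \<in> A; \<And>c. c \<in> U \<Longrightarrow> \<Phi> w c = \<Phi> w' c\<rbrakk> \<Longrightarrow> w = w'"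
  shows "finite A \<and> card A \<le> 2 ^ quot_dim U W"
proof -
  obtain B where B: "complement_basis U W B" using complement_basis_exists[OF W U WU fin] by blast
  have finB: "finite B" using B by (simp add: complement_basis_def)
  have "inj_on (\<lambda>w. restrict (\<Phi> w) B) A"
  proof (rule inj_onI)
    fix w w' assume w: "w \<in> A" "w' \<in> A" and eq: "restrict (\<Phi> w) B = restrict (\<Phi> w') B"
    have eqB: "\<Phi> w b = \<Phi> w' b" if "b \<in> B" for b using fun_cong[OF eq, of b] that by simp
    have "F2_subspace {c. \<Phi> w c = \<Phi> w' c}"
      unfolding F2_subspace_iff
    proof (intro conjI ballI CollectI)
      show "\<Phi> w 0 = \<Phi> w' 0" using add[of w 0 0] add[of w' 0 0] by simp
    qed (simp add: add)
    then have span: "F2_span B \<subseteq> {c. \<Phi> w c = \<Phi> w' c}"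
      using eqB by (intro F2.span_minimal) auto
    show "w = w'"
    proof (rule sep[OF w])
      fix c assume "c \<in> U"
      then obtain b v where "b \<in> F2_span B" "v \<in> W" "c = b + v"
        using B unfolding complement_basis_def by blast
      then show "\<Phi> w c = \<Phi> w' c" using span kill w by (auto simp: add)
    qed
  qed
  moreover have "(\<lambda>w. restrict (\<Phi> w) B) ` A \<subseteq> B \<rightarrow>\<^sub>E (UNIV :: bit set)" by auto
  moreover have "finite (B \<rightarrow>\<^sub>E (UNIV :: bit set))" using finB by (intro finite_PiE) simp_all
  ultimately have "finite A \<and> card A \<le> card (B \<rightarrow>\<^sub>E (UNIV :: bit set))"
    by (metis card_inj_on_le inj_on_finite)
  moreover have "card (UNIV :: bit set) = 2" unfolding UNIV_bit by simp
  ultimately show ?thesis using finB quot_dim_eq[OF W B] by (simp add: card_PiE)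
qed

lemma wedge_add_right: "wedge x (y + z) = wedge x y + wedge x z"
  by (simp add: wedge_def fun_eq_iff algebra_simps sum.distrib)

lemma wedge_zero_right [simp]: "wedge x 0 = 0"
  by (simp add: wedge_def fun_eq_iff)

lemma wedge_add_left: "wedge (x + y) z = wedge x z + wedge y z"
  by (simp add: wedge_def fun_eq_iff algebra_simps sum.distrib)

lemma wedge_zero_left [simp]: "wedge 0 z = 0"
  by (simp add: wedge_def fun_eq_iff)

lemma ext_vec_add: "ext_vec (a + b) = ext_vec a + ext_vec b"
  by (simp add: ext_vec_def fun_eq_iff algebra_simps sum.distrib)

lemma ext_vec_zero [simp]: "ext_vec 0 = 0"
  by (simp add: ext_vec_def fun_eq_iff)

lemma ext_vec_sum: "ext_vec (\<Sum>i\<in>I. f i) = (\<Sum>i\<in>I. ext_vec (f i))"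
  by (induction I rule: infinite_finite_induct) (simp_all add: ext_vec_add)

lemma wedge_sum_left: "wedge (\<Sum>i\<in>I. f i) z = (\<Sum>i\<in>I. wedge (f i) z)"
  by (induction I rule: infinite_finite_induct)
    (simp_all only: sum.infinite sum.empty sum.insert not_False_eq_True wedge_zero_left wedge_add_left)

lemma wedge_ext_vec:
  fixes S :: "'m::finite set"
  shows "wedge (ext_vec v) y S = (\<Sum>i\<in>S. v $ i * y (S - {i}))"
proof -
  have "wedge (ext_vec v) y S = (\<Sum>T\<in>Pow S. \<Sum>i\<in>UNIV. of_bool (T = {i}) * v $ i * y (S - T))"
    by (simp only: wedge_def ext_vec_def sum_distrib_right)
  also have "\<dots> = (\<Sum>i\<in>UNIV. \<Sum>T\<in>Pow S. of_bool (T = {i}) * v $ i * y (S - T))" by (rule sum.swap)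
  also have "\<dots> = (\<Sum>i\<in>UNIV. if i \<in> S then v $ i * y (S - {i}) else 0)"
  proof (rule sum.cong[OF refl])
    fix i
    have "(\<Sum>T\<in>Pow S. of_bool (T = {i}) * v $ i * y (S - T))
        = (\<Sum>T\<in>Pow S. if T = {i} then v $ i * y (S - {i}) else 0)"
      by (rule sum.cong) auto
    also have "\<dots> = (if {i} \<in> Pow S then v $ i * y (S - {i}) else 0)"
      by (rule sum.delta) simp
    finally show "(\<Sum>T\<in>Pow S. of_bool (T = {i}) * v $ i * y (S - T)) = (if i \<in> S then v $ i * y (S - {i}) else 0)"
      by simp
  qed
  also have "\<dots> = (\<Sum>i\<in>S. v $ i * y (S - {i}))" by (simp add: sum.If_cases)
  finally show ?thesis .
qed

lemma wedge_list_Cons: "wedge_list (v # vs) = wedge (ext_vec v) (wedge_list vs)"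
  by (simp add: wedge_list_def)

lemma wedge_ext_vec_swap:
  fixes y :: "'m::finite ext"
  shows "wedge (ext_vec v) (wedge (ext_vec w) y) = wedge (ext_vec w) (wedge (ext_vec v) y)"
proof
  fix S :: "'m set"
  have e: "wedge (ext_vec v) (wedge (ext_vec w) y) S
      = (\<Sum>i\<in>S. \<Sum>j\<in>S. if i = j then 0 else v $ i * w $ j * y (S - {i, j}))" for v w
    unfolding wedge_ext_vec sum_distrib_left
  proof (rule sum.cong[OF refl])
    fix i assume i: "i \<in> S"
    have "(\<Sum>j\<in>S - {i}. v $ i * (w $ j * y (S - {i} - {j})))
        = (\<Sum>j\<in>S - {i}. if i = j then 0 else v $ i * w $ j * y (S - {i, j}))"
      by (rule sum.cong) (auto simp: mult.assoc Diff_insert2[symmetric] insert_commute)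
    also have "\<dots> = (\<Sum>j\<in>S. if i = j then 0 else v $ i * w $ j * y (S - {i, j}))"
      by (rule sum.mono_neutral_left) auto
    finally show "(\<Sum>j\<in>S - {i}. v $ i * (w $ j * y (S - {i} - {j})))
        = (\<Sum>j\<in>S. if i = j then 0 else v $ i * w $ j * y (S - {i, j}))" .
  qed
  show "wedge (ext_vec v) (wedge (ext_vec w) y) S = wedge (ext_vec w) (wedge (ext_vec v) y) S"
    unfolding e by (subst sum.swap) (intro sum.cong refl, auto simp: insert_commute mult.commute)
qed

text \<open>In characteristic two the square of a vector vanishes because the terms of a pair and of the
  swapped pair of indices cancel.\<close>

lemma wedge_ext_vec_square:
  fixes y :: "'m::finite ext"
  shows "wedge (ext_vec v) (wedge (ext_vec v) y) = 0"
proof -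
  have "wedge (ext_vec (\<Sum>i\<in>I. a i)) (wedge (ext_vec (\<Sum>i\<in>I. a i)) y) = 0"
    if "\<And>i. i \<in> I \<Longrightarrow> wedge (ext_vec (a i)) (wedge (ext_vec (a i)) y) = 0" "finite I"
    for I :: "'m set" and a :: "'m \<Rightarrow> bit ^ 'm"
    using that(2,1)
  proof (induction I rule: finite_induct)
    case (insert i I)
    have expand: "wedge (ext_vec (a i + s)) (wedge (ext_vec (a i + s)) y)
       = wedge (ext_vec (a i)) (wedge (ext_vec (a i)) y) + wedge (ext_vec s) (wedge (ext_vec s) y)
         + (wedge (ext_vec (a i)) (wedge (ext_vec s) y) + wedge (ext_vec s) (wedge (ext_vec (a i)) y))" for s
      by (simp add: ext_vec_add wedge_add_left wedge_add_right add_ac)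
    let ?s = "\<Sum>i\<in>I. a i"
    have "wedge (ext_vec (a i)) (wedge (ext_vec (a i)) y) = 0" using insert.prems by blast
    moreover have "wedge (ext_vec ?s) (wedge (ext_vec ?s) y) = 0" using insert by blast
    ultimately show ?case
      by (simp only: sum.insert[OF insert.hyps(1,2)] expand wedge_ext_vec_swap[of ?s "a i"] F2_add_self add_0)
  qed simp
  moreover have "wedge (ext_vec (c *s axis i 1)) (wedge (ext_vec (c *s axis i 1)) y) = 0" for c i
  proof (rule ext)
    fix S :: "'m set"
    show "wedge (ext_vec (c *s axis i 1)) (wedge (ext_vec (c *s axis i 1)) y) S = 0 S"
      by (auto simp: wedge_ext_vec axis_def intro!: sum.neutral)
  qed
  ultimately have "wedge (ext_vec (\<Sum>i\<in>UNIV. v $ i *s axis i 1)) (wedge (ext_vec (\<Sum>i\<in>UNIV. v $ i *s axis i 1)) y) = 0"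
    by simp
  then show ?thesis by (simp only: basis_expansion)
qed

lemma wedge_list_mem: "v \<in> set vs \<Longrightarrow> wedge (ext_vec v) (wedge_list vs) = 0"
proof (induction vs)
  case (Cons w ws)
  show ?case
  proof (cases "v = w")
    case True
    then show ?thesis by (simp add: wedge_list_Cons wedge_ext_vec_square)
  next
    case False
    then have "wedge (ext_vec v) (wedge_list ws) = 0" using Cons by auto
    then show ?thesis by (simp only: wedge_list_Cons wedge_ext_vec_swap[of v w] wedge_zero_right)
  qed
qed simp

lemma wedge_list_not_distinct: "\<not> distinct vs \<Longrightarrow> wedge_list vs = 0"
  by (induction vs) (auto simp: wedge_list_Cons wedge_list_mem)

lemma wedge_list_zero: "0 \<in> set vs \<Longrightarrow> wedge_list vs = 0"
  by (induction vs) (auto simp: wedge_list_Cons)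

lemma wedge_list_axes:
  "distinct xs \<Longrightarrow> wedge_list (map (\<lambda>i. axis i 1) xs) = (\<lambda>S. of_bool (S = set xs))"
proof (induction xs)
  case (Cons i xs)
  show ?case
  proof
    fix S
    have "wedge_list (map (\<lambda>i. axis i 1) (i # xs)) S = (\<Sum>j\<in>S. axis i 1 $ j * of_bool (S - {j} = set xs))"
      using Cons by (simp add: wedge_list_Cons wedge_ext_vec)
    also have "\<dots> = (\<Sum>j\<in>S. if j = i then of_bool (S - {i} = set xs) else 0)"
      by (rule sum.cong) (auto simp: axis_def)
    also have "\<dots> = (if i \<in> S then of_bool (S - {i} = set xs) else 0)"
      by (rule sum.delta) simp
    also have "\<dots> = of_bool (S = set (i # xs))"
    proof -
      have "(i \<in> S \<and> S - {i} = set xs) \<longleftrightarrow> S = set (i # xs)"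
        using Cons.prems by auto
      then show ?thesis by (auto simp: of_bool_def)
    qed
    finally show "wedge_list (map (\<lambda>i. axis i 1) (i # xs)) S = of_bool (S = set (i # xs))" .
  qed
qed (simp add: wedge_list_def)

text \<open>Multilinear expansion of a wedge product whose factors are combinations of the vectors \<open>h x\<close>.\<close>

lemma wedge_list_in_span:
  assumes G: "finite G" and vs: "\<And>v. v \<in> set vs \<Longrightarrow> \<exists>c. v = (\<Sum>x\<in>G. c x *s h x)"
  shows "wedge_list vs \<in> F2_span {wedge_list (map h gs) | gs. length gs = length vs \<and> set gs \<subseteq> G}"
  using vs
proof (induction vs)
  case Nil
  then show ?case by (intro F2.span_base) force
next
  case (Cons v vs)
  let ?N = "{wedge_list (map h gs) | gs. length gs = length vs \<and> set gs \<subseteq> G}"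
  let ?M = "{wedge_list (map h gs) | gs. length gs = length (v # vs) \<and> set gs \<subseteq> G}"
  obtain c where c: "v = (\<Sum>x\<in>G. c x *s h x)" using Cons.prems by auto
  have "F2_subspace {y. wedge (ext_vec v) y \<in> F2_span ?M}"
    unfolding F2_subspace_iff by (auto simp: wedge_add_right F2.span_add F2.span_zero)
  moreover have "wedge (ext_vec v) (wedge_list (map h gs)) \<in> F2_span ?M"
    if gs: "length gs = length vs" "set gs \<subseteq> G" for gs
  proof -
    have "wedge (ext_vec (c x *s h x)) (wedge_list (map h gs)) \<in> F2_span ?M" if "x \<in> G" for x
    proof (cases "c x = 0")
      case one: False
      have "wedge_list (map h (x # gs)) \<in> ?M" using gs that by (intro CollectI exI[of _ "x # gs"]) simp
      then show ?thesis using one by (simp add: wedge_list_Cons F2.span_base)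
    next
      case zero: True
      show ?thesis unfolding zero by (simp add: F2.span_zero)
    qed
    then show ?thesis unfolding c ext_vec_sum wedge_sum_left by (rule F2.span_sum)
  qed
  ultimately have "F2_span ?N \<subseteq> {y. wedge (ext_vec v) y \<in> F2_span ?M}"
    by (intro F2.span_minimal) auto
  then show ?case using Cons by (auto simp: wedge_list_Cons)
qed

text \<open>The elements of \<open>\<And>\<^sup>n (\<sigma>\<^sup>1)\<^sup>\<bottom>\<close>, wedged with \<open>w\<close>, vanish exactly if \<open>w\<close> is orthogonal to the edge. So
  these are the functionals on the chains over maximal simplices that vanish on the boundaries of
  chains over ridges.\<close>

definition balanced_weights :: "(real ^ 'm) set set \<Rightarrow> ((real ^ 'm) set \<Rightarrow> bit ^ 'm) set" where
  "balanced_weights K = {w. (\<forall>T. T \<notin> tops K \<longrightarrow> w T = 0) \<and>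
     (\<forall>S\<in>ridges K. \<forall>x\<in>S. \<forall>y\<in>S. pair2 (mod2 (x - y)) (\<Sum>T\<in>{T\<in>tops K. S \<subseteq> T}. w T) = 0)}"

text \<open>The coefficient of \<open>w \<and> y\<close> in the one-dimensional top exterior power.\<close>

definition top_pairing :: "bit ^ 'm \<Rightarrow> 'm::finite ext \<Rightarrow> bit" where
  "top_pairing w y = wedge (ext_vec w) y UNIV"

lemma top_pairing_add_right: "top_pairing w (y + z) = top_pairing w y + top_pairing w z"
  and top_pairing_zero_right [simp]: "top_pairing w 0 = 0"
  and top_pairing_add_left: "top_pairing (v + w) y = top_pairing v y + top_pairing w y"
  and top_pairing_zero_left [simp]: "top_pairing 0 y = 0"
  by (simp_all add: top_pairing_def wedge_add_right ext_vec_add wedge_add_left)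

lemma top_pairing_sum_left: "top_pairing (\<Sum>i\<in>I. w i) y = (\<Sum>i\<in>I. top_pairing (w i) y)"
  by (induction I rule: infinite_finite_induct) (simp_all add: top_pairing_add_left)

lemma top_pairing_sum_right: "top_pairing w (\<Sum>i\<in>I. y i) = (\<Sum>i\<in>I. top_pairing w (y i))"
  by (induction I rule: infinite_finite_induct)
    (simp_all only: sum.infinite sum.empty sum.insert not_False_eq_True top_pairing_zero_right top_pairing_add_right)

lemma top_pairing_span_zero:
  assumes "y \<in> F2_span G" "\<And>g. g \<in> G \<Longrightarrow> top_pairing w g = 0"
  shows "top_pairing w y = 0"
proof -
  have "F2_subspace {y. top_pairing w y = 0}"
    unfolding F2_subspace_iff by (simp add: top_pairing_add_right)
  then have "F2_span G \<subseteq> {y. top_pairing w y = 0}" using assms(2) by (intro F2.span_minimal) auto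
  then show ?thesis using assms(1) by blast
qed

lemma perp2_antimono: "S \<subseteq> T \<Longrightarrow> perp2 T \<subseteq> perp2 S"
  unfolding perp2_def by (intro image_mono) blast

lemma perp2_pair2:
  assumes "u \<in> perp2 S" "x \<in> S" "y \<in> S" "x \<in> lat" "y \<in> lat"
  shows "pair2 (mod2 (x - y)) u = 0"
proof -
  obtain v where v: "v \<in> lat" "u = mod2 v" "v \<bullet> (x - y) = 0" using assms by (auto simp: perp2_def)
  then show ?thesis using assms(4,5) by (simp add: pair2_mod2 lat_diff inner_commute)
qed

lemma ext_kernel_mono: "V \<subseteq> W \<Longrightarrow> ext_kernel p V \<subseteq> ext_kernel p W"
  unfolding ext_kernel_def by (intro F2.span_mono) blast

lemma cosheaf_zero_subset: "cosheaf_zero p a \<subseteq> cosheaf K p a"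
  by (cases a) (auto simp: cosheaf_zero_def cosheaf_def intro: F2.span_base)

lemma cosheaf_mono:
  assumes "cell_le a' a"
  shows "cosheaf K p a \<subseteq> cosheaf K p a'"
proof -
  obtain \<sigma> Q \<sigma>' Q' where a: "a = (\<sigma>, Q)" "a' = (\<sigma>', Q')" by (metis surj_pair)
  then have "\<sigma> \<subseteq> \<sigma>'" "Q' \<subseteq> Q" using assms by (auto simp: cell_le_def)
  then show ?thesis
    unfolding a cosheaf_def prod.case
    using ext_kernel_mono[OF perp2_antimono, of Q' Q p] by (intro F2.span_mono) blast
qed

lemma F2_subspace_cosheaf: "F2_subspace (cosheaf K p a)" "F2_subspace (cosheaf_zero p a)"
  by (cases a, simp add: cosheaf_def cosheaf_zero_def ext_kernel_def F2.subspace_span)+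

lemma F2_subspace_cell_chains:
  assumes "\<And>a. F2_subspace (G a)"
  shows "F2_subspace (cell_chains C G)"
  unfolding F2_subspace_iff cell_chains_def
  using assms by (auto simp: F2_subspace_iff plus_fun_def zero_fun_def)

context primitively_triangulated begin

lemma finite_X_cells: "finite (X_cells P K q)"
proof (rule finite_subset)
  show "X_cells P K q \<subseteq> K \<times> {Q. Q face_of P}" by (auto simp: X_cells_def)
  show "finite (K \<times> {Q. Q face_of P})" using finite_K finite_polytope_faces[OF polytope_P] by simp
qed

lemma finite_cell_chains:
  fixes C :: "'m cell set"
  assumes "finite C"
  shows "finite (cell_chains C G)"
proof (rule finite_subset)
  show "cell_chains C G \<subseteq> {c. \<forall>x. (x \<in> C \<times> UNIV \<longrightarrow> c x \<in> {0, 1}) \<and> (x \<notin> C \<times> UNIV \<longrightarrow> c x = 0)}"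
    by (auto simp: cell_chains_def)
  show "finite {c::'m cchain. \<forall>x. (x \<in> C \<times> UNIV \<longrightarrow> c x \<in> {0, 1}) \<and> (x \<notin> C \<times> UNIV \<longrightarrow> c x = 0)}"
    using assms by (intro finite_set_of_finite_funs) auto
qed

lemma Sed_P: "Sed P = {0}"
proof -
  have "u = 0" if u: "\<forall>x\<in>P. \<forall>y\<in>P. u \<bullet> (x - y) = 0" for u
  proof -
    obtain p where p: "p \<in> P" using interior_P interior_subset[of P] by auto
    have "P \<subseteq> {x. u \<bullet> x = u \<bullet> p}" 
    proof
      fix x assume "x \<in> P"
      then have "u \<bullet> (x - p) = 0" using u p by blast
      then show "x \<in> {x. u \<bullet> x = u \<bullet> p}" by (simp add: inner_diff_right)
    qed
    then have "aff_dim P \<le> aff_dim {x. u \<bullet> x = u \<bullet> p}" by (rule aff_dim_subset)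
    then show "u = 0" using dim_P aff_dim_hyperplane[of u "u \<bullet> p"] by (cases "u = 0") auto
  qed
  moreover have "mod2 0 = 0" by (simp add: vec_eq_iff mod2_nth)
  ultimately show ?thesis using lat_zero by (auto simp: perp2_def image_iff intro!: bexI[of _ 0])
qed

lemma ext_kernel_Sed_P: "ext_kernel p (Sed P) = {0}"
proof -
  have "{wedge_list vs |vs. length vs = p \<and> set vs \<inter> Sed P \<noteq> {}} \<subseteq> {0}"
    by (auto simp: Sed_P wedge_list_zero)
  then have "ext_kernel p (Sed P) \<subseteq> {0}"
    unfolding ext_kernel_def by (rule F2.span_minimal) (simp add: F2_subspace_iff)
  moreover have "0 \<in> ext_kernel p (Sed P)" unfolding ext_kernel_def by (rule F2.span_zero)
  ultimately show ?thesis by blast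
qed

text \<open>The vectors of the list and \<open>w\<close> lie in a hyperplane spanned by \<open>n\<close> members of the dual
  frame, too few for a nonzero wedge product of length \<open>n + 1\<close>.\<close>

lemma top_pairing_edge_zero:
  assumes T: "T \<in> tops K" and xy: "x \<in> T" "y \<in> T" "x \<noteq> y"
    and w: "pair2 (mod2 (x - y)) w = 0" and vs: "\<And>v. v \<in> set vs \<Longrightarrow> pair2 (mod2 (x - y)) v = 0"
    and len: "Suc (length vs) = CARD('m)"
  shows "top_pairing w (wedge_list vs) = 0"
proof -
  let ?G = "T - {y} - {x}" and ?h = "\<lambda>v. mod2 (frame T v)"
  have "\<exists>c. v = (\<Sum>z\<in>?G. c z *s ?h z)" if v: "pair2 (mod2 (x - y)) v = 0" for v
  proof -
    have "v = (\<Sum>z\<in>T - {y}. pair2 (mod2 (z - y)) v *s ?h z)"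
      by (rule dual_frame_expand2[OF tops_frame[OF T] tops_finite[OF T] tops_card[OF T] xy(2) tops_lat[OF T]])
    also have "\<dots> = (\<Sum>z\<in>?G. pair2 (mod2 (z - y)) v *s ?h z)"
      by (rule sum.mono_neutral_right) (use tops_finite[OF T] v in auto)
    finally show ?thesis by (rule exI[of _ "\<lambda>z. pair2 (mod2 (z - y)) v"])
  qed
  then have "wedge_list (w # vs) \<in> F2_span {wedge_list (map ?h gs) | gs. length gs = length (w # vs) \<and> set gs \<subseteq> ?G}"
    using w vs tops_finite[OF T] by (intro wedge_list_in_span) auto
  moreover have "{wedge_list (map ?h gs) | gs. length gs = length (w # vs) \<and> set gs \<subseteq> ?G} \<subseteq> {0}"
  proof
    fix z assume "z \<in> {wedge_list (map ?h gs) | gs. length gs = length (w # vs) \<and> set gs \<subseteq> ?G}"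
    then obtain gs where gs: "z = wedge_list (map ?h gs)" "length gs = length (w # vs)" "set gs \<subseteq> ?G" by blast
    have "card ?G < CARD('m)" using tops_card[OF T] tops_finite[OF T] xy by simp
    then have "\<not> distinct gs"
      using gs(2,3) len distinct_card[of gs] card_mono[of ?G "set gs"] tops_finite[OF T] by auto
    then have "\<not> distinct (map ?h gs)" by (auto simp: distinct_map)
    then show "z \<in> {0}" using gs(1) wedge_list_not_distinct by auto
  qed
  then have "F2_span {wedge_list (map ?h gs) | gs. length gs = length (w # vs) \<and> set gs \<subseteq> ?G} \<subseteq> {0}"
    by (rule F2.span_minimal) (simp add: F2_subspace_iff)
  ultimately have "wedge_list (w # vs) = 0" by blast
  then show ?thesis by (simp add: top_pairing_def wedge_list_Cons)
qed

lemma top_pairing_ridge_zero: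
  assumes n: "CARD('m) = n + 1" and S: "S \<in> ridges K" and c: "c \<in> cosheaf K n (convex hull S, P)"
    and w: "\<And>x y. x \<in> S \<Longrightarrow> y \<in> S \<Longrightarrow> pair2 (mod2 (x - y)) w = 0"
  shows "top_pairing w c = 0"
proof -
  obtain T where T: "T \<in> tops K" "S \<subseteq> T" using S by (auto simp: ridges_def)
  have "c \<in> F2_span ({0} \<union> (\<Union>\<sigma>1\<in>{\<sigma>1\<in>K. aff_dim \<sigma>1 = 1 \<and> \<sigma>1 \<subseteq> convex hull S}. ext_power n (perp2 \<sigma>1)))"
    using c by (simp add: cosheaf_def ext_kernel_Sed_P)
  then show ?thesis
  proof (rule top_pairing_span_zero)
    fix g assume "g \<in> {0} \<union> (\<Union>\<sigma>1\<in>{\<sigma>1\<in>K. aff_dim \<sigma>1 = 1 \<and> \<sigma>1 \<subseteq> convex hull S}. ext_power n (perp2 \<sigma>1))"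
    then consider "g = 0" | \<sigma> where "\<sigma> \<in> K" "aff_dim \<sigma> = 1" "\<sigma> \<subseteq> convex hull S" "g \<in> ext_power n (perp2 \<sigma>)"
      by blast
    then show "top_pairing w g = 0"
    proof cases
      case 2
      have "\<sigma> face_of convex hull S"
        using K_Int[OF ridgeD(5)[OF S] 2(1)] 2(3) by (simp add: inf_absorb2)
      then obtain C where C: "C \<subseteq> S" "\<sigma> = convex hull C"
        using face_of_convex_hull_affine_independent[OF face_tops_indep[OF T(2,1)]] by blast
      have "verts \<sigma> = C" using verts_face_tops[of C T] C T by auto
      then have "card C = 2" using K_verts(4)[OF 2(1)] 2(2) by simp
      then obtain x y where xy: "C = {x, y}" "x \<noteq> y" by (auto simp: card_2_iff)
      have inS: "x \<in> S" "y \<in> S" using C xy by auto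
      have inT: "x \<in> T" "y \<in> T" using inS T by auto
      have in\<sigma>: "x \<in> \<sigma>" "y \<in> \<sigma>" using C(2) xy by (auto intro: hull_inc)
      show ?thesis
        using 2(4) unfolding ext_power_def
      proof (rule top_pairing_span_zero)
        fix z assume "z \<in> {wedge_list vs |vs. length vs = n \<and> set vs \<subseteq> perp2 \<sigma>}"
        then obtain vs where vs: "z = wedge_list vs" "length vs = n" "set vs \<subseteq> perp2 \<sigma>" by blast
        have "pair2 (mod2 (x - y)) v = 0" if "v \<in> set vs" for v
          using perp2_pair2[of v \<sigma> x y] that vs(3) in\<sigma> inT tops_lat[OF T(1)] by blast
        then show "top_pairing w z = 0"
          using top_pairing_edge_zero[OF T(1) inT xy(2) w[OF inS]] vs n by simp
      qed
    qed simp
  qed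
qed

text \<open>Expanding the coordinate vectors in the dual frame of a maximal simplex \<open>T\<close>: a product of
  \<open>n\<close> of the \<open>n + 1\<close> frame vectors with index other than \<open>v0\<close> misses some \<open>v\<close>, and then all
  factors are orthogonal to the edge from \<open>v0\<close> to \<open>v\<close>.\<close>

lemma coordinate_form_in_cosheaf:
  assumes n: "CARD('m) = n + 1" and T: "T \<in> tops K"
  shows "(\<lambda>S. of_bool (S = UNIV - {i})) \<in> cosheaf K n (convex hull T, P)"
proof -
  obtain xs where xs: "set xs = UNIV - {i}" "distinct xs" using finite_distinct_list[of "UNIV - {i}"] by auto
  have len: "length xs = n" using distinct_card[OF xs(2)] xs(1) n by simp
  obtain v0 where v0: "v0 \<in> T" using tops_card[OF T] by fastforce
  let ?h = "\<lambda>v. mod2 (frame T v)" and ?G = "T - {v0}"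
  have "wedge_list (map (\<lambda>i. axis i 1) xs) \<in>
      F2_span {wedge_list (map ?h gs) | gs. length gs = length (map (\<lambda>i. axis i 1 :: bit ^ 'm) xs) \<and> set gs \<subseteq> ?G}"
  proof (rule wedge_list_in_span)
    show "\<exists>c. v = (\<Sum>z\<in>?G. c z *s ?h z)" for v
      by (rule exI, rule dual_frame_expand2[OF tops_frame[OF T] tops_finite[OF T] tops_card[OF T] v0 tops_lat[OF T]])
  qed (use tops_finite[OF T] in simp)
  also have "\<dots> \<subseteq> cosheaf K n (convex hull T, P)"
  proof (rule F2.span_minimal[OF _ F2_subspace_cosheaf(1)], rule subsetI)
    fix z assume "z \<in> {wedge_list (map ?h gs) | gs. length gs = length (map (\<lambda>i. axis i 1 :: bit ^ 'm) xs) \<and> set gs \<subseteq> ?G}"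
    then obtain gs where gs: "z = wedge_list (map ?h gs)" "length gs = n" "set gs \<subseteq> ?G" using len by auto
    have "card (set gs) < card ?G"
      using card_length[of gs] gs(2) n tops_card[OF T] tops_finite[OF T] v0 by simp
    then obtain v where v: "v \<in> ?G" "v \<notin> set gs" using gs(3) by (metis order_less_irrefl subsetI subset_antisym)
    let ?e = "convex hull {v0, v}"
    have sub: "{v0, v} \<subseteq> T" using v v0 by auto
    have e: "?e \<in> K" "aff_dim ?e = 1" "?e \<subseteq> convex hull T"
      using face_tops_K[OF sub T] hull_mono[OF sub] v by (auto simp: aff_dim_convex_hull aff_dim_2)
    have "?h z \<in> perp2 ?e" if z: "z \<in> set gs" for z
    proof -
      have zT: "z \<in> T" using z gs(3) by auto
      have "?e \<subseteq> {x. frame T z \<bullet> x = frame T z \<bullet> v0}"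
      proof (rule hull_minimal)
        have "frame T z \<bullet> (v - v0) = 0"
          using dual_frame_inner[OF tops_frame[OF T] zT, of v v0] v v0 z gs(3) by auto
        then show "{v0, v} \<subseteq> {x. frame T z \<bullet> x = frame T z \<bullet> v0}" by (simp add: inner_diff_right)
      qed (simp add: convex_hyperplane)
      then have "\<forall>x\<in>?e. \<forall>y\<in>?e. frame T z \<bullet> (x - y) = 0" by (auto simp: inner_diff_right subset_iff)
      then show ?thesis using dual_frame_lat[OF tops_frame[OF T] zT] by (auto simp: perp2_def)
    qed
    then have "z \<in> ext_power n (perp2 ?e)"
      unfolding ext_power_def gs(1) using gs(2)
      by (intro F2.span_base CollectI exI[of _ "map ?h gs"]) auto
    then show "z \<in> cosheaf K n (convex hull T, P)"
      using e unfolding cosheaf_def prod.case by (intro F2.span_base) blast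
  qed
  finally show ?thesis using wedge_list_axes[OF xs(2)] xs(1) by simp
qed

definition weight_pairing :: "((real ^ 'm) set \<Rightarrow> bit ^ 'm) \<Rightarrow> 'm cchain \<Rightarrow> bit" where
  "weight_pairing w c = (\<Sum>T\<in>tops K. top_pairing (w T) (\<lambda>S. c ((convex hull T, P), S)))"

lemma weight_pairing_add: "weight_pairing w (c + c') = weight_pairing w c + weight_pairing w c'"
proof -
  have "(\<lambda>S. (c + c') (a, S)) = (\<lambda>S. c (a, S)) + (\<lambda>S. c' (a, S))" for a by (simp add: fun_eq_iff)
  then show ?thesis by (simp add: weight_pairing_def top_pairing_add_right sum.distrib)
qed

lemma inj_convex_hull_tops: "inj_on ((hull) convex) {S. \<exists>T\<in>tops K. S \<subseteq> T}"
proof (rule inj_onI)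
  fix S S' assume S: "S \<in> {S. \<exists>T\<in>tops K. S \<subseteq> T}" "S' \<in> {S. \<exists>T\<in>tops K. S \<subseteq> T}"
    and eq: "convex hull S = convex hull S'"
  obtain T where T: "T \<in> tops K" "S \<subseteq> T" using S(1) by blast
  obtain T' where T': "T' \<in> tops K" "S' \<subseteq> T'" using S(2) by blast
  have "verts (convex hull S) = S" "verts (convex hull S') = S'"
    by (rule verts_face_tops[OF T(2,1)], rule verts_face_tops[OF T'(2,1)])
  then show "S = S'" unfolding eq by (rule trans[OF sym])
qed

lemma subset_convex_hull_tops:
  assumes "S \<subseteq> T'" "T' \<in> tops K" "T \<in> tops K"
  shows "convex hull S \<subseteq> convex hull T \<longleftrightarrow> S \<subseteq> T"
proof
  assume sub: "convex hull S \<subseteq> convex hull T"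
  have "(convex hull T \<inter> convex hull S) face_of convex hull T"
    using K_Int[OF tops_K[OF assms(3)] face_tops_K[OF assms(1,2)]] .
  then have "convex hull S face_of convex hull T" using sub by (simp add: inf_absorb2)
  then obtain C where C: "C \<subseteq> T" "convex hull S = convex hull C"
    using face_of_convex_hull_affine_independent[OF tops_indep[OF assms(3)]] by blast
  then show "S \<subseteq> T" using verts_face_tops[OF assms(1,2)] verts_face_tops[OF C(1) assms(3)] by metis
qed (rule hull_mono)

lemma cells_above_top:
  assumes d: "CARD('m) \<ge> 2" and T: "T \<in> tops K"
  shows "{a\<in>X_cells P K 1. cell_le (convex hull T, P) a} = (\<lambda>S. (convex hull S, P)) ` {S\<in>ridges K. S \<subseteq> T}"
    (is "?L = ?R")
proof
  show "?L \<subseteq> ?R"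
  proof
    fix a assume a: "a \<in> ?L"
    obtain \<sigma> Q where \<sigma>: "a = (\<sigma>, Q)" by (cases a)
    have "\<sigma> \<in> K" "Q face_of P" "aff_dim Q - aff_dim \<sigma> = 1" "\<sigma> \<subseteq> convex hull T" "P \<subseteq> Q"
      using a unfolding \<sigma> by (auto simp: X_cells_def cell_le_def)
    moreover from this have Q: "Q = P" using face_of_imp_subset by blast
    ultimately have *: "\<sigma> \<in> K" "aff_dim \<sigma> = int CARD('m) - 1" "\<sigma> \<subseteq> convex hull T" using dim_P by auto
    have card: "card (verts \<sigma>) = CARD('m)" using K_verts(4)[OF *(1)] *(2) by simp
    obtain T' where T': "T' \<in> tops K" "verts \<sigma> \<subseteq> T'" using K_subset_tops[OF *(1)] by blast
    have "verts \<sigma> \<in> ridges K" using card T' by (auto simp: ridges_def)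
    moreover have "verts \<sigma> \<subseteq> T"
      using subset_convex_hull_tops[OF T'(2,1) T] *(3) K_verts(1)[OF *(1)] by simp
    ultimately show "a \<in> ?R" using \<sigma> Q K_verts(1)[OF *(1)] by blast
  qed
  show "?R \<subseteq> ?L"
  proof
    fix a assume "a \<in> ?R"
    then obtain S where S: "S \<in> ridges K" "S \<subseteq> T" "a = (convex hull S, P)" by blast
    have "convex hull S \<subseteq> P" using K_subset[OF ridgeD(5)[OF S(1)]] .
    then show "a \<in> ?L"
      using ridgeD(5,7)[OF S(1)] d dim_P face_of_refl[OF convex_P] hull_mono[OF S(2)]
      by (simp add: S(3) X_cells_def cell_le_def)
  qed
qed

text \<open>The pairing with the boundary of a chain over a ridge \<open>S\<close> is the pairing with the sum of the
  weights around \<open>S\<close>, which is orthogonal to the edges of \<open>S\<close>.\<close>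

lemma weight_pairing_boundary_zero:
  assumes n: "CARD('m) = n + 1" "n \<ge> 1" and w: "w \<in> balanced_weights K"
    and d: "d \<in> cell_chains (X_cells P K 1) (cosheaf K n)"
  shows "weight_pairing w (cell_boundary P K 1 d) = 0"
proof -
  let ?d = "\<lambda>S Z. d ((convex hull S, P), Z)"
  have d2: "CARD('m) \<ge> 2" using n by simp
  have "(\<lambda>Z. cell_boundary P K 1 d ((convex hull T, P), Z)) = (\<Sum>S\<in>{S\<in>ridges K. S \<subseteq> T}. ?d S)"
    if T: "T \<in> tops K" for T
  proof
    fix Z
    have "(convex hull T, P) \<in> X_cells P K (1 - 1)"
      using tops_K[OF T] K_subset[OF tops_K[OF T]] d2 dim_P face_of_refl[OF convex_P] tops_indep[OF T] tops_card[OF T]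
      by (simp add: X_cells_def aff_dim_convex_hull affine_independent_iff_card)
    then have "cell_boundary P K 1 d ((convex hull T, P), Z)
        = (\<Sum>a\<in>{a\<in>X_cells P K 1. cell_le (convex hull T, P) a}. d (a, Z))"
      by (simp add: cell_boundary_def)
    also have "\<dots> = (\<Sum>S\<in>{S\<in>ridges K. S \<subseteq> T}. ?d S Z)"
      unfolding cells_above_top[OF d2 T]
    proof (rule sum.reindex_cong[where l = "\<lambda>S. (convex hull S, P)"])
      show "inj_on (\<lambda>S. (convex hull S, P)) {S\<in>ridges K. S \<subseteq> T}"
        using inj_convex_hull_tops T by (auto simp: inj_on_def)
    qed auto
    also have "\<dots> = (\<Sum>S\<in>{S\<in>ridges K. S \<subseteq> T}. ?d S) Z"
      by (simp only: sum_fun_apply)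
    finally show "cell_boundary P K 1 d ((convex hull T, P), Z) = (\<Sum>S\<in>{S\<in>ridges K. S \<subseteq> T}. ?d S) Z" .
  qed
  then have "weight_pairing w (cell_boundary P K 1 d)
      = (\<Sum>T\<in>tops K. \<Sum>S\<in>{S\<in>ridges K. S \<subseteq> T}. top_pairing (w T) (?d S))"
    by (simp add: weight_pairing_def top_pairing_sum_right)
  also have "\<dots> = (\<Sum>S\<in>ridges K. \<Sum>T\<in>{T\<in>tops K. S \<subseteq> T}. top_pairing (w T) (?d S))"
    using finite_tops finite_ridges by (rule sum.swap_restrict)
  also have "\<dots> = (\<Sum>S\<in>ridges K. top_pairing (\<Sum>T\<in>{T\<in>tops K. S \<subseteq> T}. w T) (?d S))"
    by (simp only: top_pairing_sum_left)
  also have "\<dots> = 0"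
  proof (rule sum.neutral, rule ballI)
    fix S assume S: "S \<in> ridges K"
    have "convex hull S \<subseteq> P" using K_subset[OF ridgeD(5)[OF S]] .
    then have "(convex hull S, P) \<in> X_cells P K 1"
      using ridgeD(5,7)[OF S] d2 dim_P face_of_refl[OF convex_P] by (simp add: X_cells_def)
    then have "?d S \<in> cosheaf K n (convex hull S, P)" using d by (simp add: cell_chains_def)
    then show "top_pairing (\<Sum>T\<in>{T\<in>tops K. S \<subseteq> T}. w T) (?d S) = 0"
      by (rule top_pairing_ridge_zero[OF n(1) S]) (use w S in \<open>auto simp: balanced_weights_def\<close>)
  qed
  finally show ?thesis .
qed

lemma hodge_cycles_0: "hodge_cycles P K p 0 = cell_chains (X_cells P K 0) (cosheaf K p)"
proof -
  have "X_cells P K (- 1) = {}"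
  proof -
    have False if a: "a \<in> X_cells P K (- 1)" for a
    proof -
      obtain \<sigma> Q where \<sigma>: "a = (\<sigma>, Q)" by (cases a)
      have "\<sigma> \<subseteq> Q" "aff_dim Q - aff_dim \<sigma> = - 1" using a unfolding \<sigma> X_cells_def by auto
      then show False using aff_dim_subset[of \<sigma> Q] by simp
    qed
    then show ?thesis by blast
  qed
  then show ?thesis by (auto simp: hodge_cycles_def cell_boundary_def cell_chains_def)
qed

lemma hodge_boundaries_subspace: "F2_subspace (hodge_boundaries P K p 0)"
proof -
  let ?D = "cell_chains (X_cells P K 1) (cosheaf K p)" and ?E = "cell_chains (X_cells P K 0) (cosheaf_zero p)"
  have D: "F2_subspace ?D" and E: "F2_subspace ?E"
    by (rule F2_subspace_cell_chains, rule F2_subspace_cosheaf)+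
  have add: "cell_boundary P K 1 (d + d') = cell_boundary P K 1 d + cell_boundary P K 1 d'" for d d'
    by (auto simp: cell_boundary_def fun_eq_iff sum.distrib)
  have zero: "cell_boundary P K 1 0 = 0" by (auto simp: cell_boundary_def fun_eq_iff)
  have "hodge_boundaries P K p 0 = {cell_boundary P K 1 d + e | d e. d \<in> ?D \<and> e \<in> ?E}"
    by (simp add: hodge_boundaries_def)
  moreover have "F2_subspace \<dots>"
    unfolding F2_subspace_iff
  proof (intro conjI ballI)
    show "0 \<in> {cell_boundary P K 1 d + e | d e. d \<in> ?D \<and> e \<in> ?E}"
      using F2.subspace_0[OF D] F2.subspace_0[OF E] zero
      by (intro CollectI exI[of _ 0]) simp
  next
    fix x y assume "x \<in> {cell_boundary P K 1 d + e | d e. d \<in> ?D \<and> e \<in> ?E}"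
      and "y \<in> {cell_boundary P K 1 d + e | d e. d \<in> ?D \<and> e \<in> ?E}"
    then obtain d e d' e' where "x = cell_boundary P K 1 d + e" "d \<in> ?D" "e \<in> ?E"
      "y = cell_boundary P K 1 d' + e'" "d' \<in> ?D" "e' \<in> ?E" by blast
    then show "x + y \<in> {cell_boundary P K 1 d + e | d e. d \<in> ?D \<and> e \<in> ?E}"
      using F2.subspace_add[OF D] F2.subspace_add[OF E]
      by (intro CollectI exI[of _ "d + d'"] exI[of _ "e + e'"]) (simp add: add add_ac)
  qed
  ultimately show ?thesis by simp
qed

lemma hodge_boundaries_subset_cycles: "hodge_boundaries P K p 0 \<subseteq> hodge_cycles P K p 0"
proof
  fix c assume "c \<in> hodge_boundaries P K p 0"
  then obtain d e where c: "c = cell_boundary P K 1 d + e"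
    and d: "d \<in> cell_chains (X_cells P K 1) (cosheaf K p)"
    and e: "e \<in> cell_chains (X_cells P K 0) (cosheaf_zero p)"
    by (auto simp: hodge_boundaries_def)
  have "(\<lambda>S. e (a, S)) \<in> cosheaf K p a" if "a \<in> X_cells P K 0" for a
  proof (rule subsetD[OF cosheaf_zero_subset])
    show "(\<lambda>S. e (a, S)) \<in> cosheaf_zero p a" using e that by (simp add: cell_chains_def)
  qed
  then have "e \<in> cell_chains (X_cells P K 0) (cosheaf K p)"
    using e by (simp add: cell_chains_def)
  moreover have "cell_boundary P K 1 d \<in> cell_chains (X_cells P K 0) (cosheaf K p)"
    unfolding cell_chains_def
  proof (intro CollectI conjI ballI allI impI)
    fix a assume a: "a \<in> X_cells P K 0"
    have "(\<lambda>S. cell_boundary P K 1 d (a, S)) = (\<Sum>b\<in>{b\<in>X_cells P K 1. cell_le a b}. (\<lambda>S. d (b, S)))"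
      using a by (simp add: cell_boundary_def fun_eq_iff sum_fun_apply)
    also have "\<dots> \<in> cosheaf K p a"
    proof (rule F2.subspace_sum[OF F2_subspace_cosheaf(1)])
      fix b assume "b \<in> {b\<in>X_cells P K 1. cell_le a b}"
      then show "(\<lambda>S. d (b, S)) \<in> cosheaf K p a"
        using d cosheaf_mono[of a b K p] by (auto simp: cell_chains_def)
    qed
    finally show "(\<lambda>S. cell_boundary P K 1 d (a, S)) \<in> cosheaf K p a" .
  qed (auto simp: cell_boundary_def)
  ultimately show "c \<in> hodge_cycles P K p 0"
    unfolding c hodge_cycles_0
    by (intro F2.subspace_add[OF F2_subspace_cell_chains[OF F2_subspace_cosheaf(1)]])
qed

text \<open>As \<open>X\<close> has no cells of dimension \<open>-1\<close>, all chains of degree \<open>0\<close> are cycles, and a component of a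
  weight is detected by the chain of a coordinate form on the respective maximal simplex.\<close>

lemma card_balanced_weights:
  assumes n: "CARD('m) = n + 1" "n \<ge> 1"
  shows "finite (balanced_weights K) \<and> card (balanced_weights K) \<le> 2 ^ hodge P K n 0"
proof -
  have "finite (balanced_weights K) \<and>
      card (balanced_weights K) \<le> 2 ^ quot_dim (hodge_cycles P K n 0) (hodge_boundaries P K n 0)"
  proof (rule card_functionals_le[where \<Phi> = weight_pairing])
    show "F2_subspace (hodge_boundaries P K n 0)" by (rule hodge_boundaries_subspace)
    show "F2_subspace (hodge_cycles P K n 0)"
      unfolding hodge_cycles_0 by (rule F2_subspace_cell_chains[OF F2_subspace_cosheaf(1)])
    show "hodge_boundaries P K n 0 \<subseteq> hodge_cycles P K n 0" by (rule hodge_boundaries_subset_cycles)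
    show "finite (hodge_cycles P K n 0)"
      unfolding hodge_cycles_0 by (rule finite_cell_chains[OF finite_X_cells])
    show "weight_pairing w (c + c') = weight_pairing w c + weight_pairing w c'" for w c c'
      by (rule weight_pairing_add)
  next
    fix w c assume w: "w \<in> balanced_weights K" and "c \<in> hodge_boundaries P K n 0"
    then obtain d e where c: "c = cell_boundary P K 1 d + e"
      and d: "d \<in> cell_chains (X_cells P K 1) (cosheaf K n)"
      and e: "e \<in> cell_chains (X_cells P K 0) (cosheaf_zero n)"
      by (auto simp: hodge_boundaries_def)
    have "(\<lambda>S. e ((convex hull T, P), S)) = 0" for T
    proof (cases "(convex hull T, P) \<in> X_cells P K 0")
      case True
      then have "(\<lambda>S. e ((convex hull T, P), S)) \<in> cosheaf_zero n (convex hull T, P)"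
        using e by (simp add: cell_chains_def)
      then show ?thesis by (simp add: cosheaf_zero_def ext_kernel_Sed_P)
    next
      case False
      then show ?thesis using e by (auto simp: cell_chains_def fun_eq_iff)
    qed
    then have "weight_pairing w e = 0" by (simp add: weight_pairing_def)
    then show "weight_pairing w c = 0"
      using weight_pairing_boundary_zero[OF n w d] by (simp add: c weight_pairing_add)
  next
    fix w w' assume w: "w \<in> balanced_weights K" "w' \<in> balanced_weights K"
      and eq: "\<And>c. c \<in> hodge_cycles P K n 0 \<Longrightarrow> weight_pairing w c = weight_pairing w' c"
    have "w T = w' T" for T
    proof (cases "T \<in> tops K")
      case T: True
      have "w T $ i = w' T $ i" for i
      proof -
        define c :: "'m cchain" where
          "c = (\<lambda>(a, S). if a = (convex hull T, P) then of_bool (S = UNIV - {i}) else 0)"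
        have a: "(convex hull T, P) \<in> X_cells P K 0"
          using tops_K[OF T] K_subset[OF tops_K[OF T]] n dim_P face_of_refl[OF convex_P] tops_indep[OF T] tops_card[OF T]
          by (simp add: X_cells_def aff_dim_convex_hull affine_independent_iff_card)
        have c0: "(\<lambda>S. c (b, S)) = (if b = (convex hull T, P) then (\<lambda>S. of_bool (S = UNIV - {i})) else 0)" for b
          by (simp add: c_def fun_eq_iff)
        have "c \<in> hodge_cycles P K n 0"
          unfolding hodge_cycles_0 cell_chains_def
        proof (intro CollectI conjI ballI allI impI)
          show "(\<lambda>S. c (b, S)) \<in> cosheaf K n b" for b
            unfolding c0 using coordinate_form_in_cosheaf[OF n(1) T]
            by (simp add: F2.subspace_0[OF F2_subspace_cosheaf(1)])
        qed (use a in \<open>auto simp: c_def\<close>)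
        then have "weight_pairing w c = weight_pairing w' c" by (rule eq)
        moreover have "weight_pairing v c = v T $ i" for v
        proof -
          have "weight_pairing v c = (\<Sum>T'\<in>tops K. if T' = T then top_pairing (v T) (\<lambda>S. of_bool (S = UNIV - {i})) else 0)"
            unfolding weight_pairing_def
          proof (rule sum.cong[OF refl])
            fix T' assume T': "T' \<in> tops K"
            have "convex hull T' = convex hull T \<longleftrightarrow> T' = T"
              using inj_onD[OF inj_convex_hull_tops, of T' T] T T' by blast
            then show "top_pairing (v T') (\<lambda>S. c ((convex hull T', P), S))
                = (if T' = T then top_pairing (v T) (\<lambda>S. of_bool (S = UNIV - {i})) else 0)"
              unfolding c0 by simp
          qed
          also have "\<dots> = top_pairing (v T) (\<lambda>S. of_bool (S = UNIV - {i}))"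
            using T finite_tops by (simp add: sum.delta)
          also have "\<dots> = (\<Sum>j\<in>UNIV. if j = i then v T $ i else 0)"
            unfolding top_pairing_def wedge_ext_vec by (rule sum.cong) auto
          also have "\<dots> = v T $ i" by (simp add: sum.delta)
          finally show ?thesis .
        qed
        ultimately show ?thesis by simp
      qed
      then show ?thesis by (simp add: vec_eq_iff)
    qed (use w in \<open>auto simp: balanced_weights_def\<close>)
    then show "w = w'" by blast
  qed
  then show ?thesis by (simp add: hodge_def)
qed

end

section \<open>Path components and singular homology in degree zero\<close>

definition single2 :: "((nat \<Rightarrow> real) \<Rightarrow> 'a) \<Rightarrow> 'a chain2" where
  "single2 f = (\<lambda>g. of_bool (g = f))"

definition point_simplex :: "'a \<Rightarrow> (nat \<Rightarrow> real) \<Rightarrow> 'a" where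
  "point_simplex x = restrict (\<lambda>_. x) (standard_simplex 0)"

abbreviation vertex0 :: "nat \<Rightarrow> real" where
  "vertex0 \<equiv> \<lambda>j. if j = 0 then 1 else 0"

lemma point_simplex_vertex [simp]: "point_simplex x vertex0 = x"
  by (simp add: point_simplex_def standard_simplex_0)

lemma singular_simplex_0_iff:
  "singular_simplex 0 X f \<longleftrightarrow> f vertex0 \<in> topspace X \<and> f = point_simplex (f vertex0)"
proof
  assume f: "singular_simplex 0 X f"
  then have "f vertex0 \<in> topspace X"
    unfolding singular_simplex_def by (auto simp: continuous_map_def standard_simplex_0)
  moreover have "f = point_simplex (f vertex0)"
  proof
    fix z show "f z = point_simplex (f vertex0) z"
      using f by (cases "z = vertex0") (auto simp: singular_simplex_def point_simplex_def standard_simplex_0 extensional_def)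
  qed
  ultimately show "f vertex0 \<in> topspace X \<and> f = point_simplex (f vertex0)" by blast
next
  assume f: "f vertex0 \<in> topspace X \<and> f = point_simplex (f vertex0)"
  have "singular_simplex 0 X (point_simplex x)" if "x \<in> topspace X" for x
    unfolding singular_simplex_def point_simplex_def
  proof
    show "continuous_map (subtopology (powertop_real UNIV) (standard_simplex 0)) X
       (restrict (\<lambda>_. x) (standard_simplex 0))"
      by (rule continuous_map_eq[where f = "\<lambda>_. x"]) (use that in auto)
  qed simp
  then show "singular_simplex 0 X f" using f by metis
qed

abbreviation edge_boundary :: "((nat \<Rightarrow> real) \<Rightarrow> 'a) \<Rightarrow> 'a chain2" where
  "edge_boundary f \<equiv> single2 (singular_face 1 0 f) + single2 (singular_face 1 1 f)"

lemma chain2_sum_single: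
  assumes "c \<in> chains2 p X"
  shows "c = (\<Sum>f\<in>{f. c f \<noteq> 0}. single2 f)"
proof
  fix g
  have fin: "finite {f. c f \<noteq> 0}" using assms by (simp add: chains2_def)
  have "(\<Sum>f\<in>{f. c f \<noteq> 0}. single2 f g) = (\<Sum>f\<in>{f. c f \<noteq> 0}. if f = g then 1 else 0)"
    by (rule sum.cong) (auto simp: single2_def)
  also have "\<dots> = c g" using fin by (cases "c g = 0") (simp_all add: sum.delta)
  finally show "c g = (\<Sum>f\<in>{f. c f \<noteq> 0}. single2 f) g" by (simp add: sum_fun_apply)
qed

lemma chains2_add: "\<lbrakk>c \<in> chains2 p X; d \<in> chains2 p X\<rbrakk> \<Longrightarrow> c + d \<in> chains2 p X"
proof -
  assume c: "c \<in> chains2 p X" and d: "d \<in> chains2 p X"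
  have sub: "{f. (c + d) f \<noteq> 0} \<subseteq> {f. c f \<noteq> 0} \<union> {f. d f \<noteq> 0}" by auto
  then have "finite {f. (c + d) f \<noteq> 0}"
    using c d by (auto simp: chains2_def intro: finite_subset)
  then show ?thesis using c d sub unfolding chains2_def by blast
qed

lemma chains2_subspace: "F2_subspace (chains2 p X)"
  unfolding F2_subspace_iff by (simp add: chains2_add) (simp add: chains2_def)

lemma single2_in_chains2: "singular_simplex p X f \<Longrightarrow> single2 f \<in> chains2 p X"
  by (auto simp: chains2_def single2_def)

lemma boundary2_on_superset:
  assumes "finite A" "{f. c f \<noteq> 0} \<subseteq> A"
  shows "boundary2 1 c = (\<lambda>g. \<Sum>f\<in>A. c f * edge_boundary f g)"
proof
  fix g
  have "boundary2 1 c g = (\<Sum>f\<in>{f. c f \<noteq> 0}. \<Sum>k\<le>1. c f * of_bool (g = singular_face 1 k f))"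
    by (simp add: boundary2_def)
  also have "\<dots> = (\<Sum>f\<in>{f. c f \<noteq> 0}. c f * edge_boundary f g)"
    by (rule sum.cong[OF refl]) (simp add: single2_def distrib_left)
  also have "\<dots> = (\<Sum>f\<in>A. c f * edge_boundary f g)"
    by (rule sum.mono_neutral_left) (use assms in auto)
  finally show "boundary2 1 c g = (\<Sum>f\<in>A. c f * edge_boundary f g)" .
qed

lemma boundary2_image_eq_span:
  "boundary2 1 ` chains2 1 X = F2_span (edge_boundary ` {f. singular_simplex 1 X f})"
proof
  show "boundary2 1 ` chains2 1 X \<subseteq> F2_span (edge_boundary ` {f. singular_simplex 1 X f})"
  proof (rule image_subsetI)
    fix c assume c: "c \<in> chains2 1 X"
    have "boundary2 1 c = (\<Sum>f\<in>{f. c f \<noteq> 0}. edge_boundary f)"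
    proof
      fix g
      have "boundary2 1 c g = (\<Sum>f\<in>{f. c f \<noteq> 0}. c f * edge_boundary f g)"
        by (subst boundary2_on_superset[of "{f. c f \<noteq> 0}"]) (use c in \<open>auto simp: chains2_def\<close>)
      also have "\<dots> = (\<Sum>f\<in>{f. c f \<noteq> 0}. edge_boundary f g)" by (rule sum.cong) auto
      finally show "boundary2 1 c g = (\<Sum>f\<in>{f. c f \<noteq> 0}. edge_boundary f) g" by (simp only: sum_fun_apply)
    qed
    also have "\<dots> \<in> F2_span (edge_boundary ` {f. singular_simplex 1 X f})"
      by (rule F2.span_sum, rule F2.span_base) (use c in \<open>auto simp: chains2_def\<close>)
    finally show "boundary2 1 c \<in> F2_span (edge_boundary ` {f. singular_simplex 1 X f})" .
  qed
  have add: "boundary2 1 (c + d) = boundary2 1 c + boundary2 1 d" if "c \<in> chains2 1 X" "d \<in> chains2 1 X" for c d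
  proof -
    let ?A = "{f. c f \<noteq> 0} \<union> {f. d f \<noteq> 0}"
    have A: "finite ?A" using that by (auto simp: chains2_def)
    have e: "boundary2 1 e = (\<lambda>g. \<Sum>f\<in>?A. e f * edge_boundary f g)" if "{f. e f \<noteq> 0} \<subseteq> ?A" for e
      using A that by (rule boundary2_on_superset)
    have "{f. (c + d) f \<noteq> 0} \<subseteq> ?A" by auto
    then show ?thesis
      unfolding e[OF Un_upper1] e[OF Un_upper2] by (subst e) (simp_all add: fun_eq_iff distrib_right sum.distrib)
  qed
  have "F2_subspace (boundary2 1 ` chains2 1 X)"
    unfolding F2_subspace_iff
  proof (intro conjI ballI)
    have "boundary2 1 0 = 0" by (simp add: boundary2_def fun_eq_iff)
    then show "0 \<in> boundary2 1 ` chains2 1 X"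
      using F2.subspace_0[OF chains2_subspace, of 1 X] by (metis imageI)
  next
    fix x y assume "x \<in> boundary2 1 ` chains2 1 X" "y \<in> boundary2 1 ` chains2 1 X"
    then obtain c d where c: "c \<in> chains2 1 X" "x = boundary2 1 c" and d: "d \<in> chains2 1 X" "y = boundary2 1 d"
      by blast
    have "x + y = boundary2 1 (c + d)" using add[OF c(1) d(1)] c d by simp
    then show "x + y \<in> boundary2 1 ` chains2 1 X" using chains2_add[OF c(1) d(1)] by blast
  qed
  moreover have "edge_boundary f \<in> boundary2 1 ` chains2 1 X" if f: "singular_simplex 1 X f" for f
  proof -
    have "boundary2 1 (single2 f) = (\<lambda>g. \<Sum>h\<in>{f}. single2 f h * edge_boundary h g)"
      by (rule boundary2_on_superset) (auto simp: single2_def)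
    then have "boundary2 1 (single2 f) = edge_boundary f" by (simp add: fun_eq_iff single2_def)
    then show ?thesis using single2_in_chains2[OF f] by (metis imageI)
  qed
  ultimately show "F2_span (edge_boundary ` {f. singular_simplex 1 X f}) \<subseteq> boundary2 1 ` chains2 1 X"
    by (intro F2.span_minimal) auto
qed

lemma singular_face_1: "singular_face 1 k f = point_simplex (f (simplical_face k vertex0))"
proof
  fix z show "singular_face 1 k f z = point_simplex (f (simplical_face k vertex0)) z"
    by (cases "z = vertex0") (simp_all add: singular_face_def point_simplex_def standard_simplex_0)
qed

lemma edge_faces:
  assumes "singular_simplex 1 X f"
  obtains x y where "path_component_of X x y" "singular_face 1 0 f = point_simplex y" "singular_face 1 1 f = point_simplex x"
proof -
  let ?z = "\<lambda>t::real. \<lambda>i::nat. if i = 0 then 1 - t else if i = 1 then t else 0"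
  let ?g = "\<lambda>t. f (?z t)"
  have "continuous_map (top_of_set {0..1}) (subtopology (powertop_real UNIV) (standard_simplex 1)) ?z"
    unfolding continuous_map_in_subtopology continuous_map_componentwise_UNIV
  proof (intro conjI allI)
    fix k
    show "continuous_map (top_of_set {0..1}) euclideanreal (\<lambda>t. ?z t k)"
      by (cases "k = 0"; cases "k = 1") (auto intro!: continuous_intros)
    show "?z \<in> topspace (top_of_set {0..1}) \<rightarrow> standard_simplex 1"
      by (auto simp: standard_simplex_def)
  qed
  then have "continuous_map (top_of_set {0..1}) X (f \<circ> ?z)"
    using assms unfolding singular_simplex_def by (blast intro: continuous_map_compose)
  then have "pathin X ?g" by (simp add: pathin_def o_def)
  then have "path_component_of X (?g 0) (?g 1)" unfolding path_component_of_def by blast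
  moreover have "singular_face 1 0 f = point_simplex (?g 1)" "singular_face 1 1 f = point_simplex (?g 0)"
  proof -
    have "simplical_face 0 vertex0 = ?z 1" "simplical_face 1 vertex0 = ?z 0"
      by (auto simp: simplical_face_def fun_eq_iff)
    then show "singular_face 1 0 f = point_simplex (?g 1)" "singular_face 1 1 f = point_simplex (?g 0)"
      by (simp_all only: singular_face_1)
  qed
  ultimately show thesis using that by blast
qed

lemma path_edge:
  assumes "path_component_of X x y"
  obtains f where "singular_simplex 1 X f" "singular_face 1 0 f = point_simplex y" "singular_face 1 1 f = point_simplex x"
proof -
  obtain g where g: "pathin X g" "g 0 = x" "g 1 = y" using assms by (auto simp: path_component_of_def)
  let ?f = "restrict (g \<circ> (\<lambda>z. z 1)) (standard_simplex 1)"
  have "continuous_map (subtopology (powertop_real UNIV) (standard_simplex 1)) euclideanreal (\<lambda>z. z 1)"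
    by (metis (mono_tags) UNIV_I continuous_map_from_subtopology continuous_map_product_projection)
  then have "continuous_map (subtopology (powertop_real UNIV) (standard_simplex 1)) (top_of_set {0..1}) (\<lambda>z. z 1)"
    unfolding continuous_map_in_subtopology by (auto simp: standard_simplex_def)
  then have "continuous_map (subtopology (powertop_real UNIV) (standard_simplex 1)) X (g \<circ> (\<lambda>z. z 1))"
    using g(1) unfolding pathin_def by (rule continuous_map_compose)
  then have "continuous_map (subtopology (powertop_real UNIV) (standard_simplex 1)) X ?f"
    by (rule continuous_map_eq) auto
  then have f: "singular_simplex 1 X ?f" unfolding singular_simplex_def by simp
  have in1: "simplical_face k vertex0 \<in> standard_simplex 1" if "k \<le> 1" for k
    using simplical_face_in_standard_simplex[of 1 k vertex0] that by (simp add: standard_simplex_0)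
  have "simplical_face 0 vertex0 1 = (1::real)" "simplical_face 1 vertex0 1 = (0::real)"
    by (auto simp: simplical_face_def)
  then have "singular_face 1 0 ?f = point_simplex y" "singular_face 1 1 ?f = point_simplex x"
    using in1[of 0] in1[of 1] g(2,3) by (simp_all only: singular_face_1 restrict_apply o_apply) simp_all
  with f show thesis using that by blast
qed

text \<open>The number modulo two of the points of a chain that lie in the path component of \<open>y\<close>.\<close>

definition component_count :: "'a topology \<Rightarrow> 'a \<Rightarrow> 'a chain2 \<Rightarrow> bit" where
  "component_count X y c = (\<Sum>f\<in>{f. c f \<noteq> 0}. of_bool (path_component_of X y (f vertex0)))"

lemma component_count_on_superset:
  assumes "finite A" "{f. c f \<noteq> 0} \<subseteq> A"
  shows "component_count X y c = (\<Sum>f\<in>A. c f * of_bool (path_component_of X y (f vertex0)))"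
proof -
  have "component_count X y c = (\<Sum>f\<in>{f. c f \<noteq> 0}. c f * of_bool (path_component_of X y (f vertex0)))"
    unfolding component_count_def by (rule sum.cong) auto
  also have "\<dots> = (\<Sum>f\<in>A. c f * of_bool (path_component_of X y (f vertex0)))"
    by (rule sum.mono_neutral_left) (use assms in auto)
  finally show ?thesis .
qed

lemma component_count_add:
  assumes "c \<in> chains2 p X" "d \<in> chains2 p X"
  shows "component_count X y (c + d) = component_count X y c + component_count X y d"
proof -
  let ?A = "{f. c f \<noteq> 0} \<union> {f. d f \<noteq> 0}"
  have A: "finite ?A" using assms by (auto simp: chains2_def)
  have "component_count X y e = (\<Sum>f\<in>?A. e f * of_bool (path_component_of X y (f vertex0)))"
    if "{f. e f \<noteq> 0} \<subseteq> ?A" for e using component_count_on_superset[OF A that] .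
  moreover have "{f. (c + d) f \<noteq> 0} \<subseteq> ?A" by auto
  ultimately show ?thesis by (simp add: distrib_right sum.distrib)
qed

lemma component_count_single: "component_count X y (single2 f) = of_bool (path_component_of X y (f vertex0))"
proof -
  have "component_count X y (single2 f) = (\<Sum>h\<in>{f}. single2 f h * of_bool (path_component_of X y (h vertex0)))"
    by (rule component_count_on_superset) (auto simp: single2_def)
  then show ?thesis by (simp add: single2_def)
qed

lemma component_count_zero [simp]: "component_count X y 0 = 0"
  by (simp add: component_count_def)

text \<open>The points of \<open>R\<close> represent the path components; their classes are a basis of \<open>H\<^sub>0\<close> because
  counting points of a chain in a fixed component modulo two vanishes on boundaries of edges.\<close>

lemma betti2_0_eq_card:
  assumes R: "R \<subseteq> topspace X" "finite R"
    and uniq: "\<And>x y. \<lbrakk>x \<in> R; y \<in> R; path_component_of X x y\<rbrakk> \<Longrightarrow> x = y"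
    and ex: "\<And>x. x \<in> topspace X \<Longrightarrow> \<exists>y\<in>R. path_component_of X y x"
  shows "betti2 0 X = card R"
proof -
  let ?b = "\<lambda>x. single2 (point_simplex x)" and ?c = "component_count X"
  let ?B = "?b ` R" and ?U = "chains2 0 X" and ?W = "boundary2 1 ` chains2 1 X"
  have pt: "singular_simplex 0 X (point_simplex x)" if "x \<in> topspace X" for x
    using that by (simp add: singular_simplex_0_iff)
  have bU: "?b x \<in> ?U" if "x \<in> topspace X" for x using single2_in_chains2[OF pt[OF that]] .
  have BU: "?B \<subseteq> ?U" using bU R by blast
  have W: "F2_subspace ?W" unfolding boundary2_image_eq_span by (rule F2.subspace_span)
  have c_b: "?c y (?b x) = of_bool (path_component_of X y x)" for x y by (simp add: component_count_single)
  have c_bR: "?c y (?b x) = of_bool (x = y)" if "x \<in> R" "y \<in> R" for x y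
    using that uniq R path_component_of_refl[of X y] by (auto simp: c_b)
  have edge: "edge_boundary f \<in> ?U \<and> (\<forall>y. ?c y (edge_boundary f) = 0)" if f: "singular_simplex 1 X f" for f
  proof -
    obtain x y where xy: "path_component_of X x y" and e: "edge_boundary f = ?b y + ?b x"
      using edge_faces[OF f] by metis
    have top: "x \<in> topspace X" "y \<in> topspace X" using path_component_in_topspace[OF xy] by auto
    have "path_component_of X z x \<longleftrightarrow> path_component_of X z y" for z
      using xy path_component_of_trans path_component_of_sym by metis
    then have "?c z (?b y + ?b x) = 0" for z
      using component_count_add[OF bU[OF top(2)] bU[OF top(1)], of z] by (simp add: c_b)
    then show ?thesis using e chains2_add[OF bU[OF top(2)] bU[OF top(1)]] by simp
  qed
  have subspace_zero: "F2_subspace {c \<in> ?U. \<forall>y\<in>Y. ?c y c = 0}" for Y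
    unfolding F2_subspace_iff
    using F2.subspace_0[OF chains2_subspace] by (auto simp: chains2_add component_count_add)
  have W0: "?W \<subseteq> {c \<in> ?U. \<forall>y\<in>UNIV. ?c y c = 0}"
    unfolding boundary2_image_eq_span
    by (rule F2.span_minimal[OF _ subspace_zero]) (use edge in auto)
  have inj: "inj_on ?b R"
  proof (rule inj_onI)
    fix x y assume "x \<in> R" "y \<in> R" "?b x = ?b y"
    then show "x = y" using c_bR[of x y] c_bR[of y y] by (cases "x = y") auto
  qed
  have finB: "finite ?B" using R by simp
  have indep: "\<not> F2_dependent ?B"
  proof
    assume "F2_dependent ?B"
    then obtain x where x: "x \<in> R" "?b x \<in> F2_span (?B - {?b x})"
      unfolding F2.dependent_def by blast
    have "?B - {?b x} \<subseteq> {c \<in> ?U. \<forall>y\<in>{x}. ?c y c = 0}"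
      using BU x(1) c_bR by auto
    then have "F2_span (?B - {?b x}) \<subseteq> {c \<in> ?U. \<forall>y\<in>{x}. ?c y c = 0}"
      by (rule F2.span_minimal[OF _ subspace_zero])
    then have "?c x (?b x) = 0" using x(2) by blast
    then show False using c_bR[OF x(1) x(1)] by simp
  qed
  have expand: "F2_span ?B \<subseteq> {c \<in> ?U. c = (\<lambda>g. \<Sum>x\<in>R. ?c x c * ?b x g)}"
  proof (rule F2.span_minimal)
    show "?B \<subseteq> {c \<in> ?U. c = (\<lambda>g. \<Sum>x\<in>R. ?c x c * ?b x g)}"
    proof (rule image_subsetI, rule CollectI, rule conjI)
      fix x assume x: "x \<in> R"
      then show "?b x \<in> ?U" using BU by blast
      show "?b x = (\<lambda>g. \<Sum>y\<in>R. ?c y (?b x) * ?b y g)"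
      proof
        fix g
        have "(\<Sum>y\<in>R. ?c y (?b x) * ?b y g) = (\<Sum>y\<in>R. if y = x then ?b x g else 0)"
          by (rule sum.cong) (use c_bR x in auto)
        then show "?b x g = (\<Sum>y\<in>R. ?c y (?b x) * ?b y g)" using x R by (simp add: sum.delta)
      qed
    qed
    show "F2_subspace {c \<in> ?U. c = (\<lambda>g. \<Sum>x\<in>R. ?c x c * ?b x g)}"
      unfolding F2_subspace_iff
    proof (intro conjI ballI CollectI)
      show "0 \<in> ?U" by (rule F2.subspace_0[OF chains2_subspace])
      show "0 = (\<lambda>g. \<Sum>x\<in>R. ?c x 0 * ?b x g)" by (simp add: fun_eq_iff)
    next
      fix c d assume c: "c \<in> {c \<in> ?U. c = (\<lambda>g. \<Sum>x\<in>R. ?c x c * ?b x g)}"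
        and d: "d \<in> {c \<in> ?U. c = (\<lambda>g. \<Sum>x\<in>R. ?c x c * ?b x g)}"
      then show "c + d \<in> ?U" by (simp add: chains2_add)
      show "c + d = (\<lambda>g. \<Sum>x\<in>R. ?c x (c + d) * ?b x g)"
      proof
        fix g
        have "c g = (\<Sum>x\<in>R. ?c x c * ?b x g)" "d g = (\<Sum>x\<in>R. ?c x d * ?b x g)"
          using c d by (auto dest: fun_cong)
        moreover have "?c x (c + d) = ?c x c + ?c x d" for x
          by (rule component_count_add) (use c d in auto)
        ultimately show "(c + d) g = (\<Sum>x\<in>R. ?c x (c + d) * ?b x g)"
          by (simp only: plus_fun_apply distrib_right sum.distrib)
      qed
    qed
  qed
  have int: "F2_span ?B \<inter> ?W = {0}"
  proof
    show "F2_span ?B \<inter> ?W \<subseteq> {0}"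
    proof
      fix c assume c: "c \<in> F2_span ?B \<inter> ?W"
      then have "c = (\<lambda>g. \<Sum>x\<in>R. ?c x c * ?b x g)" using expand by blast
      moreover have "?c x c = 0" for x using c W0 by blast
      ultimately have "c = (\<lambda>g. \<Sum>x\<in>R. 0 * ?b x g)" by simp
      then show "c \<in> {0}" by (simp add: fun_eq_iff)
    qed
  qed (use F2.span_zero F2.subspace_0[OF W] in simp)
  have sum: "{b + w |b w. b \<in> F2_span ?B \<and> w \<in> ?W} = ?U"
  proof -
    have "F2_span (?B \<union> ?W) = {b + w |b w. b \<in> F2_span ?B \<and> w \<in> F2_span ?W}" by (rule F2.span_Un)
    moreover have "F2_span ?W = ?W" using W by (rule F2.span_eq_iff[THEN iffD2])
    moreover have "F2_span (?B \<union> ?W) = ?U"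
    proof
      show "F2_span (?B \<union> ?W) \<subseteq> ?U"
        by (rule F2.span_minimal[OF _ chains2_subspace]) (use BU W0 in blast)
      show "?U \<subseteq> F2_span (?B \<union> ?W)"
      proof
        fix c assume c: "c \<in> ?U"
        have "single2 f \<in> F2_span (?B \<union> ?W)" if f: "f \<in> {f. c f \<noteq> 0}" for f
        proof -
          have "singular_simplex 0 X f" using c f by (simp add: chains2_def)
          then have top: "f vertex0 \<in> topspace X" and fp: "f = point_simplex (f vertex0)"
            using singular_simplex_0_iff by blast+
          obtain y where y: "y \<in> R" "path_component_of X y (f vertex0)" using ex[OF top] by blast
          obtain h where h: "singular_simplex 1 X h" "edge_boundary h = single2 f + ?b y"
            using path_edge[OF y(2)] fp by metis
          have "edge_boundary h \<in> ?W"
            unfolding boundary2_image_eq_span using h(1) by (intro F2.span_base) blast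
          then have "edge_boundary h \<in> F2_span (?B \<union> ?W)" by (intro F2.span_base) blast
          moreover have "?b y \<in> F2_span (?B \<union> ?W)" using y(1) by (intro F2.span_base) blast
          ultimately have "(single2 f + ?b y) + ?b y \<in> F2_span (?B \<union> ?W)"
            unfolding h(2) by (rule F2.span_add)
          then show ?thesis by (simp add: add.assoc F2_add_self)
        qed
        then have "(\<Sum>f\<in>{f. c f \<noteq> 0}. single2 f) \<in> F2_span (?B \<union> ?W)" by (rule F2.span_sum)
        then show "c \<in> F2_span (?B \<union> ?W)" using chain2_sum_single[OF c] by simp
      qed
    qed
    ultimately show ?thesis by (simp only:)
  qed
  have "complement_basis ?U ?W ?B" unfolding complement_basis_def using finB indep int sum by blast
  then have "quot_dim ?U ?W = card ?B" by (rule quot_dim_eq[OF W])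
  moreover have "{c \<in> ?U. boundary2 0 c = 0} = ?U" by (simp add: boundary2_def)
  ultimately show ?thesis using card_image[OF inj] by (simp add: betti2_def)
qed

lemma path_representatives_exist:
  assumes N: "finite N" and ex: "\<And>x. x \<in> topspace X \<Longrightarrow> \<exists>y\<in>N. path_component_of X x y"
  obtains R where "R \<subseteq> topspace X" "finite R"
    "\<And>x y. \<lbrakk>x \<in> R; y \<in> R; path_component_of X x y\<rbrakk> \<Longrightarrow> x = y"
    "\<And>x. x \<in> topspace X \<Longrightarrow> \<exists>y\<in>R. path_component_of X y x"
proof -
  define r where "r x = (SOME y. y \<in> N \<and> path_component_of X x y)" for x
  have r: "r x \<in> N \<and> path_component_of X x (r x)" if "x \<in> topspace X" for x
    unfolding r_def by (rule someI_ex) (use ex[OF that] in blast)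
  have eq: "r x = r y" if "path_component_of X x y" for x y
  proof -
    have "path_component_of X x = path_component_of X y" using that by (simp add: path_component_of_equiv)
    then show ?thesis by (simp add: r_def)
  qed
  have top: "r x \<in> topspace X" if "x \<in> topspace X" for x
    using path_component_in_topspace[of X x "r x"] r[OF that] by blast
  have rr: "r (r x) = r x" if "x \<in> topspace X" for x using eq r[OF that] by metis
  show thesis
  proof (rule that[of "r ` topspace X"])
    show "finite (r ` topspace X)" by (rule finite_subset[OF _ N]) (use r in blast)
    show "x = y" if "x \<in> r ` topspace X" "y \<in> r ` topspace X" "path_component_of X x y" for x y
      using that(1,2) eq[OF that(3)] by (auto simp: rr)
    show "\<exists>y\<in>r ` topspace X. path_component_of X y x" if "x \<in> topspace X" for x
      using path_component_of_sym[of X x "r x"] r[OF that] that by blast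
  qed (use top in blast)
qed

section \<open>Functions on the components of a T-hypersurface\<close>

lemma barycenter_mem:
  assumes "finite S" "S \<noteq> {}"
  shows "(1 / real (card S)) *\<^sub>R (\<Sum>v\<in>S. v) \<in> convex hull S"
  unfolding convex_hull_finite[OF assms(1)] scaleR_sum_right
  using assms by (intro CollectI exI[of _ "\<lambda>_. 1 / real (card S)"]) simp

lemma perp2_add: "\<lbrakk>a \<in> perp2 S; b \<in> perp2 S\<rbrakk> \<Longrightarrow> a + b \<in> perp2 S"
proof -
  assume "a \<in> perp2 S" "b \<in> perp2 S"
  then obtain x y where x: "x \<in> lat" "\<forall>p\<in>S. \<forall>q\<in>S. x \<bullet> (p - q) = 0" "a = mod2 x"
    and y: "y \<in> lat" "\<forall>p\<in>S. \<forall>q\<in>S. y \<bullet> (p - q) = 0" "b = mod2 y"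
    unfolding perp2_def by blast
  have "\<forall>p\<in>S. \<forall>q\<in>S. (x + y) \<bullet> (p - q) = 0" using x(2) y(2) by (simp add: inner_add_left)
  then show ?thesis using x y by (auto simp: perp2_def mod2_add[symmetric] lat_add)
qed

lemma toric_class_translate:
  assumes l: "l \<in> Sed Q" and Q: "Q face_of P" "x \<in> Q"
  shows "toric_class P (u + l, x) = toric_class P (u, x)"
proof -
  have "smallest_face P x \<subseteq> Q" using Q by (auto simp: smallest_face_def)
  then have l': "l \<in> Sed (smallest_face P x)" using l perp2_antimono by blast
  have "u + l - u' \<in> Sed (smallest_face P x) \<longleftrightarrow> u - u' \<in> Sed (smallest_face P x)" for u'
  proof
    assume "u + l - u' \<in> Sed (smallest_face P x)"
    then have "(u + l - u') + l \<in> Sed (smallest_face P x)" using l' by (rule perp2_add)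
    moreover have "(u + l - u') + l = (u - u') + (l + l)" by (simp only: bitvec_diff_eq_add ac_simps)
    ultimately show "u - u' \<in> Sed (smallest_face P x)" by simp
  next
    assume "u - u' \<in> Sed (smallest_face P x)"
    then have "(u - u') + l \<in> Sed (smallest_face P x)" using l' by (rule perp2_add)
    moreover have "(u - u') + l = u + l - u'" by (simp only: bitvec_diff_eq_add ac_simps)
    ultimately show "u + l - u' \<in> Sed (smallest_face P x)" by simp
  qed
  then show ?thesis unfolding toric_class_def by auto
qed

lemma sum_translate_bitvec:
  fixes h :: "bit ^ 'm \<Rightarrow> 'a::comm_monoid_add"
  shows "(\<Sum>u\<in>UNIV. h (u + l)) = (\<Sum>u\<in>UNIV. h u)"
proof (rule sum.reindex_bij_witness[where i = "\<lambda>u. u + l" and j = "\<lambda>u. u + l"])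
qed (simp_all add: add.assoc)

text \<open>Translation by a nonzero vector is an involution without fixed points.\<close>

lemma sum_invariant_zero:
  fixes h :: "bit ^ 'm \<Rightarrow> bit"
  assumes inv: "\<And>u. h (u + l) = h u" and l: "l \<noteq> 0"
  shows "(\<Sum>u\<in>UNIV. h u) = 0"
proof -
  obtain i where i: "l $ i = 1" using l by (auto simp: vec_eq_iff)
  let ?A = "{u :: bit ^ 'm. u $ i = 0}" and ?B = "{u :: bit ^ 'm. u $ i = 1}"
  have UNIV: "UNIV = ?A \<union> ?B" by auto
  have "(\<Sum>u\<in>UNIV. h u) = (\<Sum>u\<in>?A. h u) + (\<Sum>u\<in>?B. h u)"
    by (subst UNIV, rule sum.union_disjoint) auto
  also have "(\<Sum>u\<in>?B. h u) = (\<Sum>u\<in>?A. h u)"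
    by (rule sum.reindex_bij_witness[where i = "\<lambda>u. u + l" and j = "\<lambda>u. u + l"])
      (auto simp: inv i add.assoc)
  finally show ?thesis by simp
qed

text \<open>The first moment detects a function that is supported on a pair \<open>{p, p + l}\<close>.\<close>

lemma pair_supported:
  fixes G :: "bit ^ 'm \<Rightarrow> bit"
  assumes supp: "\<And>u. u \<noteq> p \<Longrightarrow> u \<noteq> p + l \<Longrightarrow> G u = 0" and sum: "(\<Sum>u\<in>UNIV. G u) = 0" and l: "l \<noteq> 0"
  shows "G (p + l) = G p" and "(\<Sum>u\<in>UNIV. G u *s u) = G p *s l"
proof -
  have ne: "p \<noteq> p + l" using l by simp
  have "(\<Sum>u\<in>UNIV. G u) = (\<Sum>u\<in>{p, p + l}. G u)"
    by (rule sum.mono_neutral_right) (use supp in auto)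
  then have "G p + G (p + l) = 0" using sum ne by simp
  then show G: "G (p + l) = G p" using bit_eq_iff_add by metis
  have "(\<Sum>u\<in>UNIV. G u *s u) = (\<Sum>u\<in>{p, p + l}. G u *s u)"
    by (rule sum.mono_neutral_right) (use supp in auto)
  also have "\<dots> = G p *s p + G p *s (p + l)" using ne G by simp
  also have "\<dots> = G p *s l" by (cases "G p = 0") (simp_all flip: add.assoc)
  finally show "(\<Sum>u\<in>UNIV. G u *s u) = G p *s l" .
qed

lemma mem_face_cell:
  "y \<in> face_cell K e Q \<longleftrightarrow> (\<exists>\<tau> F. \<tau> \<in> K \<and> e \<subseteq> \<tau> \<and> \<tau> \<subseteq> Q \<and> y \<in> convex hull (barycenter ` F) \<and>
     F \<subseteq> K \<and> (\<forall>\<alpha>\<in>F. \<forall>\<beta>\<in>F. \<alpha> \<subseteq> \<beta> \<or> \<beta> \<subseteq> \<alpha>) \<and> (\<forall>\<alpha>\<in>F. e \<subseteq> \<alpha> \<and> \<alpha> \<subseteq> \<tau>))"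
    (is "_ \<longleftrightarrow> ?R")
proof
  assume "y \<in> face_cell K e Q"
  then obtain \<tau> where \<tau>: "\<tau> \<in> {\<tau>\<in>K. e \<subseteq> \<tau> \<and> \<tau> \<subseteq> Q}" "y \<in> cubical_cell K e \<tau>"
    unfolding face_cell_def by (rule UN_E)
  from \<tau>(2) obtain Z where Z: "Z \<in> {convex hull (barycenter ` F) | F.
     F \<subseteq> K \<and> (\<forall>\<alpha>\<in>F. \<forall>\<beta>\<in>F. \<alpha> \<subseteq> \<beta> \<or> \<beta> \<subseteq> \<alpha>) \<and> (\<forall>\<alpha>\<in>F. e \<subseteq> \<alpha> \<and> \<alpha> \<subseteq> \<tau>)}" "y \<in> Z"
    unfolding cubical_cell_def by (rule UnionE)
  from Z(1) obtain F where F: "Z = convex hull (barycenter ` F) \<and>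
     F \<subseteq> K \<and> (\<forall>\<alpha>\<in>F. \<forall>\<beta>\<in>F. \<alpha> \<subseteq> \<beta> \<or> \<beta> \<subseteq> \<alpha>) \<and> (\<forall>\<alpha>\<in>F. e \<subseteq> \<alpha> \<and> \<alpha> \<subseteq> \<tau>)"
    unfolding mem_Collect_eq by (rule exE)
  have "y \<in> convex hull (barycenter ` F)" using F Z(2) by simp
  with F \<tau>(1) show ?R unfolding mem_Collect_eq by (intro exI[of _ \<tau>] exI[of _ F]) simp
next
  assume ?R
  then obtain \<tau> F where *: "\<tau> \<in> K" "e \<subseteq> \<tau>" "\<tau> \<subseteq> Q" "y \<in> convex hull (barycenter ` F)"
     "F \<subseteq> K" "\<forall>\<alpha>\<in>F. \<forall>\<beta>\<in>F. \<alpha> \<subseteq> \<beta> \<or> \<beta> \<subseteq> \<alpha>" "\<forall>\<alpha>\<in>F. e \<subseteq> \<alpha> \<and> \<alpha> \<subseteq> \<tau>"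
    by (elim exE conjE)
  have "y \<in> cubical_cell K e \<tau>"
    unfolding cubical_cell_def
    by (rule UnionI[OF _ *(4)], rule CollectI, rule exI[of _ F]) (intro conjI refl *)
  then show "y \<in> face_cell K e Q"
    unfolding face_cell_def using *(1-3) by (intro UN_I[of \<tau>]) simp_all
qed

locale patchworked = primitively_triangulated P K for P :: "(real ^ 'm) set" and K +
  fixes \<epsilon> :: "real ^ 'm \<Rightarrow> bit"
  assumes smooth: "smooth_polytope P" and dim2: "CARD('m) \<ge> 2"
begin

abbreviation RX :: "((bit ^ 'm) \<times> (real ^ 'm)) set topology" where
  "RX \<equiv> subtopology (real_toric_variety P) (T_hypersurface P K \<epsilon>)"

abbreviation pt :: "bit ^ 'm \<Rightarrow> (real ^ 'm) set \<Rightarrow> ((bit ^ 'm) \<times> (real ^ 'm)) set" where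
  "pt u S \<equiv> toric_class P (u, barycenter (convex hull S))"

lemma K_barycenter: "\<lbrakk>\<alpha> \<in> K; \<alpha> \<noteq> {}\<rbrakk> \<Longrightarrow> barycenter \<alpha> \<in> \<alpha>"
  using barycenter_mem[of "verts \<alpha>"] K_verts(1,3)[of \<alpha>] unfolding barycenter_def by fastforce

lemma edge_verts:
  assumes "v0 \<noteq> v1" "closed_segment v0 v1 \<in> K"
  shows "verts (closed_segment v0 v1) = {v0, v1}" "v0 \<in> lat" "v1 \<in> lat"
proof -
  show v: "verts (closed_segment v0 v1) = {v0, v1}"
    unfolding segment_convex_hull by (rule verts_convex_hull) (simp add: affine_independent_2)
  show "v0 \<in> lat" "v1 \<in> lat" using verts_lat[OF assms(2)] unfolding v by auto
qed

lemma face_cell_segment: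
  assumes e: "e \<in> K" and y: "y \<in> face_cell K e P"
  shows "closed_segment (barycenter e) y \<subseteq> face_cell K e P"
proof -
  obtain \<tau> F where \<tau>: "\<tau> \<in> K" "e \<subseteq> \<tau>" "\<tau> \<subseteq> P" and F: "y \<in> convex hull (barycenter ` F)" "F \<subseteq> K"
      "\<forall>\<alpha>\<in>F. \<forall>\<beta>\<in>F. \<alpha> \<subseteq> \<beta> \<or> \<beta> \<subseteq> \<alpha>" "\<forall>\<alpha>\<in>F. e \<subseteq> \<alpha> \<and> \<alpha> \<subseteq> \<tau>"
    using y by (auto simp only: mem_face_cell)
  let ?F = "insert e F"
  show ?thesis
  proof
    fix x assume x: "x \<in> closed_segment (barycenter e) y"
    have "closed_segment (barycenter e) y \<subseteq> convex hull (barycenter ` ?F)"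
    proof (rule closed_segment_subset[OF _ _ convex_convex_hull])
      show "barycenter e \<in> convex hull (barycenter ` ?F)" by (rule hull_inc) simp
      have "barycenter ` F \<subseteq> barycenter ` ?F" by (rule image_mono) (rule subset_insertI)
      then show "y \<in> convex hull (barycenter ` ?F)" using F(1) hull_mono subsetD by metis
    qed
    then have "x \<in> convex hull (barycenter ` ?F)" using x by (rule subsetD)
    moreover have "?F \<subseteq> K" using e F(2) by simp
    moreover have "\<forall>\<alpha>\<in>?F. \<forall>\<beta>\<in>?F. \<alpha> \<subseteq> \<beta> \<or> \<beta> \<subseteq> \<alpha>" using F(3,4) by simp
    moreover have "\<forall>\<alpha>\<in>?F. e \<subseteq> \<alpha> \<and> \<alpha> \<subseteq> \<tau>" using F(4) \<tau>(2) by simp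
    ultimately show "x \<in> face_cell K e P"
      unfolding mem_face_cell using \<tau> by (intro exI[of _ \<tau>] exI[of _ ?F] conjI)
  qed
qed

lemma barycenter_face_cell:
  assumes "\<alpha> \<in> K" "e \<subseteq> \<alpha>"
  shows "barycenter \<alpha> \<in> face_cell K e P"
  unfolding mem_face_cell
  by (rule exI[of _ \<alpha>], rule exI[of _ "{\<alpha>}"]) (use assms K_subset in simp)

lemma face_cell_subset:
  assumes "e \<noteq> {}"
  shows "face_cell K e P \<subseteq> P"
proof
  fix y assume "y \<in> face_cell K e P"
  then obtain \<tau> F where \<tau>: "\<tau> \<in> K" "\<tau> \<subseteq> P" and F: "y \<in> convex hull (barycenter ` F)" "F \<subseteq> K"
      "\<forall>\<alpha>\<in>F. e \<subseteq> \<alpha> \<and> \<alpha> \<subseteq> \<tau>"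
    by (auto simp only: mem_face_cell)
  have "barycenter ` F \<subseteq> \<tau>"
  proof (rule image_subsetI)
    fix \<alpha> assume \<alpha>: "\<alpha> \<in> F"
    then have \<alpha>': "e \<subseteq> \<alpha>" "\<alpha> \<subseteq> \<tau>" "\<alpha> \<in> K" using F(2,3) by auto
    then have "\<alpha> \<noteq> {}" using assms by auto
    then show "barycenter \<alpha> \<in> \<tau>" using subsetD[OF \<alpha>'(2) K_barycenter[OF \<alpha>'(3)]] by simp
  qed
  moreover have "convex \<tau>" using K_simplex[OF \<tau>(1)] convex_simplex by blast
  ultimately have "convex hull (barycenter ` F) \<subseteq> \<tau>" by (rule hull_minimal)
  then show "y \<in> P" using F(1) \<tau>(2) by (meson subsetD)
qed

lemma continuous_toric_sheet:
  "continuous_map (top_of_set P) (real_toric_variety P) (\<lambda>y. toric_class P (u, y))"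
proof -
  have "continuous_map (top_of_set P) (toric_cover P) (\<lambda>y. (u, y))"
    unfolding toric_cover_def by (intro continuous_map_pairedI) (simp_all add: continuous_map_const)
  then have "continuous_map (top_of_set P) (real_toric_variety P) (toric_class P \<circ> (\<lambda>y. (u, y)))"
    using quotient_imp_continuous_map[OF quotient_map_toric_class] by (rule continuous_map_compose)
  then show ?thesis by (simp add: o_def)
qed

text \<open>The dual cell of the edge is star-shaped with respect to the barycentre of the edge.\<close>

lemma cell_path:
  assumes v: "v0 \<noteq> v1" "closed_segment v0 v1 \<in> K" and cr: "tsign \<epsilon> u v0 \<noteq> tsign \<epsilon> u v1"
    and y: "y \<in> face_cell K (closed_segment v0 v1) P"
  shows "path_component_of RX (toric_class P (u, barycenter (closed_segment v0 v1))) (toric_class P (u, y))"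
proof -
  let ?e = "closed_segment v0 v1"
  let ?l = "\<lambda>t. (1 - t) *\<^sub>R barycenter ?e + t *\<^sub>R y"
  have ene: "?e \<noteq> {}" by simp
  have seg: "?l t \<in> face_cell K ?e P" if "t \<in> {0..1}" for t
    using face_cell_segment[OF v(2) y] that by (auto simp: closed_segment_def)
  have "pair2 (mod2 (v0 - v1)) u + \<epsilon> v0 + \<epsilon> v1 = 1"
  proof -
    have "tsign \<epsilon> u v0 + tsign \<epsilon> u v1 = 1" using cr bit_eq_iff_add by (metis bit_not_zero_iff)
    then show ?thesis using tsign_sum[OF edge_verts(2,3)[OF v], of \<epsilon> u] by (simp add: add.assoc)
  qed
  then have hyp: "toric_class P ` ({u} \<times> face_cell K ?e P) \<subseteq> T_hypersurface P K \<epsilon>"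
    unfolding T_hypersurface_def
    by (intro Union_upper CollectI exI[of _ u] exI[of _ v0] exI[of _ v1] conjI refl v)
  have "continuous_map (top_of_set {0..1}) (top_of_set P) ?l"
    unfolding continuous_map_in_subtopology
  proof
    show "continuous_map (top_of_set {0..1}) euclidean ?l"
      by (simp, intro continuous_intros)
    show "?l \<in> topspace (top_of_set {0..1}) \<rightarrow> P" using seg face_cell_subset[OF ene] by auto
  qed
  then have "continuous_map (top_of_set {0..1}) (real_toric_variety P) ((\<lambda>y. toric_class P (u, y)) \<circ> ?l)"
    using continuous_toric_sheet by (rule continuous_map_compose)
  then have "pathin RX (\<lambda>t. toric_class P (u, ?l t))"
    unfolding pathin_subtopology using seg hyp by (auto simp: pathin_def o_def)
  then show ?thesis unfolding path_component_of_def by (rule exI[of _ "\<lambda>t. toric_class P (u, ?l t)", OF conjI]) simp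
qed

lemma crossing_path:
  assumes T: "T \<in> tops K" and S: "S \<subseteq> T" and cr: "crosses \<epsilon> u S"
  shows "path_component_of RX (pt u S) (pt u T)"
proof -
  obtain x y where xy: "x \<in> S" "y \<in> S" "tsign \<epsilon> u x \<noteq> tsign \<epsilon> u y" using cr by (auto simp: crosses_def)
  have ne: "x \<noteq> y" using xy by auto
  let ?e = "closed_segment x y"
  have e: "?e = convex hull {x, y}" by (rule segment_convex_hull)
  have eK: "?e \<in> K" unfolding e by (rule face_tops_K[OF _ T]) (use xy S in auto)
  have path: "path_component_of RX (toric_class P (u, barycenter ?e)) (pt u R)" if "R \<subseteq> T" "{x, y} \<subseteq> R" for R
  proof (rule cell_path[OF ne eK xy(3)], rule barycenter_face_cell)
    show "convex hull R \<in> K" using that(1) T by (rule face_tops_K)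
    show "?e \<subseteq> convex hull R" unfolding e using that(2) by (rule hull_mono)
  qed
  have "path_component_of RX (toric_class P (u, barycenter ?e)) (pt u S)" using S xy by (intro path) auto
  moreover have "path_component_of RX (toric_class P (u, barycenter ?e)) (pt u T)" using S xy by (intro path) auto
  ultimately show ?thesis by (rule path_component_of_trans[OF path_component_of_sym])
qed

lemma path_to_top:
  assumes z: "z \<in> topspace RX"
  shows "\<exists>u T. T \<in> tops K \<and> crosses \<epsilon> u T \<and> path_component_of RX z (pt u T)"
proof -
  have "z \<in> T_hypersurface P K \<epsilon>" using z by simp
  then obtain Z where Z: "Z \<in> {toric_class P ` ({u} \<times> face_cell K (closed_segment v0 v1) P) | u v0 v1.
      v0 \<noteq> v1 \<and> closed_segment v0 v1 \<in> K \<and> pair2 (mod2 (v0 - v1)) u + \<epsilon> v0 + \<epsilon> v1 = 1}" "z \<in> Z"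
    unfolding T_hypersurface_def by (rule UnionE)
  from Z(1) obtain u v0 v1 where ZZ: "Z = toric_class P ` ({u} \<times> face_cell K (closed_segment v0 v1) P) \<and>
      v0 \<noteq> v1 \<and> closed_segment v0 v1 \<in> K \<and> pair2 (mod2 (v0 - v1)) u + \<epsilon> v0 + \<epsilon> v1 = 1"
    unfolding mem_Collect_eq by (elim exE)
  then have "z \<in> toric_class P ` ({u} \<times> face_cell K (closed_segment v0 v1) P)" using Z(2) by simp
  then obtain y where v: "v0 \<noteq> v1" "closed_segment v0 v1 \<in> K"
      and cr: "pair2 (mod2 (v0 - v1)) u + \<epsilon> v0 + \<epsilon> v1 = 1"
      and y: "y \<in> face_cell K (closed_segment v0 v1) P" "z = toric_class P (u, y)"
    using ZZ by auto
  have cr': "tsign \<epsilon> u v0 \<noteq> tsign \<epsilon> u v1"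
    using tsign_sum[OF edge_verts(2,3)[OF v], of \<epsilon> u] cr by (auto simp: add.assoc)
  obtain T where T: "T \<in> tops K" "{v0, v1} \<subseteq> T"
    using K_subset_tops[OF v(2)] edge_verts(1)[OF v] by auto
  have "crosses \<epsilon> u T" using T(2) cr' by (auto simp: crosses_def)
  moreover have "path_component_of RX (toric_class P (u, barycenter (closed_segment v0 v1))) (pt u T)"
  proof (rule cell_path[OF v cr'], rule barycenter_face_cell[OF tops_K[OF T(1)]])
    show "closed_segment v0 v1 \<subseteq> convex hull T" unfolding segment_convex_hull using T(2) by (rule hull_mono)
  qed
  then have "path_component_of RX z (pt u T)"
    unfolding y(2) by (rule path_component_of_trans[OF path_component_of_sym[OF cell_path[OF v cr' y(1)]]])
  ultimately show ?thesis using T(1) by blast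
qed

definition loc_const :: "(((bit ^ 'm) \<times> (real ^ 'm)) set \<Rightarrow> bit) \<Rightarrow> bool" where
  "loc_const f \<longleftrightarrow> (\<forall>x y. path_component_of RX x y \<longrightarrow> f x = f y)"

text \<open>This is the function \<open>F\<^sub>T\<close> of the opening comment. The value in the sheet that does not meet the
  hypersurface makes the sum over all \<open>u\<close> vanish; in other words, \<open>F\<^sub>T\<close> as a polynomial on \<open>N\<^sub>2\<close> has
  degree less than the dimension of \<open>N\<^sub>2\<close>.\<close>

definition sheet_value :: "(((bit ^ 'm) \<times> (real ^ 'm)) set \<Rightarrow> bit) \<Rightarrow> (real ^ 'm) set \<Rightarrow> bit ^ 'm \<Rightarrow> bit" where
  "sheet_value f T u = (if crosses \<epsilon> u T then f (pt u T) else \<Sum>u'\<in>{u'. crosses \<epsilon> u' T}. f (pt u' T))"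

definition weight :: "(((bit ^ 'm) \<times> (real ^ 'm)) set \<Rightarrow> bit) \<Rightarrow> (real ^ 'm) set \<Rightarrow> bit ^ 'm" where
  "weight f T = (if T \<in> tops K then \<Sum>u\<in>UNIV. sheet_value f T u *s u else 0)"

definition uncrossed_sheet :: "(real ^ 'm) set \<Rightarrow> bit ^ 'm" where
  "uncrossed_sheet T = (THE u. \<not> crosses \<epsilon> u T)"

lemma not_crosses_top_iff:
  assumes T: "T \<in> tops K"
  shows "\<not> crosses \<epsilon> u T \<longleftrightarrow> u = uncrossed_sheet T"
proof -
  have ex1: "\<exists>!u. \<not> crosses \<epsilon> u T"
    by (rule not_crosses_ex1[OF tops_frame[OF T] tops_finite[OF T] tops_card[OF T] tops_lat[OF T]])
  show ?thesis using theI'[OF ex1] ex1 unfolding uncrossed_sheet_def by metis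
qed

lemma not_crosses_ridge_iff:
  assumes T: "T \<in> tops K" and v: "v \<in> T"
  shows "\<not> crosses \<epsilon> u (T - {v}) \<longleftrightarrow> u = uncrossed_sheet T \<or> u = uncrossed_sheet T + mod2 (frame T v)"
  using not_crosses_ridge[OF tops_frame[OF T] tops_finite[OF T] tops_card[OF T] tops_lat[OF T] v]
    not_crosses_top_iff[OF T] by blast

lemma sheet_value_sum:
  assumes T: "T \<in> tops K"
  shows "(\<Sum>u\<in>UNIV. sheet_value f T u) = 0"
proof -
  have UNIV: "UNIV = insert (uncrossed_sheet T) {u. crosses \<epsilon> u T}" using not_crosses_top_iff[OF T] by auto
  have nf: "\<not> crosses \<epsilon> (uncrossed_sheet T) T" using not_crosses_top_iff[OF T] by blast
  have "(\<Sum>u\<in>UNIV. sheet_value f T u) = sheet_value f T (uncrossed_sheet T) + (\<Sum>u\<in>{u. crosses \<epsilon> u T}. sheet_value f T u)"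
    by (subst UNIV, rule sum.insert) (use nf in auto)
  also have "(\<Sum>u\<in>{u. crosses \<epsilon> u T}. sheet_value f T u) = (\<Sum>u\<in>{u. crosses \<epsilon> u T}. f (pt u T))"
    by (rule sum.cong) (auto simp: sheet_value_def)
  finally show ?thesis using nf by (simp add: sheet_value_def)
qed

lemma sheet_value_add: "sheet_value (f + g) T u = sheet_value f T u + sheet_value g T u"
  by (simp add: sheet_value_def sum.distrib)

lemma weight_add: "weight (f + g) T = weight f T + weight g T"
  by (simp add: weight_def sheet_value_add vector_sadd_rdistrib sum.distrib)

lemma sheet_value_face:
  assumes f: "loc_const f" and T: "T \<in> tops K" and S: "S \<subseteq> T" and cr: "crosses \<epsilon> u S"
  shows "sheet_value f T u = f (pt u S)"
  using crossing_path[OF T S cr] f crosses_mono[OF cr S] by (simp add: sheet_value_def loc_const_def)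

lemma frame_mod2_nonzero:
  assumes T: "T \<in> tops K" and v: "v \<in> T"
  shows "mod2 (frame T v) \<noteq> 0"
proof -
  have "card (T - {v}) \<noteq> 0" using tops_card[OF T] tops_finite[OF T] v by simp
  then obtain x where x: "x \<in> T - {v}" by (metis card.empty ex_in_conv)
  then show ?thesis
    using mod2_dual_frame_nonzero[OF tops_frame[OF T] tops_lat[OF T] v, of x] by auto
qed

text \<open>In a sheet that crosses the ridge both values are that of \<open>f\<close> at the barycentre of the ridge. So
  the difference is supported on the two other sheets.\<close>

lemma sheet_value_jump:
  assumes f: "loc_const f" and S: "S \<in> ridges K"
    and T: "insert a S \<in> tops K" "a \<notin> S" and T': "insert b S \<in> tops K" "b \<notin> S"
  obtains c where "\<And>u. sheet_value f (insert a S) u + sheet_value f (insert b S) u = (if crosses \<epsilon> u S then 0 else c)"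
    "weight f (insert a S) + weight f (insert b S) = c *s mod2 (frame (insert a S) a)"
proof -
  let ?T = "insert a S" and ?T' = "insert b S"
  let ?G = "\<lambda>u. sheet_value f ?T u + sheet_value f ?T' u" and ?l = "mod2 (frame (insert a S) a)" and ?p = "uncrossed_sheet (insert a S)"
  have iff: "\<not> crosses \<epsilon> u S \<longleftrightarrow> u = ?p \<or> u = ?p + ?l" for u
    using not_crosses_ridge_iff[OF T(1), of a u] T(2) by simp
  have supp: "?G u = 0" if "u \<noteq> ?p" "u \<noteq> ?p + ?l" for u
  proof -
    have "crosses \<epsilon> u S" using that iff by blast
    then have "sheet_value f ?T u = f (pt u S)" "sheet_value f ?T' u = f (pt u S)"
      using sheet_value_face[OF f T(1)] sheet_value_face[OF f T'(1)] by auto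
    then show ?thesis by simp
  qed
  have sum: "(\<Sum>u\<in>UNIV. ?G u) = 0" using sheet_value_sum[OF T(1)] sheet_value_sum[OF T'(1)] by (simp add: sum.distrib)
  have l: "?l \<noteq> 0" using frame_mod2_nonzero[OF T(1)] by simp
  note G = pair_supported[of ?p ?l ?G, OF supp sum l]
  have "?G u = (if crosses \<epsilon> u S then 0 else ?G ?p)" for u
  proof (cases "crosses \<epsilon> u S")
    case True
    then show ?thesis using supp[of u] iff by auto
  next
    case False
    then consider "u = ?p" | "u = ?p + ?l" using iff by blast
    then show ?thesis by cases (use False G(1) in auto)
  qed
  moreover have "weight f ?T + weight f ?T' = ?G ?p *s ?l"
    using G(2) T T' by (simp add: weight_def vector_sadd_rdistrib sum.distrib)
  ultimately show thesis by (rule that)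
qed

text \<open>In the sheets that cross the ridge this is the identification of the sheets over \<open>Q\<close>. If \<open>F\<^sub>T\<close> had
  different values in the other two sheets, the first moment of \<open>F\<^sub>T(u) + F\<^sub>T(u + l)\<close> would be \<open>l\<close>; but it
  is \<open>l\<close> times the sum of \<open>F\<^sub>T\<close>, which vanishes.\<close>

lemma sheet_value_boundary_invariant:
  assumes f: "loc_const f" and Q: "Q facet_of P" and S: "S \<in> ridges K" and SQ: "convex hull S \<subseteq> Q"
    and T: "insert a S \<in> tops K" "a \<notin> S" and l: "l \<in> Sed Q"
  shows "sheet_value f (insert a S) (u + l) = sheet_value f (insert a S) u"
proof (cases "l = 0")
  case False
  let ?T = "insert a S"
  let ?G = "\<lambda>u. sheet_value f ?T u + sheet_value f ?T (u + l)" and ?p = "uncrossed_sheet ?T"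
  have perp: "pair2 (mod2 (x - y)) l = 0" if "x \<in> S" "y \<in> S" for x y
    using perp2_pair2[OF l, of x y] that ridgeD(3)[OF S] SQ hull_inc[of _ S convex] by blast
  have cr: "crosses \<epsilon> (u + l) S \<longleftrightarrow> crosses \<epsilon> u S" for u
  proof -
    have "\<not> crosses \<epsilon> (w + l) S" if "\<not> crosses \<epsilon> w S" for w
      using not_crosses_translate[OF that ridgeD(3)[OF S], of l] perp by blast
    from this[of u] this[of "u + l"] show ?thesis by (auto simp: add.assoc)
  qed
  have p: "\<not> crosses \<epsilon> ?p S" using not_crosses_ridge_iff[OF T(1), of a ?p] T(2) by simp
  have "?p + l = ?p \<or> ?p + l = ?p + mod2 (frame ?T a)"
    using not_crosses_ridge_iff[OF T(1), of a "?p + l"] T(2) p cr by simp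
  then have lg: "l = mod2 (frame ?T a)" using False by simp
  have iff: "\<not> crosses \<epsilon> u S \<longleftrightarrow> u = ?p \<or> u = ?p + l" for u
    using not_crosses_ridge_iff[OF T(1), of a u] T(2) lg by simp
  have supp: "?G u = 0" if "u \<noteq> ?p" "u \<noteq> ?p + l" for u
  proof -
    have c: "crosses \<epsilon> u S" using that iff by blast
    have "barycenter (convex hull S) \<in> Q"
      using K_barycenter[OF ridgeD(5)[OF S]] ridgeD(4)[OF S] SQ by auto
    then have "pt (u + l) S = pt u S" by (rule toric_class_translate[OF l facet_of_imp_face_of[OF Q]])
    moreover have "sheet_value f ?T u = f (pt u S)"
      by (rule sheet_value_face[OF f T(1) subset_insertI c])
    moreover have "sheet_value f ?T (u + l) = f (pt (u + l) S)"
      by (rule sheet_value_face[OF f T(1) subset_insertI]) (use c cr in blast)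
    ultimately have "sheet_value f ?T (u + l) = sheet_value f ?T u" by (simp only:)
    then show ?thesis by simp
  qed
  have s0: "(\<Sum>u\<in>UNIV. sheet_value f ?T u) = 0" by (rule sheet_value_sum[OF T(1)])
  then have sum: "(\<Sum>u\<in>UNIV. ?G u) = 0" using sum_translate_bitvec[of "sheet_value f ?T" l] by (simp add: sum.distrib)
  have "(\<Sum>u\<in>UNIV. sheet_value f ?T (u + l) *s u) = (\<Sum>u\<in>UNIV. sheet_value f ?T u *s (u + l))"
    using sum_translate_bitvec[of "\<lambda>u. sheet_value f ?T u *s (u + l)" l] by (simp add: add.assoc)
  also have "\<dots> = (\<Sum>u\<in>UNIV. sheet_value f ?T u *s u) + (\<Sum>u\<in>UNIV. sheet_value f ?T u) *s l"
    by (simp add: vector_add_ldistrib sum.distrib) (simp add: vec_eq_iff sum_distrib_right)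
  finally have "(\<Sum>u\<in>UNIV. ?G u *s u) = 0"
    using s0 by (simp add: vector_sadd_rdistrib sum.distrib)
  then have "?G ?p *s l = 0" using pair_supported(2)[of ?p l ?G, OF supp sum False] by simp
  then have Gp: "?G ?p = 0" unfolding vector_mul_eq_0 using False by blast
  have Gpl: "?G (?p + l) = 0"
    by (rule trans[OF pair_supported(1)[of ?p l ?G, OF supp sum False] Gp])
  have "?G u = 0"
  proof (cases "u = ?p \<or> u = ?p + l")
    case True
    then show ?thesis using Gp Gpl by blast
  next
    case False
    then show ?thesis by (intro supp) auto
  qed
  then show ?thesis by (rule bit_eq_iff_add[THEN iffD2, symmetric])
qed simp

text \<open>Over an interior ridge the sum of the moments is a multiple of the vector orthogonal to the ridge.
  Over a ridge in the boundary each moment is orthogonal to the ridge, because its summands cancel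
  in pairs.\<close>

lemma weight_balanced:
  assumes f: "loc_const f"
  shows "weight f \<in> balanced_weights K"
  unfolding balanced_weights_def
proof (intro CollectI conjI allI impI ballI)
  show "weight f T = 0" if "T \<notin> tops K" for T using that by (simp add: weight_def)
  fix S x y assume S: "S \<in> ridges K" and xy: "x \<in> S" "y \<in> S"
  let ?C = "{T \<in> tops K. S \<subseteq> T}"
  have perp: "pair2 (mod2 (x - y)) (mod2 (frame (insert a S) a)) = 0" if "insert a S \<in> tops K" "a \<notin> S" for a
  proof -
    have "x \<noteq> a" "y \<noteq> a" using xy that(2) by auto
    then show ?thesis
      using pair2_dual_frame[OF tops_frame[OF that(1)] tops_lat[OF that(1)], of a x y] xy by simp
  qed
  show "pair2 (mod2 (x - y)) (\<Sum>T\<in>?C. weight f T) = 0"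
  proof (cases "convex hull S \<subseteq> frontier P")
    case False
    obtain a b where ab: "a \<noteq> b" "a \<notin> S" "b \<notin> S" "?C = {insert a S, insert b S}"
      using interior_ridge_two_tops[OF S False] by blast
    have "insert a S \<in> ?C" "insert b S \<in> ?C" unfolding ab(4) by blast+
    then have top: "insert a S \<in> tops K" "insert b S \<in> tops K" by blast+
    obtain c where c: "weight f (insert a S) + weight f (insert b S) = c *s mod2 (frame (insert a S) a)"
      using sheet_value_jump[OF f S top(1) ab(2) top(2) ab(3)] by blast
    have "insert a S \<noteq> insert b S" using ab by auto
    then have "(\<Sum>T\<in>?C. weight f T) = c *s mod2 (frame (insert a S) a)" unfolding ab(4) using c by simp
    then show ?thesis using perp[OF top(1) ab(2)] by (simp add: pair2_scale_right)
  next
    case True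
    then obtain Q where Q: "Q facet_of P" "convex hull S \<subseteq> Q" using boundary_ridge_facet[OF S] by blast
    have "pair2 (mod2 (x - y)) (weight f T) = 0" if T: "T \<in> ?C" for T
    proof -
      have "T \<in> tops K" "S \<subseteq> T" using T by auto
      then obtain a where a: "a \<notin> S" "T = insert a S" using ridge_apex[OF S] by metis
      have top: "insert a S \<in> tops K" using T a by simp
      let ?l = "mod2 (frame (insert a S) a)"
      have l: "?l \<in> Sed Q" by (rule facet_frame_in_Sed[OF Q(1) S Q(2) top a(1)])
      have "pair2 (mod2 (x - y)) (weight f T) = (\<Sum>u\<in>UNIV. sheet_value f T u * pair2 (mod2 (x - y)) u)"
        using T by (simp add: weight_def pair2_sum_right pair2_scale_right)
      also have "\<dots> = 0"
      proof (rule sum_invariant_zero[where l = ?l])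
        show "?l \<noteq> 0" using frame_mod2_nonzero[OF top] by simp
        show "sheet_value f T (u + ?l) * pair2 (mod2 (x - y)) (u + ?l) = sheet_value f T u * pair2 (mod2 (x - y)) u" for u
          using sheet_value_boundary_invariant[OF f Q(1) S Q(2) top a(1) l, of u] perp[OF top a(1)]
          by (simp add: a(2) pair2_add_right)
      qed
      finally show ?thesis .
    qed
    then show ?thesis by (simp only: pair2_sum_right) (rule sum.neutral, blast)
  qed
qed

text \<open>If all first moments vanish, the functions \<open>F\<^sub>T\<close> agree for all \<open>T\<close>, and the invariance under the
  groups of the facets at a vertex of \<open>P\<close>, which generate \<open>N\<^sub>2\<close>, leaves constants only.\<close>

lemma weight_zero_constant:
  assumes f: "loc_const f" and w: "\<And>T. weight f T = 0" and z: "z \<in> topspace RX" "z' \<in> topspace RX"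
  shows "f z = f z'"
proof -
  have neighbours: "sheet_value f T = sheet_value f T'" if S: "S \<in> ridges K" "S \<subseteq> T" "S \<subseteq> T'" and T: "T \<in> tops K" "T' \<in> tops K" for S T T'
  proof -
    obtain a where a: "a \<notin> S" "T = insert a S" using ridge_apex[OF S(1) T(1) S(2)] by metis
    obtain b where b: "b \<notin> S" "T' = insert b S" using ridge_apex[OF S(1) T(2) S(3)] by metis
    have T0: "insert a S \<in> tops K" "insert b S \<in> tops K" using T a b by auto
    obtain c where c: "\<And>u. sheet_value f (insert a S) u + sheet_value f (insert b S) u = (if crosses \<epsilon> u S then 0 else c)"
      "weight f (insert a S) + weight f (insert b S) = c *s mod2 (frame (insert a S) a)"
      using sheet_value_jump[OF f S(1) T0(1) a(1) T0(2) b(1)] by blast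
    have "c *s mod2 (frame (insert a S) a) = 0" using c(2) w by simp
    then have "c = 0" using frame_mod2_nonzero[OF T0(1), of a] by (cases "c = 0") auto
    then have "sheet_value f T u + sheet_value f T' u = 0" for u using c(1)[of u] a b by simp
    then have "sheet_value f T u = sheet_value f T' u" for u using bit_eq_iff_add by metis
    then show ?thesis by blast
  qed
  obtain u T where T: "T \<in> tops K" "crosses \<epsilon> u T" "path_component_of RX z (pt u T)"
    using path_to_top[OF z(1)] by blast
  have "{T' \<in> tops K. sheet_value f T' = sheet_value f T} = tops K"
  proof (rule tops_strongly_connected)
    show "{T' \<in> tops K. sheet_value f T' = sheet_value f T} \<noteq> {}" using T(1) by blast
    fix S T1 T2
    assume "S \<in> ridges K" "T1 \<in> {T' \<in> tops K. sheet_value f T' = sheet_value f T}" "T2 \<in> tops K" "S \<subseteq> T1" "S \<subseteq> T2"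
    then show "T2 \<in> {T' \<in> tops K. sheet_value f T' = sheet_value f T}" using neighbours[of S T1 T2] by auto
  qed blast
  then have all: "sheet_value f T' = sheet_value f T" if "T' \<in> tops K" for T' using that by blast
  have "{u'. sheet_value f T u' = sheet_value f T u} = UNIV"
  proof (rule smooth_polytope_Sed_generate[OF smooth dim2])
    show "u \<in> {u'. sheet_value f T u' = sheet_value f T u}" by simp
    fix Q l w assume Q: "Q facet_of P" and l: "l \<in> Sed Q" and w: "w \<in> {u'. sheet_value f T u' = sheet_value f T u}"
    obtain S where S: "S \<in> ridges K" "convex hull S \<subseteq> Q" using facet_contains_ridge[OF Q] by blast
    obtain T' where T': "T' \<in> tops K" "S \<subseteq> T'" using S(1) by (auto simp: ridges_def)
    obtain a where a: "a \<notin> S" "T' = insert a S" using ridge_apex[OF S(1) T'] by metis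
    have "sheet_value f (insert a S) (w + l) = sheet_value f (insert a S) w"
      using sheet_value_boundary_invariant[OF f Q S _ a(1) l] T' a(2) by simp
    then show "w + l \<in> {u'. sheet_value f T u' = sheet_value f T u}" using all[OF T'(1)] a(2) w by simp
  qed
  then have const: "sheet_value f T' u' = sheet_value f T u" if "T' \<in> tops K" for T' u' using all[OF that] by auto
  have "f y = sheet_value f T u" if y: "y \<in> topspace RX" for y
  proof -
    obtain u' T' where T': "T' \<in> tops K" "crosses \<epsilon> u' T'" "path_component_of RX y (pt u' T')"
      using path_to_top[OF y] by blast
    then have "f y = f (pt u' T')" using f by (simp add: loc_const_def)
    also have "\<dots> = sheet_value f T' u'" using T'(2) by (simp add: sheet_value_def)
    finally show ?thesis using const[OF T'(1)] by simp
  qed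
  then show ?thesis using z by simp
qed

end

section \<open>The obstruction at non-uniform simplices\<close>

lemma pair2_ext: "(\<And>u. pair2 x u = pair2 y u) \<Longrightarrow> x = y"
proof -
  assume eq: "\<And>u. pair2 x u = pair2 y u"
  have "pair2 x (axis i 1) = x $ i" for x :: "bit ^ 'm" and i
    using pair2_axis[of i x] by (simp add: pair2_def mult.commute)
  then show ?thesis using eq by (metis vec_eq_iff)
qed

lemma dual_frame_expand2_primal:
  fixes T :: "(real ^ 'm) set"
  assumes g: "dual_frame T g" and fin: "finite T" and card: "card T = Suc CARD('m)" and v0: "v0 \<in> T"
    and T: "T \<subseteq> lat"
  shows "x = (\<Sum>v\<in>T - {v0}. pair2 x (mod2 (g v)) *s mod2 (v - v0))"
proof (rule pair2_ext)
  fix u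
  have "pair2 x u = pair2 x (\<Sum>v\<in>T - {v0}. pair2 (mod2 (v - v0)) u *s mod2 (g v))"
    by (rule arg_cong[OF dual_frame_expand2[OF assms]])
  also have "\<dots> = pair2 (\<Sum>v\<in>T - {v0}. pair2 x (mod2 (g v)) *s mod2 (v - v0)) u"
    by (simp only: pair2_sum_right pair2_sum_left pair2_scale_left pair2_scale_right mult.commute)
  finally show "pair2 x u = pair2 (\<Sum>v\<in>T - {v0}. pair2 x (mod2 (g v)) *s mod2 (v - v0)) u" .
qed

lemma dual_frame_sum2:
  fixes T :: "(real ^ 'm) set"
  assumes g: "dual_frame T g" and fin: "finite T" and card: "card T = Suc CARD('m)" and T: "T \<subseteq> lat"
  shows "(\<Sum>v\<in>T. mod2 (g v)) = 0"
proof -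
  obtain v0 where v0: "v0 \<in> T" using card by fastforce
  have "pair2 (mod2 (x - v0)) (\<Sum>v\<in>T. mod2 (g v)) = 0" if x: "x \<in> T" for x
  proof -
    have "pair2 (mod2 (x - v0)) (\<Sum>v\<in>T. mod2 (g v)) = (\<Sum>v\<in>T. (if v = x then 1 else 0) + (if v = v0 then 1 else 0))"
      unfolding pair2_sum_right
      by (rule sum.cong[OF refl]) (use pair2_dual_frame[OF g T _ x v0] in auto)
    also have "\<dots> = (\<Sum>v\<in>T. if v = x then 1 else 0) + (\<Sum>v\<in>T. if v = v0 then 1 else 0)"
      by (rule sum.distrib)
    also have "\<dots> = (1 :: bit) + 1" using x v0 fin by (simp only: sum.delta if_True)
    finally show ?thesis by simp
  qed
  then have "(\<Sum>v\<in>T - {v0}. pair2 (mod2 (v - v0)) (\<Sum>v\<in>T. mod2 (g v)) *s mod2 (g v)) = 0"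
    by (intro sum.neutral) simp
  then show ?thesis using dual_frame_expand2[OF g fin card v0 T, of "\<Sum>v\<in>T. mod2 (g v)"] by simp
qed

context primitively_triangulated begin

lemma interior_vertex_not_frontier:
  assumes "v \<in> S" "v \<in> interior P"
  shows "\<not> convex hull S \<subseteq> frontier P"
  using hull_inc[of v S convex] assms frontier_P by auto

lemma apices_ridge:
  assumes S: "S \<in> ridges K" and ab: "a \<notin> S" "b \<notin> S" and C: "{T \<in> tops K. S \<subseteq> T} = {insert a S, insert b S}"
  shows "apices K (convex hull S) = {a, b}"
proof
  have top: "insert a S \<in> tops K" "insert b S \<in> tops K" using C by blast+
  show "apices K (convex hull S) \<subseteq> {a, b}"
  proof
    fix v assume "v \<in> apices K (convex hull S)"
    then obtain \<tau> where \<tau>: "\<tau> \<in> K" "aff_dim \<tau> = aff_dim (convex hull S) + 1" "convex hull S \<subseteq> \<tau>"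
        "v \<in> verts \<tau>" "v \<notin> convex hull S"
      unfolding apices_def by blast
    have t: "verts \<tau> \<in> tops K" using \<tau>(1,2) ridgeD(7)[OF S] by (auto simp: tops_def)
    have "S \<subseteq> verts \<tau>"
      using subset_convex_hull_tops[OF subset_insertI top(1) t] \<tau>(3) K_verts(1)[OF \<tau>(1)] by simp
    then have "verts \<tau> = insert a S \<or> verts \<tau> = insert b S" using t C by blast
    moreover have "v \<notin> S" using \<tau>(5) hull_inc[of v S convex] by blast
    ultimately show "v \<in> {a, b}" using \<tau>(4) by blast
  qed
  have "c \<in> apices K (convex hull S)" if c: "c \<notin> S" "insert c S \<in> tops K" for c
  proof -
    let ?T = "insert c S"
    have "c \<notin> convex hull S"
    proof
      assume "c \<in> convex hull S"
      then have "coord ?T c c = 0" using mem_face_tops[OF c(2) subset_insertI, of c] c(1) by simp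
      then show False using bary_coord_vertex[OF tops_frame[OF c(2)], of c c] by simp
    qed
    moreover have "aff_dim (convex hull ?T) = aff_dim (convex hull S) + 1"
      using ridgeD(7)[OF S] tops_indep[OF c(2)] tops_card[OF c(2)]
      by (simp add: aff_dim_convex_hull affine_independent_iff_card)
    moreover have "c \<in> verts (convex hull ?T)" using verts_face_tops[OF order_refl c(2)] by simp
    ultimately show ?thesis
      unfolding apices_def using tops_K[OF c(2)] hull_mono[OF subset_insertI[of S c], of convex] by blast
  qed
  then show "{a, b} \<subseteq> apices K (convex hull S)" using ab top by blast
qed

text \<open>The lattice heights of the two apices over the ridge are units, so \<open>a - b\<close> has even height. This
  is why \<open>v\<^sub>1 - v\<^sub>2\<close> is a combination of the vertices of the ridge modulo two.\<close>

lemma opposite_apex: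
  assumes S: "S \<in> ridges K" and T: "insert a S \<in> tops K" "a \<notin> S" and T': "insert b S \<in> tops K" "b \<notin> S"
  shows "pair2 (mod2 (a - b)) (mod2 (frame (insert b S) b)) = 0"
proof -
  obtain s where s: "s \<in> S" using ridgeD(4)[OF S] by blast
  let ?g = "frame (insert a S) a" and ?h = "frame (insert b S) b"
  have lat: "a \<in> lat" "b \<in> lat" "s \<in> lat" using tops_lat[OF T(1)] tops_lat[OF T'(1)] s by auto
  have g: "?g \<in> lat" and h: "?h \<in> lat"
    using dual_frame_lat[OF tops_frame[OF T(1)]] dual_frame_lat[OF tops_frame[OF T'(1)]] by auto
  have "s \<noteq> a" using s T(2) by auto
  then have "?g \<bullet> (a - s) = 1" using dual_frame_inner[OF tops_frame[OF T(1)], of a a s] s by simp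
  then have "1 = (?g \<bullet> (b - s)) * (?h \<bullet> (a - s))" using frame_proportional[OF S T T' s, of "a - s"] by simp
  moreover have "?g \<bullet> (b - s) \<in> \<int>" "?h \<bullet> (a - s) \<in> \<int>" using g h lat by (auto intro!: lat_inner lat_diff)
  ultimately have "bit_of (?g \<bullet> (b - s)) * bit_of (?h \<bullet> (a - s)) = 1" using bit_of_mult bit_of_simps(2) by metis
  then have "bit_of (?h \<bullet> (a - s)) = 1" by (cases "bit_of (?h \<bullet> (a - s)) = 0") auto
  then have 1: "pair2 (mod2 (a - s)) (mod2 ?h) = 1"
    using pair2_mod2[of "a - s" ?h] lat h by (simp add: lat_diff inner_commute)
  have "s \<noteq> b" using s T'(2) by auto
  then have 2: "pair2 (mod2 (s - b)) (mod2 ?h) = 1"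
    using pair2_dual_frame[OF tops_frame[OF T'(1)] tops_lat[OF T'(1)], of b s b] s by simp
  have "a - b = (a - s) + (s - b)" by simp
  then have "mod2 (a - b) = mod2 (a - s) + mod2 (s - b)" using lat by (metis lat_diff mod2_add)
  then show ?thesis using 1 2 by (simp add: pair2_add_left)
qed

text \<open>The barycentric coordinates of \<open>a - b\<close> in the simplex with apex \<open>b\<close> satisfy the conditions that
  define \<open>\<rho>\<close>; pairing with the dual frame shows that nothing else does.\<close>

lemma rho_eq:
  assumes S: "S \<in> ridges K" and ab: "a \<noteq> b" "a \<notin> S" "b \<notin> S"
    and C: "{T \<in> tops K. S \<subseteq> T} = {insert a S, insert b S}" and v: "v \<in> S"
  shows "rho K (convex hull S) v = pair2 (mod2 (a - b)) (mod2 (frame (insert b S) v))"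
proof -
  have top: "insert a S \<in> tops K" "insert b S \<in> tops K" using C by blast+
  let ?T = "insert b S" and ?g = "frame (insert b S)" and ?x = "mod2 (a - b)"
  note F = tops_frame[OF top(2)] tops_finite[OF top(2)] tops_card[OF top(2)]
  note lat = tops_lat[OF top(2)]
  have abl: "a \<in> lat" "b \<in> lat" using tops_lat[OF top(1)] lat by auto
  have finS: "finite S" by (rule ridgeD(2)[OF S])
  have TS: "?T - {b} = S" using ab(3) by auto
  define r where "r w = (if w \<in> S then pair2 ?x (mod2 (?g w)) else 0)" for w
  have "(\<Sum>w\<in>?T. pair2 ?x (mod2 (?g w))) = 0"
    using dual_frame_sum2[OF F lat] by (simp only: pair2_sum_right[symmetric] pair2_zero_right)
  then have "pair2 ?x (mod2 (?g b)) + (\<Sum>w\<in>S. pair2 ?x (mod2 (?g w))) = 0"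
    by (simp only: sum.insert[OF finS ab(3)])
  then have rsum0: "(\<Sum>w\<in>S. pair2 ?x (mod2 (?g w))) = 0"
    using opposite_apex[OF S top(1) ab(2) top(2) ab(3)] by (simp only: add_0)
  have rsum: "(\<Sum>w\<in>S. r w) = 0" using rsum0 by (simp add: r_def)
  have "?x = (\<Sum>w\<in>S. r w *s mod2 w)"
  proof -
    have "?x = (\<Sum>w\<in>?T - {b}. pair2 ?x (mod2 (?g w)) *s mod2 (w - b))"
      by (rule dual_frame_expand2_primal[OF F _ lat]) simp
    also have "\<dots> = (\<Sum>w\<in>S. r w *s mod2 w + r w *s mod2 b)"
      unfolding TS
    proof (rule sum.cong[OF refl])
      fix w assume w: "w \<in> S"
      then have "mod2 (w - b) = mod2 w + mod2 b"
        using lat by (auto simp: mod2_diff bitvec_diff_eq_add)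
      then show "pair2 ?x (mod2 (?g w)) *s mod2 (w - b) = r w *s mod2 w + r w *s mod2 b"
        using w by (simp add: r_def vector_add_ldistrib)
    qed
    also have "\<dots> = (\<Sum>w\<in>S. r w *s mod2 w) + (\<Sum>w\<in>S. r w) *s mod2 b"
      unfolding sum.distrib by (simp add: vec_eq_iff sum_distrib_right)
    finally show ?thesis unfolding rsum by simp
  qed
  then have rx: "(\<Sum>w\<in>S. r w *s mod2 w) = ?x" by (rule sym)
  have uniq: "r' = r" if r': "\<forall>w. w \<notin> S \<longrightarrow> r' w = 0" "(\<Sum>w\<in>S. r' w) = 0" "(\<Sum>w\<in>S. r' w *s mod2 w) = ?x" for r'
  proof
    fix w show "r' w = r w"
    proof (cases "w \<in> S")
      case w: True
      let ?gw = "mod2 (?g w)"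
      have "pair2 ?x ?gw = (\<Sum>z\<in>S. r' z * pair2 (mod2 z) ?gw)"
        unfolding r'(3)[symmetric] pair2_sum_left pair2_scale_left ..
      also have "\<dots> = (\<Sum>z\<in>S. (if z = w then r' w else 0) + r' z * pair2 (mod2 b) ?gw)"
      proof (rule sum.cong[OF refl])
        fix z assume z: "z \<in> S"
        have "b \<noteq> w" using w ab(3) by auto
        then have "pair2 (mod2 (z - b)) ?gw = of_bool (z = w)"
          using pair2_dual_frame[OF F(1) lat, of w z b] w z by simp
        moreover have "mod2 (z - b) = mod2 z + mod2 b"
          using z lat by (auto simp: mod2_diff bitvec_diff_eq_add)
        ultimately have "pair2 (mod2 z) ?gw + pair2 (mod2 b) ?gw = of_bool (z = w)"
          by (simp only: pair2_add_left)
        moreover have "p + q = r \<Longrightarrow> p = r + q" for p q r :: bit by (cases q) auto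
        ultimately have "pair2 (mod2 z) ?gw = of_bool (z = w) + pair2 (mod2 b) ?gw" by blast
        then show "r' z * pair2 (mod2 z) ?gw = (if z = w then r' w else 0) + r' z * pair2 (mod2 b) ?gw"
          by (simp add: distrib_left)
      qed
      also have "\<dots> = (\<Sum>z\<in>S. if z = w then r' w else 0) + (\<Sum>z\<in>S. r' z) * pair2 (mod2 b) ?gw"
        by (simp only: sum.distrib sum_distrib_right)
      also have "\<dots> = r' w" unfolding r'(2) using w finS by (simp add: sum.delta)
      finally show ?thesis using w by (simp add: r_def)
    qed (use r'(1) in \<open>simp add: r_def\<close>)
  qed
  have swap: "mod2 (b - a) = ?x" using abl by (simp add: mod2_diff bitvec_diff_eq_add add.commute)
  have ap: "apices K (convex hull S) = {a, b}" by (rule apices_ridge[OF S ab(2,3) C])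
  have vS: "verts (convex hull S) = S" by (rule ridgeD(6)[OF S])
  have "rho K (convex hull S) = r"
    unfolding rho_def vS ap
  proof (rule the_equality)
    show "(\<forall>w. w \<notin> S \<longrightarrow> r w = 0) \<and> (\<Sum>w\<in>S. r w) = 0 \<and>
      (\<exists>v1 v2. v1 \<noteq> v2 \<and> {a, b} = {v1, v2} \<and> (\<Sum>w\<in>S. r w *s mod2 w) = mod2 (v1 - v2))"
    proof (intro conjI exI)
      show "a \<noteq> b" by (rule ab(1))
      show "(\<Sum>w\<in>S. r w *s mod2 w) = ?x" by (rule rx)
    qed (simp_all add: rsum, simp add: r_def)
  next
    fix r' assume "(\<forall>w. w \<notin> S \<longrightarrow> r' w = 0) \<and> (\<Sum>w\<in>S. r' w) = 0 \<and>
      (\<exists>v1 v2. v1 \<noteq> v2 \<and> {a, b} = {v1, v2} \<and> (\<Sum>w\<in>S. r' w *s mod2 w) = mod2 (v1 - v2))"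
    then obtain v1 v2 where r': "\<forall>w. w \<notin> S \<longrightarrow> r' w = 0" "(\<Sum>w\<in>S. r' w) = 0"
      and v12: "{a, b} = {v1, v2}" "(\<Sum>w\<in>S. r' w *s mod2 w) = mod2 (v1 - v2)" by (elim conjE exE)
    have "(v1 = a \<and> v2 = b) \<or> (v1 = b \<and> v2 = a)" using v12(1) by (auto simp: doubleton_eq_iff)
    then have "mod2 (v1 - v2) = ?x" using swap by auto
    then have "(\<Sum>w\<in>S. r' w *s mod2 w) = ?x" using v12(2) by simp
    then show "r' = r" using uniq r' by blast
  qed
  then show ?thesis using v by (simp add: r_def)
qed

text \<open>The derivative modulo two of the function that is affine on all simplices, \<open>1\<close> at \<open>v\<close> and \<open>0\<close> at the
  other vertices of the triangulation.\<close>

definition vertex_weight :: "real ^ 'm \<Rightarrow> (real ^ 'm) set \<Rightarrow> bit ^ 'm" where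
  "vertex_weight v T = (if T \<in> tops K \<and> v \<in> T then mod2 (frame T v) else 0)"

lemma pair2_vertex_weight:
  assumes "T \<in> tops K" "x \<in> T" "y \<in> T"
  shows "pair2 (mod2 (x - y)) (vertex_weight v T) = of_bool (x = v) + of_bool (y = v)"
proof (cases "v \<in> T")
  case True
  then show ?thesis using pair2_dual_frame[OF tops_frame[OF assms(1)] tops_lat[OF assms(1)] True assms(2,3)] assms(1)
    by (simp add: vertex_weight_def)
next
  case False
  then show ?thesis using assms by (auto simp: vertex_weight_def)
qed

text \<open>The derivatives on the simplices around a ridge agree along the ridge, and if the ridge contains
  \<open>v\<close> there are two of them; otherwise they vanish along the ridge.\<close>

lemma vertex_weight_balanced:
  assumes v: "v \<in> interior P"
  shows "vertex_weight v \<in> balanced_weights K"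
  unfolding balanced_weights_def
proof (intro CollectI conjI allI impI ballI)
  show "vertex_weight v T = 0" if "T \<notin> tops K" for T using that by (simp add: vertex_weight_def)
  fix S x y assume S: "S \<in> ridges K" and xy: "x \<in> S" "y \<in> S"
  let ?C = "{T \<in> tops K. S \<subseteq> T}" and ?k = "of_bool (x = v) + of_bool (y = v) :: bit"
  have "pair2 (mod2 (x - y)) (\<Sum>T\<in>?C. vertex_weight v T) = (\<Sum>T\<in>?C. ?k)"
    unfolding pair2_sum_right by (rule sum.cong[OF refl], rule pair2_vertex_weight) (use xy in auto)
  also have "\<dots> = 0"
  proof (cases "v \<in> S")
    case True
    obtain a b where ab: "a \<noteq> b" "a \<notin> S" "b \<notin> S" "?C = {insert a S, insert b S}"
      using interior_ridge_two_tops[OF S interior_vertex_not_frontier[OF True v]] by metis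
    have "insert a S \<noteq> insert b S" using ab(1-3) by auto
    then show ?thesis unfolding ab(4) by simp
  next
    case False
    then have "x \<noteq> v" "y \<noteq> v" using xy by auto
    then show ?thesis by simp
  qed
  finally show "pair2 (mod2 (x - y)) (\<Sum>T\<in>?C. vertex_weight v T) = 0" .
qed

lemma balanced_weights_add:
  assumes "w \<in> balanced_weights K" "w' \<in> balanced_weights K"
  shows "(\<lambda>T. w T + w' T) \<in> balanced_weights K"
  using assms by (simp add: balanced_weights_def sum.distrib pair2_add_right)

lemma balanced_weights_sum:
  assumes "finite A" "\<And>i. i \<in> A \<Longrightarrow> w i \<in> balanced_weights K"
  shows "(\<lambda>T. \<Sum>i\<in>A. w i T) \<in> balanced_weights K"
  using assms
proof (induction A rule: finite_induct)
  case empty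
  then show ?case by (simp add: balanced_weights_def)
next
  case (insert i A)
  then have "(\<lambda>T. w i T + (\<Sum>i\<in>A. w i T)) \<in> balanced_weights K" by (intro balanced_weights_add) auto
  then show ?case using insert by simp
qed

text \<open>Every maximal simplex through \<open>S - {v}\<close> is counted by the two ridges between them.\<close>

lemma sum_over_ridges_zero:
  fixes h :: "(real ^ 'm) set \<Rightarrow> bit"
  assumes S: "S \<in> ridges K" and v: "v \<in> S"
  shows "(\<Sum>R\<in>{R\<in>ridges K. S - {v} \<subseteq> R}. \<Sum>T\<in>{T \<in> tops K. R \<subseteq> T}. h T) = 0"
proof -
  let ?\<eta> = "S - {v}"
  let ?R = "{R\<in>ridges K. ?\<eta> \<subseteq> R}" and ?C = "{T\<in>tops K. ?\<eta> \<subseteq> T}"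
  have "(\<Sum>R\<in>?R. \<Sum>T\<in>{T \<in> tops K. R \<subseteq> T}. h T) = (\<Sum>R\<in>?R. \<Sum>T\<in>{T \<in> ?C. R \<subseteq> T}. h T)"
  proof (rule sum.cong[OF refl])
    fix R assume "R \<in> ?R"
    then have "{T \<in> tops K. R \<subseteq> T} = {T \<in> ?C. R \<subseteq> T}" by auto
    then show "(\<Sum>T\<in>{T \<in> tops K. R \<subseteq> T}. h T) = (\<Sum>T\<in>{T \<in> ?C. R \<subseteq> T}. h T)" by simp
  qed
  also have "\<dots> = (\<Sum>T\<in>?C. \<Sum>R\<in>{R \<in> ?R. R \<subseteq> T}. h T)"
    by (rule sum.swap_restrict) (use finite_ridges finite_tops in auto)
  also have "\<dots> = 0"
  proof (rule sum.neutral, rule ballI)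
    fix T assume T: "T \<in> ?C"
    then have top: "T \<in> tops K" and sub: "?\<eta> \<subseteq> T" by auto
    have "card (T - ?\<eta>) = 2"
      using card_Diff_subset[OF finite_subset[OF sub tops_finite[OF top]] sub] tops_card[OF top]
        ridgeD(1,2)[OF S] v by simp
    then obtain p q where pq: "T - ?\<eta> = {p, q}" "p \<noteq> q" by (auto simp: card_2_iff)
    have p: "p \<in> T" "p \<notin> ?\<eta>" "q \<in> T" "q \<notin> ?\<eta>" using pq by blast+
    have "{R \<in> ?R. R \<subseteq> T} = {T - {p}, T - {q}}"
    proof
      show "{R \<in> ?R. R \<subseteq> T} \<subseteq> {T - {p}, T - {q}}"
      proof
        fix R assume "R \<in> {R \<in> ?R. R \<subseteq> T}"
        then have R: "R \<in> ridges K" "?\<eta> \<subseteq> R" "R \<subseteq> T" by auto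
        obtain t where t: "t \<in> T" "t \<notin> R" "R = T - {t}" using ridge_apex[OF R(1) top R(3)] by metis
        then have "t \<in> T - ?\<eta>" using R(2) by blast
        then show "R \<in> {T - {p}, T - {q}}" using t(3) pq(1) by auto
      qed
      have "T - {t} \<in> {R \<in> ?R. R \<subseteq> T}" if "t \<in> T" "t \<notin> ?\<eta>" for t
        using that sub top tops_card[OF top] tops_finite[OF top] by (auto simp: ridges_def)
      then show "{T - {p}, T - {q}} \<subseteq> {R \<in> ?R. R \<subseteq> T}" using p by blast
    qed
    moreover have "T - {p} \<noteq> T - {q}" using pq p by blast
    ultimately show "(\<Sum>R\<in>{R \<in> ?R. R \<subseteq> T}. h T) = 0" by simp
  qed
  finally show ?thesis .
qed

end

context patchworked begin

lemma ridge_jump: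
  assumes f: "loc_const f" and R: "R \<in> ridges K" "\<not> convex hull R \<subseteq> frontier P"
    and T: "insert c R \<in> tops K" "c \<notin> R"
  shows "\<exists>k. (\<forall>u. (\<Sum>T\<in>{T \<in> tops K. R \<subseteq> T}. sheet_value f T u) = (if crosses \<epsilon> u R then 0 else k)) \<and>
    (\<Sum>T\<in>{T \<in> tops K. R \<subseteq> T}. weight f T) = k *s mod2 (frame (insert c R) c)"
proof -
  obtain a b where ab: "a \<noteq> b" "a \<notin> R" "b \<notin> R" "{T \<in> tops K. R \<subseteq> T} = {insert a R, insert b R}"
    using interior_ridge_two_tops[OF R] by metis
  have "insert c R \<in> {insert a R, insert b R}" unfolding ab(4)[symmetric] using T(1) by blast
  then have "c = a \<or> c = b" using T(2) ab(2,3) by (auto simp: insert_ident)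
  then obtain d where d: "d \<noteq> c" "d \<notin> R" "{T \<in> tops K. R \<subseteq> T} = {insert c R, insert d R}"
  proof
    assume ca: "c = a"
    show thesis by (rule that[OF _ ab(3)]) (use ab(1) ca in simp, simp only: ab(4) ca)
  next
    assume cb: "c = b"
    have C: "{T \<in> tops K. R \<subseteq> T} = {insert c R, insert a R}" unfolding ab(4) cb by (rule insert_commute)
    show thesis by (rule that[OF _ ab(2) C]) (use ab(1) cb in simp)
  qed
  have Td: "insert d R \<in> tops K" using d(3) by blast
  obtain k where k: "\<And>u. sheet_value f (insert c R) u + sheet_value f (insert d R) u = (if crosses \<epsilon> u R then 0 else k)"
    "weight f (insert c R) + weight f (insert d R) = k *s mod2 (frame (insert c R) c)"
    using sheet_value_jump[OF f R(1) T Td d(2)] by metis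
  have ne: "insert c R \<noteq> insert d R" using d(1,2) T(2) by auto
  show ?thesis
  proof (intro exI conjI allI)
    show "(\<Sum>T\<in>{T \<in> tops K. R \<subseteq> T}. sheet_value f T u) = (if crosses \<epsilon> u R then 0 else k)" for u
      unfolding d(3) using k(1)[of u] ne by simp
    show "(\<Sum>T\<in>{T \<in> tops K. R \<subseteq> T}. weight f T) = k *s mod2 (frame (insert c R) c)"
      unfolding d(3) using k(2) ne by simp
  qed
qed

text \<open>The jumps of the functions \<open>F\<^sub>T\<close> across all ridges through \<open>S - {v}\<close> add up to zero in every
  sheet; consider the one in which the signs are constant on \<open>insert a S\<close>. Only three ridges
  contribute: \<open>S\<close> with the value of \<open>\<rho>\<close> at \<open>v\<close>, the ridge opposite to \<open>v\<close> in \<open>insert a S\<close> with \<open>1\<close>,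
  and the one opposite to \<open>v\<close> in \<open>insert b S\<close> with \<open>1\<close> or \<open>0\<close> according as \<open>a\<close> and \<open>b\<close> have the same
  sign in this sheet or not. The vertex \<open>y\<close> in the interior of \<open>P\<close> ensures that no ridge through
  \<open>S - {v}\<close> lies in the boundary.\<close>

lemma vertex_weight_obstruction:
  assumes S: "S \<in> ridges K" and ab: "a \<noteq> b" "a \<notin> S" "b \<notin> S"
    and C: "{T \<in> tops K. S \<subseteq> T} = {insert a S, insert b S}"
    and v: "v \<in> S" and y: "y \<in> S" "y \<noteq> v" "y \<in> interior P"
    and f: "loc_const f" and eq: "\<And>T. T \<in> tops K \<Longrightarrow> S - {v} \<subseteq> T \<Longrightarrow> weight f T = vertex_weight v T"
  shows "pair2 (mod2 (a - b)) (mod2 (frame (insert b S) v))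
    = tsign \<epsilon> (uncrossed_sheet (insert a S)) a + tsign \<epsilon> (uncrossed_sheet (insert a S)) b"
proof -
  let ?\<eta> = "S - {v}" and ?T1 = "insert a S" and ?T2 = "insert b S" and ?u = "uncrossed_sheet (insert a S)"
  let ?R1 = "insert a ?\<eta>" and ?R2 = "insert b ?\<eta>" and ?R = "{R\<in>ridges K. ?\<eta> \<subseteq> R}"
  let ?A = "\<lambda>R. \<Sum>T\<in>{T \<in> tops K. R \<subseteq> T}. sheet_value f T ?u"
  have top: "?T1 \<in> tops K" "?T2 \<in> tops K" using C by blast+
  have va: "v \<noteq> a" "v \<noteq> b" using v ab by auto
  have y\<eta>: "y \<in> ?\<eta>" using y by blast
  have int: "\<not> convex hull R \<subseteq> frontier P" if "?\<eta> \<subseteq> R" for R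
    using interior_vertex_not_frontier[OF _ y(3)] that y\<eta> by blast
  have wsum: "(\<Sum>T\<in>{T \<in> tops K. R \<subseteq> T}. weight f T) = (\<Sum>T\<in>{T \<in> tops K. R \<subseteq> T}. vertex_weight v T)"
    if "?\<eta> \<subseteq> R" for R
    by (rule sum.cong[OF refl], rule eq) (use that in auto)
  have nc1: "\<not> crosses \<epsilon> ?u ?T1" using not_crosses_top_iff[OF top(1)] by blast
  have cardS: "card S = CARD('m)" "finite S" using ridgeD[OF S] by auto
  \<comment> \<open>The jump across the ridge opposite to \<open>v\<close> in \<open>insert c S\<close>\<close>
  have opp: "?A (insert c ?\<eta>) = (if crosses \<epsilon> ?u (insert c ?\<eta>) then 0 else 1)"
    and oppR: "insert c ?\<eta> \<in> ridges K"
    if c: "c \<notin> S" "insert c S \<in> tops K" for c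
  proof -
    let ?Q = "insert c ?\<eta>"
    have card: "card ?Q = CARD('m)" using cardS c(1) v by (simp add: card.remove[symmetric])
    have sub: "?Q \<subseteq> insert c S" by blast
    show Q: "?Q \<in> ridges K" using card sub c(2) unfolding ridges_def by blast
    have vc: "v \<noteq> c" "v \<notin> ?Q" using v c by auto
    have Tc: "insert v ?Q = insert c S" using v by blast
    have topv: "insert v ?Q \<in> tops K" unfolding Tc by (rule c(2))
    obtain k where k: "\<And>u. (\<Sum>T\<in>{T \<in> tops K. ?Q \<subseteq> T}. sheet_value f T u) = (if crosses \<epsilon> u ?Q then 0 else k)"
      "(\<Sum>T\<in>{T \<in> tops K. ?Q \<subseteq> T}. weight f T) = k *s mod2 (frame (insert v ?Q) v)"
      using ridge_jump[OF f Q int[OF subset_insertI] topv vc(2)] by blast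
    have "(\<Sum>T\<in>{T \<in> tops K. ?Q \<subseteq> T}. vertex_weight v T) = (\<Sum>T\<in>{insert v ?Q}. vertex_weight v T)"
    proof (rule sum.mono_neutral_right)
      show "finite {T \<in> tops K. ?Q \<subseteq> T}" using finite_tops by simp
      show "{insert v ?Q} \<subseteq> {T \<in> tops K. ?Q \<subseteq> T}" using topv by blast
      show "\<forall>T\<in>{T \<in> tops K. ?Q \<subseteq> T} - {insert v ?Q}. vertex_weight v T = 0"
      proof
        fix T assume T: "T \<in> {T \<in> tops K. ?Q \<subseteq> T} - {insert v ?Q}"
        then have T': "T \<in> tops K" "?Q \<subseteq> T" "T \<noteq> insert v ?Q" by auto
        have "v \<notin> T"
        proof
          assume "v \<in> T"
          obtain t where t: "t \<notin> ?Q" "T = insert t ?Q" using ridge_apex[OF Q T'(1,2)] by metis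
          then have "v = t" using \<open>v \<in> T\<close> vc(2) by auto
          then show False using t(2) T'(3) by simp
        qed
        then show "vertex_weight v T = 0" by (simp add: vertex_weight_def)
      qed
    qed
    then have "k *s mod2 (frame (insert v ?Q) v) = mod2 (frame (insert v ?Q) v)"
      using k(2) wsum[OF subset_insertI] topv by (simp add: vertex_weight_def)
    then have "k = 1" using frame_mod2_nonzero[OF topv, of v] by (cases "k = 0") auto
    then show "?A ?Q = (if crosses \<epsilon> ?u ?Q then 0 else 1)" using k(1) by simp
  qed
  have A1: "?A ?R1 = 1"
  proof -
    have "?R1 \<subseteq> ?T1" by blast
    then have "\<not> crosses \<epsilon> ?u ?R1" using nc1 crosses_mono by blast
    then show ?thesis using opp[OF ab(2) top(1)] by simp
  qed
  have A2: "?A ?R2 = of_bool (tsign \<epsilon> ?u a = tsign \<epsilon> ?u b)"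
  proof -
    have const: "tsign \<epsilon> ?u x = tsign \<epsilon> ?u a" if "x \<in> S" for x
      using nc1 that unfolding crosses_def by blast
    have "crosses \<epsilon> ?u ?R2 \<longleftrightarrow> tsign \<epsilon> ?u a \<noteq> tsign \<epsilon> ?u b"
    proof
      assume "crosses \<epsilon> ?u ?R2"
      then obtain x z where xz: "x \<in> ?R2" "z \<in> ?R2" "tsign \<epsilon> ?u x \<noteq> tsign \<epsilon> ?u z" unfolding crosses_def by blast
      show "tsign \<epsilon> ?u a \<noteq> tsign \<epsilon> ?u b"
      proof
        assume e: "tsign \<epsilon> ?u a = tsign \<epsilon> ?u b"
        have "tsign \<epsilon> ?u x = tsign \<epsilon> ?u a" if "x \<in> ?R2" for x
          using that const[of x] e by (cases "x = b") auto
        then show False using xz by simp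
      qed
    next
      assume "tsign \<epsilon> ?u a \<noteq> tsign \<epsilon> ?u b"
      then have "tsign \<epsilon> ?u y \<noteq> tsign \<epsilon> ?u b" using const[OF y(1)] by simp
      then show "crosses \<epsilon> ?u ?R2" unfolding crosses_def using y\<eta> by blast
    qed
    then show ?thesis using opp[OF ab(3) top(2)] by simp
  qed
  have AS: "?A S = pair2 (mod2 (a - b)) (mod2 (frame ?T2 v))"
  proof -
    obtain k where k: "\<And>u. (\<Sum>T\<in>{T \<in> tops K. S \<subseteq> T}. sheet_value f T u) = (if crosses \<epsilon> u S then 0 else k)"
      "(\<Sum>T\<in>{T \<in> tops K. S \<subseteq> T}. weight f T) = k *s mod2 (frame ?T1 a)"
      using ridge_jump[OF f S int[OF Diff_subset] top(1) ab(2)] by blast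
    have ne: "?T1 \<noteq> ?T2" using ab by auto
    have w: "vertex_weight v ?T1 + vertex_weight v ?T2 = k *s mod2 (frame ?T1 a)"
      using trans[OF wsum[OF Diff_subset, symmetric] k(2)] ne unfolding C by simp
    let ?z = "mod2 (a - y)"
    have ya: "y \<noteq> a" "y \<noteq> b" using y ab by auto
    have l1: "pair2 ?z (mod2 (frame ?T1 a)) = 1"
      using pair2_dual_frame[OF tops_frame[OF top(1)] tops_lat[OF top(1)], of a a y] y ya by simp
    have l2: "pair2 ?z (vertex_weight v ?T1) = 0"
      using pair2_vertex_weight[OF top(1), of a y v] y va by simp
    have lat: "a \<in> lat" "b \<in> lat" "y \<in> lat"
      using tops_lat[OF top(1)] tops_lat[OF top(2)] y by auto
    have "?z = mod2 ((a - b) + (b - y))" by simp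
    also have "\<dots> = mod2 (a - b) + mod2 (b - y)" by (rule mod2_add) (use lat lat_diff in auto)
    finally have z: "?z = mod2 (a - b) + mod2 (b - y)" .
    have "pair2 (mod2 (b - y)) (vertex_weight v ?T2) = 0"
      using pair2_vertex_weight[OF top(2), of b y v] y va by simp
    then have l3: "pair2 ?z (vertex_weight v ?T2) = pair2 (mod2 (a - b)) (mod2 (frame ?T2 v))"
      using top(2) v by (simp add: z pair2_add_left vertex_weight_def)
    have "k = pair2 ?z (k *s mod2 (frame ?T1 a))" using l1 by (simp add: pair2_scale_right)
    also have "\<dots> = pair2 (mod2 (a - b)) (mod2 (frame ?T2 v))"
      using l2 l3 by (simp add: w[symmetric] pair2_add_right)
    finally have "k = pair2 (mod2 (a - b)) (mod2 (frame ?T2 v))" .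
    moreover have "\<not> crosses \<epsilon> ?u S" using nc1 crosses_mono by blast
    ultimately show ?thesis using k(1)[of ?u] by simp
  qed
  have rest: "?A R = 0" if R: "R \<in> ?R" "R \<noteq> S" "R \<noteq> ?R1" "R \<noteq> ?R2" for R
  proof -
    have Rr: "R \<in> ridges K" "?\<eta> \<subseteq> R" using R(1) by auto
    have finR: "finite R" "card R = CARD('m)" using ridgeD[OF Rr(1)] by auto
    have vR: "v \<notin> R"
    proof
      assume "v \<in> R"
      then have "S \<subseteq> R" using Rr(2) by blast
      then show False using card_subset_eq[OF finR(1)] finR(2) cardS(1) R(2) by metis
    qed
    have vT: "v \<notin> T" if T: "T \<in> tops K" "R \<subseteq> T" for T
    proof
      assume vin: "v \<in> T"
      obtain t where t: "t \<notin> R" "T = insert t R" using ridge_apex[OF Rr(1) T] by metis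
      then have RT: "R = T - {v}" using vin vR by auto
      have "S \<subseteq> T" using Rr(2) T(2) vin by blast
      then have "T \<in> {insert a S, insert b S}" unfolding C[symmetric] using T(1) by blast
      then have "T = ?T1 \<or> T = ?T2" by blast
      then have "R = ?R1 \<or> R = ?R2" using RT va by (auto simp: insert_Diff_if)
      then show False using R(3,4) by blast
    qed
    obtain T where T: "T \<in> tops K" "R \<subseteq> T" using Rr(1) by (auto simp: ridges_def)
    obtain c where c: "c \<notin> R" "T = insert c R" using ridge_apex[OF Rr(1) T] by metis
    have Tc: "insert c R \<in> tops K" using T(1) c(2) by simp
    obtain k where k: "\<And>u. (\<Sum>T\<in>{T \<in> tops K. R \<subseteq> T}. sheet_value f T u) = (if crosses \<epsilon> u R then 0 else k)"
      "(\<Sum>T\<in>{T \<in> tops K. R \<subseteq> T}. weight f T) = k *s mod2 (frame (insert c R) c)"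
      using ridge_jump[OF f Rr(1) int[OF Rr(2)] Tc c(1)] by blast
    have "(\<Sum>T\<in>{T \<in> tops K. R \<subseteq> T}. vertex_weight v T) = 0"
      by (rule sum.neutral) (use vT in \<open>auto simp: vertex_weight_def\<close>)
    then have "k *s mod2 (frame (insert c R) c) = 0" using k(2) wsum[OF Rr(2)] by simp
    then have "k = 0" unfolding vector_mul_eq_0 using frame_mod2_nonzero[OF Tc, of c] by blast
    then show ?thesis using k(1)[of ?u] by simp
  qed
  have R1ne: "?R1 \<noteq> S" "?R2 \<noteq> S" "?R1 \<noteq> ?R2" using v va ab by (blast, blast, auto)
  have "0 = (\<Sum>R\<in>?R. ?A R)" by (rule sum_over_ridges_zero[OF S v, symmetric])
  also have "\<dots> = (\<Sum>R\<in>{S, ?R1, ?R2}. ?A R)"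
  proof (rule sum.mono_neutral_right)
    show "finite ?R" using finite_ridges by simp
    show "{S, ?R1, ?R2} \<subseteq> ?R" using S oppR[OF ab(2) top(1)] oppR[OF ab(3) top(2)] by blast
    show "\<forall>R\<in>?R - {S, ?R1, ?R2}. ?A R = 0" using rest by blast
  qed
  also have "\<dots> = ?A S + (?A ?R1 + ?A ?R2)" using R1ne by simp
  also have "\<dots> = pair2 (mod2 (a - b)) (mod2 (frame ?T2 v)) + (1 + of_bool (tsign \<epsilon> ?u a = tsign \<epsilon> ?u b))"
    by (simp only: A1 A2 AS)
  finally have "pair2 (mod2 (a - b)) (mod2 (frame ?T2 v)) + (1 + of_bool (tsign \<epsilon> ?u a = tsign \<epsilon> ?u b)) = 0"
    by (rule sym)
  then have "pair2 (mod2 (a - b)) (mod2 (frame ?T2 v)) = 1 + of_bool (tsign \<epsilon> ?u a = tsign \<epsilon> ?u b)"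
    by (rule bit_eq_iff_add[THEN iffD2])
  also have "\<dots> = tsign \<epsilon> ?u a + tsign \<epsilon> ?u b"
    by (cases "tsign \<epsilon> ?u a"; cases "tsign \<epsilon> ?u b") simp_all
  finally show ?thesis .
qed

lemma loc_const_add:
  assumes "loc_const f" "loc_const g"
  shows "loc_const (f + g)"
  unfolding loc_const_def
proof (intro allI impI)
  fix x y assume xy: "path_component_of RX x y"
  have "f x = f y" "g x = g y" using assms xy unfolding loc_const_def by blast+
  then show "(f + g) x = (f + g) y" by (simp only: plus_fun_apply)
qed

definition obstructed :: "(real ^ 'm) set \<Rightarrow> real ^ 'm \<Rightarrow> bool" where
  "obstructed \<sigma> v \<longleftrightarrow> (\<forall>f. loc_const f \<longrightarrow>
     (\<exists>T\<in>tops K. verts \<sigma> - {v} \<subseteq> T \<and> weight f T \<noteq> vertex_weight v T))"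

text \<open>The obstruction compares \<open>\<rho>\<close> at \<open>v\<close> with a number that does not depend on \<open>v\<close>; so it is
  effective at one of two vertices with different values of \<open>\<rho>\<close>.\<close>

lemma non_uniform_obstructed:
  assumes "\<sigma> \<in> non_uniform P K"
  shows "\<exists>v\<in>verts \<sigma> \<inter> interior P. obstructed \<sigma> v"
proof -
  have \<sigma>: "\<sigma> \<in> K" "aff_dim \<sigma> = int CARD('m) - 1" "\<not> \<sigma> \<subseteq> frontier P"
    using assms by (auto simp: non_uniform_def interior_simplices_def)
  obtain x y where x: "x \<in> verts \<sigma>" "x \<in> interior P" and y: "y \<in> verts \<sigma>" "y \<in> interior P"
    and ne: "rho K \<sigma> x \<noteq> rho K \<sigma> y" using assms unfolding non_uniform_def by blast
  let ?S = "verts \<sigma>"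
  have S: "?S \<in> ridges K" "\<sigma> = convex hull ?S"
    using K_subset_tops[OF \<sigma>(1)] K_verts[OF \<sigma>(1)] \<sigma>(2) by (auto simp: ridges_def)
  have ni: "\<not> convex hull ?S \<subseteq> frontier P" unfolding S(2)[symmetric] by (rule \<sigma>(3))
  have "\<exists>a b. a \<noteq> b \<and> a \<notin> ?S \<and> b \<notin> ?S \<and> {T \<in> tops K. ?S \<subseteq> T} = {insert a ?S, insert b ?S}"
    by (rule interior_ridge_two_tops[OF S(1) ni], intro exI conjI)
  then obtain a b where ab: "a \<noteq> b" "a \<notin> ?S" "b \<notin> ?S" "{T \<in> tops K. ?S \<subseteq> T} = {insert a ?S, insert b ?S}"
    by (elim exE conjE)
  let ?s = "tsign \<epsilon> (uncrossed_sheet (insert a ?S)) a + tsign \<epsilon> (uncrossed_sheet (insert a ?S)) b"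
  have main: "obstructed \<sigma> v" if v: "v \<in> ?S" "rho K \<sigma> v \<noteq> ?s" and z: "z \<in> ?S" "z \<noteq> v" "z \<in> interior P" for v z
    unfolding obstructed_def
  proof (intro allI impI, rule ccontr)
    fix f assume f: "loc_const f" and no: "\<not> (\<exists>T\<in>tops K. ?S - {v} \<subseteq> T \<and> weight f T \<noteq> vertex_weight v T)"
    have "rho K (convex hull ?S) v = pair2 (mod2 (a - b)) (mod2 (frame (insert b ?S) v))"
      by (rule rho_eq[OF S(1) ab v(1)])
    also have "\<dots> = ?s" by (rule vertex_weight_obstruction[OF S(1) ab v(1) z f]) (use no in blast)
    finally show False using v(2) unfolding S(2)[symmetric] by blast
  qed
  have xy: "x \<noteq> y" using ne by auto
  show ?thesis
  proof (cases "rho K \<sigma> x = ?s")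
    case True
    then have "rho K \<sigma> y \<noteq> ?s" using ne by simp
    then have "obstructed \<sigma> y" by (rule main[OF y(1) _ x(1) xy x(2)])
    then show ?thesis using y by blast
  next
    case False
    then have "obstructed \<sigma> x" by (rule main[OF x(1) _ y(1) xy[symmetric] y(2)])
    then show ?thesis using x by blast
  qed
qed

lemma far_simplices_no_common_top:
  assumes dist: "simplex_dist K \<sigma> \<sigma>' \<ge> 2" and T: "T \<in> tops K"
    and x: "x \<in> verts \<sigma>" "x \<in> T" and y: "y \<in> verts \<sigma>'" "y \<in> T"
  shows False
proof -
  have "graph_dist K x y \<le> enat 1"
  proof (cases "x = y")
    case True
    then have "graph_dist K x y \<le> enat 0" unfolding graph_dist_def by (intro INF_lower) simp
    also have "\<dots> \<le> enat 1" by simp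
    finally show ?thesis .
  next
    case False
    have "closed_segment x y \<in> K"
      unfolding segment_convex_hull by (rule face_tops_K[OF _ T]) (use x y in auto)
    then have "(x, y) \<in> skeleton1 K ^^ 1" using False by (simp add: skeleton1_def)
    then show ?thesis unfolding graph_dist_def by (intro INF_lower) simp
  qed
  moreover have "simplex_dist K \<sigma> \<sigma>' \<le> graph_dist K x y"
    unfolding simplex_dist_def by (intro INF_lower2[OF x(1)] INF_lower[OF y(1)])
  ultimately have "simplex_dist K \<sigma> \<sigma>' \<le> enat 1" by (rule order_trans[rotated])
  then have "(2 :: enat) \<le> enat 1" using dist by (rule order_trans[rotated])
  then show False by (simp add: numeral_eq_enat)
qed

lemma kappa_witness:
  obtains A where "A \<subseteq> non_uniform P K" "finite A" "card A = kappa P K"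
    "\<And>\<sigma> \<tau>. \<lbrakk>\<sigma> \<in> A; \<tau> \<in> A; \<sigma> \<noteq> \<tau>\<rbrakk> \<Longrightarrow> simplex_dist K \<sigma> \<tau> \<ge> 2"
proof -
  let ?F = "{S. S \<subseteq> non_uniform P K \<and> pairwise (\<lambda>\<sigma> \<tau>. simplex_dist K \<sigma> \<tau> \<ge> 2) S}"
  have fin: "finite (non_uniform P K)"
    by (rule finite_subset[OF _ finite_K]) (auto simp: non_uniform_def interior_simplices_def)
  have "?F \<subseteq> Pow (non_uniform P K)" by blast
  then have "finite ?F" using fin finite_subset by blast
  moreover have "{} \<in> ?F" by simp
  ultimately have "kappa P K \<in> card ` ?F" unfolding kappa_def by (intro Max_in) auto
  then obtain A where A: "A \<subseteq> non_uniform P K" "pairwise (\<lambda>\<sigma> \<tau>. simplex_dist K \<sigma> \<tau> \<ge> 2) A" "card A = kappa P K"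
    by auto
  show thesis
    by (rule that[OF A(1) finite_subset[OF A(1) fin] A(3)]) (use A(2) in \<open>auto simp: pairwise_def\<close>)
qed

text \<open>Near a simplex of \<open>B\<close> the vertex weights of the other, far simplices vanish, so the weight of \<open>f\<close>
  would there be a single vertex weight, which is obstructed.\<close>

lemma vertex_weight_sums_independent:
  assumes A: "finite A" and far: "\<And>\<sigma> \<tau>. \<lbrakk>\<sigma> \<in> A; \<tau> \<in> A; \<sigma> \<noteq> \<tau>\<rbrakk> \<Longrightarrow> simplex_dist K \<sigma> \<tau> \<ge> 2"
    and p: "\<And>\<sigma>. \<sigma> \<in> A \<Longrightarrow> p \<sigma> \<in> verts \<sigma> \<and> obstructed \<sigma> (p \<sigma>) \<and> verts \<sigma> - {p \<sigma>} \<noteq> {}"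
    and f: "loc_const f" and B: "B \<subseteq> A" and eq: "\<And>T. weight f T = (\<Sum>\<sigma>\<in>B. vertex_weight (p \<sigma>) T)"
  shows "B = {}"
proof (rule ccontr)
  assume "B \<noteq> {}"
  then obtain \<sigma> where \<sigma>: "\<sigma> \<in> B" by blast
  then have \<sigma>A: "\<sigma> \<in> A" using B by blast
  have finB: "finite B" using A B finite_subset by blast
  obtain T where T: "T \<in> tops K" "verts \<sigma> - {p \<sigma>} \<subseteq> T" "weight f T \<noteq> vertex_weight (p \<sigma>) T"
    using p[OF \<sigma>A] f unfolding obstructed_def by blast
  obtain x where x: "x \<in> verts \<sigma> - {p \<sigma>}" using p[OF \<sigma>A] by blast
  have "(\<Sum>\<tau>\<in>B. vertex_weight (p \<tau>) T) = (\<Sum>\<tau>\<in>{\<sigma>}. vertex_weight (p \<tau>) T)"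
  proof (rule sum.mono_neutral_right[OF finB])
    show "{\<sigma>} \<subseteq> B" using \<sigma> by blast
    show "\<forall>\<tau>\<in>B - {\<sigma>}. vertex_weight (p \<tau>) T = 0"
    proof
      fix \<tau> assume \<tau>: "\<tau> \<in> B - {\<sigma>}"
      then have \<tau>A: "\<tau> \<in> A" "\<sigma> \<noteq> \<tau>" using B by auto
      have "p \<tau> \<notin> T"
      proof
        assume "p \<tau> \<in> T"
        then show False
          using far_simplices_no_common_top[OF far[OF \<sigma>A \<tau>A] T(1), of x "p \<tau>"] x T(2) p[OF \<tau>A(1)] by blast
      qed
      then show "vertex_weight (p \<tau>) T = 0" by (simp add: vertex_weight_def)
    qed
  qed
  then show False using T(3) eq[of T] by simp
qed

lemma bitvec_symdiff_sum:
  fixes h :: "'i \<Rightarrow> bit ^ 'k"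
  assumes "finite A" "finite B"
  shows "(\<Sum>i\<in>A. h i) + (\<Sum>i\<in>B. h i) = (\<Sum>i\<in>(A - B) \<union> (B - A). h i)"
proof -
  have "(\<Sum>i\<in>A. h i) = (\<Sum>i\<in>A - B. h i) + (\<Sum>i\<in>A \<inter> B. h i)"
    using sum.Int_Diff[OF assms(1), of h B] by (simp add: add.commute)
  moreover have "(\<Sum>i\<in>B. h i) = (\<Sum>i\<in>A \<inter> B. h i) + (\<Sum>i\<in>B - A. h i)"
    using sum.Int_Diff[OF assms(2), of h A] by (simp add: Int_commute)
  ultimately have "(\<Sum>i\<in>A. h i) + (\<Sum>i\<in>B. h i)
      = (\<Sum>i\<in>A - B. h i) + ((\<Sum>i\<in>A \<inter> B. h i) + (\<Sum>i\<in>A \<inter> B. h i)) + (\<Sum>i\<in>B - A. h i)"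
    by (simp only: add.assoc)
  also have "\<dots> = (\<Sum>i\<in>A - B. h i) + (\<Sum>i\<in>B - A. h i)" by simp
  also have "\<dots> = (\<Sum>i\<in>(A - B) \<union> (B - A). h i)"
    by (rule sum.union_disjoint[symmetric]) (use assms in auto)
  finally show ?thesis .
qed

text \<open>A set \<open>B\<close> of components and a set \<open>D\<close> of far apart non-uniform simplices give a balanced weight, the
  moments of the indicator function of \<open>B\<close> plus the vertex weights of \<open>D\<close>. This weight determines
  \<open>D\<close>, and it determines \<open>B\<close> up to the complement.\<close>

theorem betti2_plus_kappa_le:
  assumes n: "CARD('m) = n + 1" "n \<ge> 1"
  shows "betti2 0 RX + kappa P K \<le> hodge P K n 0 + 1"
proof -
  let ?N = "(\<lambda>(u, T). pt u T) ` (UNIV \<times> tops K)"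
  have finN: "finite ?N" using finite_tops by simp
  have exN: "\<exists>y\<in>?N. path_component_of RX x y" if x: "x \<in> topspace RX" for x
  proof -
    obtain u T where T: "T \<in> tops K" "path_component_of RX x (pt u T)" using path_to_top[OF x] by blast
    then show ?thesis by (intro bexI[of _ "pt u T"] image_eqI[of _ _ "(u, T)"]) simp_all
  qed
  obtain R where R: "R \<subseteq> topspace RX" "finite R"
      and uniq: "\<And>x y. \<lbrakk>x \<in> R; y \<in> R; path_component_of RX x y\<rbrakk> \<Longrightarrow> x = y"
      and ex: "\<And>x. x \<in> topspace RX \<Longrightarrow> \<exists>y\<in>R. path_component_of RX y x"
    by (rule path_representatives_exist[OF finN exN]) blast+
  have betti: "betti2 0 RX = card R" by (rule betti2_0_eq_card[OF R uniq ex])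
  obtain A where A: "A \<subseteq> non_uniform P K" "finite A" "card A = kappa P K"
      and far: "\<And>\<sigma> \<tau>. \<lbrakk>\<sigma> \<in> A; \<tau> \<in> A; \<sigma> \<noteq> \<tau>\<rbrakk> \<Longrightarrow> simplex_dist K \<sigma> \<tau> \<ge> 2"
    by (rule kappa_witness) blast
  have "\<forall>\<sigma>\<in>A. \<exists>v. v \<in> verts \<sigma> \<inter> interior P \<and> obstructed \<sigma> v"
    using non_uniform_obstructed A(1) by blast
  then obtain p where p: "\<forall>\<sigma>\<in>A. p \<sigma> \<in> verts \<sigma> \<inter> interior P \<and> obstructed \<sigma> (p \<sigma>)"
    using bchoice[of A "\<lambda>\<sigma> v. v \<in> verts \<sigma> \<inter> interior P \<and> obstructed \<sigma> v"] by blast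
  have p': "p \<sigma> \<in> verts \<sigma> \<and> obstructed \<sigma> (p \<sigma>) \<and> verts \<sigma> - {p \<sigma>} \<noteq> {}" if \<sigma>: "\<sigma> \<in> A" for \<sigma>
  proof -
    have s: "\<sigma> \<in> K" "aff_dim \<sigma> = int CARD('m) - 1"
      using A(1) \<sigma> by (auto simp: non_uniform_def interior_simplices_def)
    have "card (verts \<sigma>) \<ge> 2" using K_verts(4)[OF s(1)] s(2) dim2 by simp
    then have "verts \<sigma> \<noteq> {p \<sigma>}" "verts \<sigma> \<noteq> {}" by auto
    then show ?thesis using p \<sigma> by blast
  qed
  define ind :: "((bit ^ 'm) \<times> (real ^ 'm)) set set \<Rightarrow> ((bit ^ 'm) \<times> (real ^ 'm)) set \<Rightarrow> bit" where
    "ind B x = of_bool (\<exists>y\<in>B. path_component_of RX y x)" for B x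
  have ind_loc: "loc_const (ind B)" for B
    unfolding loc_const_def
  proof (intro allI impI)
    fix x y assume xy: "path_component_of RX x y"
    have "path_component_of RX z x \<longleftrightarrow> path_component_of RX z y" for z
      using path_component_of_trans[OF _ xy] path_component_of_trans[OF _ path_component_of_sym[OF xy]] by blast
    then show "ind B x = ind B y" by (simp add: ind_def)
  qed
  have ind_R: "ind B x = of_bool (x \<in> B)" if "B \<subseteq> R" "x \<in> R" for B x
  proof -
    have "(\<exists>y\<in>B. path_component_of RX y x) \<longleftrightarrow> x \<in> B"
    proof
      assume "\<exists>y\<in>B. path_component_of RX y x"
      then obtain y where y: "y \<in> B" "path_component_of RX y x" by blast
      then have "y = x" using uniq[of y x] that by blast
      then show "x \<in> B" using y(1) by simp
    next
      assume "x \<in> B"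
      moreover have "path_component_of RX x x" using path_component_of_refl[of RX x] that(2) R(1) by blast
      ultimately show "\<exists>y\<in>B. path_component_of RX y x" by blast
    qed
    then show ?thesis by (simp add: ind_def)
  qed
  \<comment> \<open>The value of the indicator function at \<open>x0\<close> distinguishes \<open>B\<close> from its complement.\<close>
  define x0 where "x0 = (SOME x. x \<in> R)"
  define \<Psi> where "\<Psi> = (\<lambda>(B, D). ((\<lambda>T. weight (ind B) T + (\<Sum>\<sigma>\<in>D. vertex_weight (p \<sigma>) T)), ind B x0))"
  have into: "\<Psi> ` (Pow R \<times> Pow A) \<subseteq> balanced_weights K \<times> UNIV"
  proof (rule image_subsetI)
    fix z assume z: "z \<in> Pow R \<times> Pow A"
    obtain B D where BD: "z = (B, D)" by (cases z)
    have D: "D \<subseteq> A" using z BD by simp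
    have "(\<lambda>T. \<Sum>\<sigma>\<in>D. vertex_weight (p \<sigma>) T) \<in> balanced_weights K"
    proof (rule balanced_weights_sum)
      show "finite D" using D A(2) finite_subset by blast
      show "vertex_weight (p \<sigma>) \<in> balanced_weights K" if "\<sigma> \<in> D" for \<sigma>
        using vertex_weight_balanced p D that by blast
    qed
    then have "(\<lambda>T. weight (ind B) T + (\<Sum>\<sigma>\<in>D. vertex_weight (p \<sigma>) T)) \<in> balanced_weights K"
      by (rule balanced_weights_add[OF weight_balanced[OF ind_loc]])
    then show "\<Psi> z \<in> balanced_weights K \<times> UNIV" by (simp add: \<Psi>_def BD)
  qed
  have inj: "inj_on \<Psi> (Pow R \<times> Pow A)"
  proof (rule inj_onI)
    fix z z' assume z: "z \<in> Pow R \<times> Pow A" "z' \<in> Pow R \<times> Pow A" and eq: "\<Psi> z = \<Psi> z'"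
    obtain B D where BD: "z = (B, D)" by (cases z)
    obtain B' D' where BD': "z' = (B', D')" by (cases z')
    have sub: "B \<subseteq> R" "D \<subseteq> A" "B' \<subseteq> R" "D' \<subseteq> A" using z BD BD' by auto
    have fin: "finite D" "finite D'" using sub A(2) finite_subset by blast+
    have weq: "weight (ind B) T + (\<Sum>\<sigma>\<in>D. vertex_weight (p \<sigma>) T)
        = weight (ind B') T + (\<Sum>\<sigma>\<in>D'. vertex_weight (p \<sigma>) T)" for T
      using eq unfolding \<Psi>_def BD BD' by (simp add: fun_eq_iff)
    have x0eq: "ind B x0 = ind B' x0" using eq unfolding \<Psi>_def BD BD' by simp
    let ?f = "ind B + ind B'" and ?E = "(D - D') \<union> (D' - D)"
    have f: "loc_const ?f" by (rule loc_const_add[OF ind_loc ind_loc])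
    have wf: "weight ?f T = (\<Sum>\<sigma>\<in>?E. vertex_weight (p \<sigma>) T)" for T
    proof -
      have bit: "a + b = c + d \<Longrightarrow> a + c = b + d" for a b c d :: bit
        by (cases a; cases b; cases c; cases d) simp_all
      have swap: "a + b = c + d \<Longrightarrow> a + c = b + d" for a b c d :: "bit ^ 'm"
        unfolding vec_eq_iff vector_add_component by (rule allI, rule bit, erule spec)
      show ?thesis
        unfolding weight_add bitvec_symdiff_sum[OF fin, symmetric] by (rule swap[OF weq])
    qed
    have "?E = {}"
      by (rule vertex_weight_sums_independent[OF A(2) far p' f _ wf]) (use sub in auto)
    then have DD: "D = D'" by blast
    have w0: "weight ?f T = 0" for T using wf[of T] \<open>?E = {}\<close> by simp
    have "B = B'"
    proof (cases "R = {}")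
      case False
      then have "\<exists>x. x \<in> R" by blast
      then have x0: "x0 \<in> R" unfolding x0_def by (rule someI_ex)
      have "ind B x = ind B' x" if x: "x \<in> R" for x
      proof -
        have "?f x = ?f x0"
          by (rule weight_zero_constant[OF f w0]) (use R(1) x x0 in blast)+
        also have "\<dots> = 0" using x0eq by simp
        finally have "ind B x + ind B' x = 0" by simp
        then show ?thesis by (rule bit_eq_iff_add[THEN iffD2])
      qed
      then have "x \<in> B \<longleftrightarrow> x \<in> B'" if "x \<in> R" for x
        using ind_R[OF sub(1) that] ind_R[OF sub(3) that] that by (auto simp: of_bool_def split: if_splits)
      then show ?thesis using sub by blast
    qed (use sub in blast)
    then show "z = z'" using DD BD BD' by simp
  qed
  have bw: "finite (balanced_weights K)" "card (balanced_weights K) \<le> 2 ^ hodge P K n 0"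
    using card_balanced_weights[OF n] by auto
  have "card (Pow R \<times> Pow A) \<le> card (balanced_weights K \<times> (UNIV :: bit set))"
    by (rule card_inj_on_le[OF inj into]) (use bw(1) in simp)
  moreover have "card (UNIV :: bit set) = 2" unfolding UNIV_bit by simp
  ultimately have "2 ^ card R * 2 ^ card A \<le> card (balanced_weights K) * 2"
    using R(2) A(2) by (simp add: card_cartesian_product card_Pow)
  also have "\<dots> \<le> 2 ^ hodge P K n 0 * 2" using bw(2) by simp
  finally have "(2::nat) ^ (card R + card A) \<le> 2 ^ (hodge P K n 0 + 1)" by (simp add: power_add)
  then have "card R + card A \<le> hodge P K n 0 + 1" by (simp only: power_increasing_iff)
  then show ?thesis using betti A(3) by simp
qed

end

theorem proposition5p15:
  fixes n :: nat
    and P :: "(real ^ 'm) set"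
    and K :: "(real ^ 'm) set set"
    and \<epsilon> :: "real ^ 'm \<Rightarrow> bit"
  assumes "n \<ge> 1" and "CARD('m) = n + 1"
    and "smooth_polytope P"
    and "primitive_triangulation P K"
  shows "int (betti2 0 (subtopology (real_toric_variety P) (T_hypersurface P K \<epsilon>)))
           \<le> int (hodge P K n 0) + 1 - int (kappa P K)"
proof -
  interpret patchworked P K \<epsilon>
    by unfold_locales (use assms in \<open>auto simp: smooth_polytope_def\<close>)
  show ?thesis using betti2_plus_kappa_le[OF assms(2,1)] by simp
qed

end
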